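(* Consider a conservative Feller semi-group $(P_t)_{t\ge 0}$ on a Polish space $E$ and, for each $\nu\in\mathcal P(E)$, a jump rate $\lambda_\nu$ and a jump kernel $Q_\nu$ with representation $G_\nu$, as described in the context. Assume that there is $\lambda_*$ with $\lambda_\nu(x)\le\lambda_*$ for all $\nu\in\mathcal P(E)$, $x\in E$, and that there exist a measurable $\mathcal V:E\to[1,\infty)$, $\theta\ge0$, $\rho,t_0>0$, $\rho_*\in\mathbb R$, $\alpha\in[0,1]$, $\eta\in[0,1)$ and $M,\gamma_*\ge1$ such that: (i) for all $\mu\in\mathcal M(\mathbb R_+,\mathcal P(E))$, $x\in E$, $t\ge0$ and almost all $u\in[0,1]$, $$R^\mu_{0,t}\mathcal V(x)\le e^{-\rho t}\mathcal V(x)+\rho\int_0^te^{\rho(s-t)}\big(\eta\,\mu_s(\mathcal V)+M\big)ds,\qquad P_t\mathcal V(x)\le e^{\rho_*t}\mathcal V(x),\qquad \mathcal V(G_{\mu_t}(x,u))\le\gamma_*\mathcal V(x);$$ (ii) for all $\nu_1,\nu_2\in\mathcal P_{\mathcal V}(E)$, $$\sup_{\|f\|_\infty\le1}\|\lambda_{\nu_1}(Q_{\nu_1}f-f)-\lambda_{\nu_2}(Q_{\nu_2}f-f)\|_\infty\le\theta\|\nu_1-\nu_2\|_{\mathcal V};$$ (iii) for all $x,y\in E$ with $\mathcal V(x)+\mathcal V(y)\le8(1+M/(1-\eta))$, $\|\delta_xP_{t_0}-\delta_yP_{t_0}\|_{TV}\le2(1-\alpha)$. Then for all $m_0\in\mathcal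 P_{\mathcal V}(E)$ there exists a unique solution $t\mapsto m_t$ (in the sense of the context) of $$\partial_tm_t=L'm_t+Q'_{m_t}(\lambda_{m_t}m_t)-\lambda_{m_t}m_t$$ with initial condition $m_0$. Moreover, for all $t\ge0$, $$m_t(\mathcal V)\le e^{-\rho(1-\eta)t}m_0(\mathcal V)+\big(1-e^{-\rho(1-\eta)t}\big)\frac{M}{1-\eta}.$$
   Context: $E$ is a Polish space, $\mathcal P(E)$ the set of Borel probability measures on $E$, $\mathcal D(E)$ the set of càdlàg functions $\mathbb R_+\to E$ with the Skorokhod topology, $\|\nu_1-\nu_2\|_{TV}=\sup_{\|f\|_\infty\le1}|(\nu_1-\nu_2)(f)|$ (supremum over measurable $f$). For measurable $\mathcal V:E\to[1,\infty)$, $\mathcal P_{\mathcal V}(E)=\{\nu\in\mathcal P(E):\nu(\mathcal V)<\infty\}$ and $\|\mu-\nu\|_{\mathcal V}=|\mu-\nu|(\mathcal V)$ for $\mu,\nu\in\mathcal P_{\mathcal V}(E)$. $(P_t)_{t\ge0}$ is a conservative Feller semi-group on $E$ with generator $L$; for each $x\in E$, $(Z^x_t)_{t\ge0}$ is an associated càdlàg strong Markov process with $Z_0^x=x$ and $P_tf(x)=\mathbb E f(Z^x_t)$. $A'$ denotes the dual on measures of an operator $A$ on functions. For each $\nu\in\mathcal P(E)$, $\lambda_\nu:E\to\mathbb R_+$ is measurable and $Q_\nu$ is a Markov kernel on $E$ (also viewed as the operator $Q_\nu f(x)=\int f\,dQ_\nu(x)$). $G_\nu:E\times[0,1]\to E$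 is a representation of $Q_\nu$: if $U$ is uniform on $[0,1]$ then $G_\nu(x,U)\sim Q_\nu(x)$ for all $x$. Similarly $H:(x,u)\in E\times[0,1]\mapsto(H_t(x,u))_{t\ge0}\in\mathcal D(E)$ is a representation of $x\mapsto Law((Z^x_t)_{t\ge0})$. The maps $(\nu,x)\mapsto\lambda_\nu(x)$ and $(\nu,x,u)\mapsto G_\nu(x,u)$ are taken measurable so that the construction below makes sense. $\mathcal M(\mathbb R_+,\mathcal P(E))$ is the set of measurable functions $\mathbb R_+\to\mathcal P(E)$. Process $X^{\mu,x}$. Assume $\lambda_\nu(x)\le\lambda_*$ for all $\nu,x$. Let $\mu\in\mathcal M(\mathbb R_+,\mathcal P(E))$, $x\in E$, and let $(S_k,U_k,V_k,W_k)_{k\in\mathbb N}$ be i.i.d. with independent components, $S_k$ exponential of parameter 1 and $U_k,V_k,W_k$ uniform on $[0,1]$. Put $T_0=0$, $X_0^{\mu,x}=x$, $T_{n+1}=T_n+S_n/\lambda_*$. For $t\in(T_n,T_{n+1})$ put $X_t^{\mu,x}=H_{t-T_n}(X_{T_n}^{\mu,x},U_n)$. With $\tilde x=H_{S_n/\lambda_*}(X^{\mu,x}_{T_n},U_n)$: if $V_n\le\lambda_{\mu_{T_{n+1}}}(\tilde x)/\lambda_*$ put $X_{T_{n+1}}^{\mu,x}=G_{\mu_{T_{n+1}}}(\tilde x,W_n)$, otherwise put $X_{T_{n+1}}^{\mu,x}=\tilde x$. Set $R^\mu_{s,t}f(x)=\mathbb E f(X^{\sigma_s\mu,x}_{t-s})$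 for $0\le s\le t$ and $f$ bounded or nonnegative measurable, where $(\sigma_s\mu)_t=\mu_{s+t}$. A solution with initial distribution $m_0$ is an $m\in\mathcal M(\mathbb R_+,\mathcal P(E))$ such that $m_0R^m_{0,t}=m_t$ for all $t\ge0$. *)

theory Defs
  imports "HOL-Probability.Probability"
begin

section \<open>Cadlag paths and the Skorokhod topology\<close>

text \<open>Functions on the half-line are functions on \<open>real\<close> that are \<open>undefined\<close> at negative
  arguments, so that equality of such functions is equality on \<open>{0..}\<close>.\<close>

definition cadlag_paths :: "(real \<Rightarrow> 'a::topological_space) set" where
  "cadlag_paths = {w \<in> extensional {0..}.
     (\<forall>t\<ge>0. (w \<longlongrightarrow> w t) (at_right t)) \<and> (\<forall>t>0. \<exists>l. (w \<longlongrightarrow> l) (at_left t))}"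

text \<open>Time changes are increasing bijections of the half-line (hence continuous, and fixing 0).
  A sequence \<open>v n\<close> converges to \<open>w\<close> in the Skorokhod topology iff, for some time changes \<open>\<tau> n\<close>,
  \<open>\<tau> n\<close> converges to the identity and \<open>v n \<circ> \<tau> n\<close> converges to \<open>w\<close>, both uniformly on bounded
  intervals; equivalently, iff \<open>v n\<close> is eventually in each of the following sets. The Skorokhod
  topology being metrizable, these sets determine it.\<close>

definition skorokhod_nbhd ::
    "(real \<Rightarrow> 'a::metric_space) \<Rightarrow> real \<Rightarrow> real \<Rightarrow> (real \<Rightarrow> 'a) set" where
  "skorokhod_nbhd w N e = {v \<in> cadlag_paths. \<exists>\<tau>. bij_betw \<tau> {0..} {0..} \<and> strict_mono_on {0..} \<tau> \<and>
     (\<forall>t\<in>{0..N}. \<bar>\<tau> t - t\<bar> < e \<and> dist (v (\<tau> t)) (w t) < e)}"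

definition skorokhod_open :: "(real \<Rightarrow> 'a::metric_space) set \<Rightarrow> bool" where
  "skorokhod_open U \<longleftrightarrow> U \<subseteq> cadlag_paths \<and> (\<forall>w\<in>U. \<exists>N. \<exists>e>0. skorokhod_nbhd w N e \<subseteq> U)"

definition skorokhod_topology :: "(real \<Rightarrow> 'a::metric_space) topology" where
  "skorokhod_topology = topology skorokhod_open"

lemma skorokhod_nbhd_mono:
  assumes "N \<le> N'" "e' \<le> e"
  shows "skorokhod_nbhd w N' e' \<subseteq> skorokhod_nbhd w N e"
proof
  fix v assume "v \<in> skorokhod_nbhd w N' e'"
  then obtain \<tau> where v: "v \<in> cadlag_paths" and \<tau>: "bij_betw \<tau> {0..} {0..}" "strict_mono_on {0..} \<tau>"
    and d: "\<forall>t\<in>{0..N'}. \<bar>\<tau> t - t\<bar> < e' \<and> dist (v (\<tau> t)) (w t) < e'"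
    unfolding skorokhod_nbhd_def mem_Collect_eq by (elim conjE exE)
  have "\<forall>t\<in>{0..N}. \<bar>\<tau> t - t\<bar> < e \<and> dist (v (\<tau> t)) (w t) < e"
  proof
    fix t assume "t \<in> {0..N}"
    then have "t \<in> {0..N'}" using assms(1) by simp
    from bspec[OF d this] show "\<bar>\<tau> t - t\<bar> < e \<and> dist (v (\<tau> t)) (w t) < e"
      using assms(2) by linarith
  qed
  then show "v \<in> skorokhod_nbhd w N e"
    unfolding skorokhod_nbhd_def mem_Collect_eq by (intro conjI exI[of _ \<tau>] v \<tau>)
qed

lemma istopology_skorokhod_open: "istopology skorokhod_open"
  unfolding istopology_def
proof (intro conjI allI impI)
  fix S T :: "(real \<Rightarrow> 'a) set"
  assume S: "skorokhod_open S" and T: "skorokhod_open T"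
  show "skorokhod_open (S \<inter> T)"
    unfolding skorokhod_open_def
  proof (intro conjI ballI)
    show "S \<inter> T \<subseteq> cadlag_paths"
      using S unfolding skorokhod_open_def by (simp add: le_infI1)
    fix w assume w: "w \<in> S \<inter> T"
    obtain N1 e1 where 1: "e1 > 0" "skorokhod_nbhd w N1 e1 \<subseteq> S"
      using S IntD1[OF w] unfolding skorokhod_open_def by metis
    obtain N2 e2 where 2: "e2 > 0" "skorokhod_nbhd w N2 e2 \<subseteq> T"
      using T IntD2[OF w] unfolding skorokhod_open_def by metis
    have "skorokhod_nbhd w (max N1 N2) (min e1 e2) \<subseteq> S"
      by (rule subset_trans[OF skorokhod_nbhd_mono 1(2)]) simp_all
    moreover have "skorokhod_nbhd w (max N1 N2) (min e1 e2) \<subseteq> T"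
      by (rule subset_trans[OF skorokhod_nbhd_mono 2(2)]) simp_all
    ultimately have "skorokhod_nbhd w (max N1 N2) (min e1 e2) \<subseteq> S \<inter> T"
      by (rule Int_greatest)
    moreover have "min e1 e2 > 0" using 1(1) 2(1) by simp
    ultimately show "\<exists>N. \<exists>e>0. skorokhod_nbhd w N e \<subseteq> S \<inter> T"
      by (intro exI conjI)
  qed
next
  fix K :: "(real \<Rightarrow> 'a) set set"
  assume K: "\<forall>S\<in>K. skorokhod_open S"
  show "skorokhod_open (\<Union>K)"
    unfolding skorokhod_open_def
  proof (intro conjI ballI)
    show "\<Union>K \<subseteq> cadlag_paths"
      by (rule Union_least) (use K in \<open>simp add: skorokhod_open_def\<close>)
    fix w assume "w \<in> \<Union>K"
    then obtain S where S: "S \<in> K" "w \<in> S" by (elim UnionE)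
    then obtain N e where "e > 0" "skorokhod_nbhd w N e \<subseteq> S"
      using K unfolding skorokhod_open_def by metis
    then have "e > 0 \<and> skorokhod_nbhd w N e \<subseteq> \<Union>K"
      using Union_upper[OF S(1)] by (simp add: subset_trans)
    then show "\<exists>N. \<exists>e>0. skorokhod_nbhd w N e \<subseteq> \<Union>K"
      by (intro exI)
  qed
qed

lemma openin_skorokhod_topology: "openin skorokhod_topology = skorokhod_open"
  unfolding skorokhod_topology_def by (rule topology_inverse'[OF istopology_skorokhod_open])

lemma topspace_skorokhod_topology: "topspace skorokhod_topology = cadlag_paths"
proof (rule antisym)
  show "topspace skorokhod_topology \<subseteq> (cadlag_paths :: (real \<Rightarrow> 'a) set)"
    unfolding topspace_def openin_skorokhod_topology
    by (rule Union_least) (simp add: skorokhod_open_def)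
  have "skorokhod_nbhd w 0 1 \<subseteq> cadlag_paths" for w :: "real \<Rightarrow> 'a"
    unfolding skorokhod_nbhd_def by (rule Collect_restrict)
  then have "skorokhod_open (cadlag_paths :: (real \<Rightarrow> 'a) set)"
    unfolding skorokhod_open_def using zero_less_one by (metis subset_refl)
  then show "(cadlag_paths :: (real \<Rightarrow> 'a) set) \<subseteq> topspace skorokhod_topology"
    unfolding topspace_def openin_skorokhod_topology by (intro Union_upper) simp
qed

definition skorokhod_borel :: "(real \<Rightarrow> 'a::metric_space) measure" where
  "skorokhod_borel = sigma cadlag_paths {U. openin skorokhod_topology U}"

section \<open>Feller semigroups and associated strong Markov processes\<close>

text \<open>The semigroup is given by its transition kernels, the operator being
  \<open>f \<mapsto> (\<lambda>x. \<integral>y. f y \<partial>P t x)\<close>; it is conservative because the kernels are Markov kernels. On a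
  Polish space, which need not be locally compact, the Feller property refers to bounded
  continuous functions and to pointwise continuity at time 0.\<close>

definition feller_semigroup :: "(real \<Rightarrow> 'a::polish_space \<Rightarrow> 'a measure) \<Rightarrow> bool" where
  "feller_semigroup P \<longleftrightarrow>
     (\<forall>t\<ge>0. P t \<in> borel \<rightarrow>\<^sub>M prob_algebra borel) \<and>
     (\<forall>x. P 0 x = return borel x) \<and>
     (\<forall>s\<ge>0. \<forall>t\<ge>0. \<forall>x. P (s + t) x = P s x \<bind> P t) \<and>
     (\<forall>f :: 'a \<Rightarrow> real. continuous_on UNIV f \<and> bounded (range f) \<longrightarrow>
        (\<forall>t\<ge>0. continuous_on UNIV (\<lambda>x. \<integral>y. f y \<partial>P t x)) \<and>
        (\<forall>x. ((\<lambda>t. \<integral>y. f y \<partial>P t x) \<longlongrightarrow> f x) (at_right 0)))"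

text \<open>The time set of filtrations is \<open>[0, \<infinity>]\<close>, so that stopping times may be infinite.\<close>

definition natural_filtration ::
    "'w measure \<Rightarrow> ('w \<Rightarrow> real \<Rightarrow> 'a::topological_space) \<Rightarrow> ennreal \<Rightarrow> 'w measure" where
  "natural_filtration M Y t = sigma (space M)
     {(\<lambda>\<omega>. Y \<omega> s) -` A \<inter> space M | s A. 0 \<le> s \<and> ennreal s \<le> t \<and> A \<in> sets borel}"

definition strong_markov :: "(real \<Rightarrow> 'a::polish_space \<Rightarrow> 'a measure) \<Rightarrow> 'w measure \<Rightarrow>
    ('w \<Rightarrow> real \<Rightarrow> 'a) \<Rightarrow> bool" where
  "strong_markov P M Y \<longleftrightarrow>
     (\<forall>\<tau>. stopping_time (natural_filtration M Y) \<tau> \<longrightarrow>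
       (\<forall>t\<ge>0. \<forall>f :: 'a \<Rightarrow> real. f \<in> borel_measurable borel \<and> bounded (range f) \<longrightarrow>
         (AE \<omega> in M. \<tau> \<omega> < \<infinity> \<longrightarrow>
            real_cond_exp M (filtration.pre_sigma (space M) (natural_filtration M Y) \<tau>)
              (\<lambda>\<omega>. f (Y \<omega> (enn2real (\<tau> \<omega>) + t))) \<omega>
            = (\<integral>y. f y \<partial>P t (Y \<omega> (enn2real (\<tau> \<omega>)))))))"

definition associated_process :: "(real \<Rightarrow> 'a::polish_space \<Rightarrow> 'a measure) \<Rightarrow> 'a \<Rightarrow> 'w measure \<Rightarrow>
    ('w \<Rightarrow> real \<Rightarrow> 'a) \<Rightarrow> bool" where
  "associated_process P x M Y \<longleftrightarrow>
     prob_space M \<and> Y \<in> M \<rightarrow>\<^sub>M skorokhod_borel \<and> (\<forall>\<omega>\<in>space M. Y \<omega> 0 = x) \<and>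
     (\<forall>t\<ge>0. distr M borel (\<lambda>\<omega>. Y \<omega> t) = P t x) \<and> strong_markov P M Y"

section \<open>Representations\<close>

definition unit_uniform :: "real measure" where
  "unit_uniform = restrict_space lborel {0..1}"

definition is_representation ::
    "'x measure \<Rightarrow> 'y measure \<Rightarrow> ('x \<Rightarrow> real \<Rightarrow> 'y) \<Rightarrow> ('x \<Rightarrow> 'y measure) \<Rightarrow> bool" where
  "is_representation X Y g K \<longleftrightarrow>
     (\<lambda>(x, u). g x u) \<in> X \<Otimes>\<^sub>M restrict_space borel {0..1} \<rightarrow>\<^sub>M Y \<and>
     (\<forall>x\<in>space X. distr unit_uniform Y (g x) = K x)"

section \<open>Norms\<close>

definition sup_norm :: "('a \<Rightarrow> real) \<Rightarrow> ennreal" where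
  "sup_norm g = (SUP x. ennreal \<bar>g x\<bar>)"

definition unit_test_functions :: "('a::topological_space \<Rightarrow> real) set" where
  "unit_test_functions = {f \<in> borel_measurable borel. sup_norm f \<le> 1}"

definition tv_norm_diff :: "'a::topological_space measure \<Rightarrow> 'a measure \<Rightarrow> ennreal" where
  "tv_norm_diff \<mu> \<nu> = (SUP f\<in>unit_test_functions. ennreal \<bar>(\<integral>x. f x \<partial>\<mu>) - (\<integral>x. f x \<partial>\<nu>)\<bar>)"

text \<open>The total variation measure of the signed measure \<open>\<mu> - \<nu>\<close>, for finite \<open>\<mu>\<close> and \<open>\<nu>\<close>.\<close>

definition variation_measure :: "'a measure \<Rightarrow> 'a measure \<Rightarrow> 'a measure" where
  "variation_measure \<mu> \<nu> = measure_of (space \<mu>) (sets \<mu>) (\<lambda>A.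
     SUP \<C>\<in>{\<C>. finite \<C> \<and> \<C> \<subseteq> sets \<mu> \<and> disjoint \<C> \<and> \<Union>\<C> = A}.
       ennreal (\<Sum>B\<in>\<C>. \<bar>measure \<mu> B - measure \<nu> B\<bar>))"

definition weighted_norm_diff ::
    "('a \<Rightarrow> real) \<Rightarrow> 'a measure \<Rightarrow> 'a measure \<Rightarrow> ennreal" where
  "weighted_norm_diff V \<mu> \<nu> = (\<integral>\<^sup>+x. ennreal (V x) \<partial>variation_measure \<mu> \<nu>)"

definition weighted_probs :: "('a::topological_space \<Rightarrow> real) \<Rightarrow> 'a measure set" where
  "weighted_probs V = {\<nu> \<in> space (prob_algebra borel). (\<integral>\<^sup>+x. ennreal (V x) \<partial>\<nu>) < \<infinity>}"

section \<open>The jump process and the nonlinear equation\<close>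

definition measure_flows :: "(real \<Rightarrow> 'a::topological_space measure) set" where
  "measure_flows = (restrict_space borel {0..} \<rightarrow>\<^sub>M prob_algebra borel) \<inter> extensional {0..}"

definition shift_flow :: "real \<Rightarrow> (real \<Rightarrow> 'a measure) \<Rightarrow> real \<Rightarrow> 'a measure" where
  "shift_flow s \<mu> = (\<lambda>t\<in>{0..}. \<mu> (s + t))"

text \<open>The canonical space of i.i.d. sequences \<open>n \<mapsto> (S\<^sub>n, U\<^sub>n, V\<^sub>n, W\<^sub>n)\<close>.\<close>

type_synonym marks = "nat \<Rightarrow> real \<times> real \<times> real \<times> real"

definition mark_space :: "marks measure" where
  "mark_space = (\<Pi>\<^sub>M n\<in>UNIV.
     restrict_space (density lborel (\<lambda>s. ennreal (exponential_density 1 s))) {0..} \<Otimes>\<^sub>M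
       (unit_uniform \<Otimes>\<^sub>M (unit_uniform \<Otimes>\<^sub>M unit_uniform)))"

primrec jump_time :: "real \<Rightarrow> marks \<Rightarrow> nat \<Rightarrow> real" where
  "jump_time l \<omega> 0 = 0"
| "jump_time l \<omega> (Suc n) = jump_time l \<omega> n + fst (\<omega> n) / l"

primrec jump_position :: "real \<Rightarrow> ('a measure \<Rightarrow> 'a \<Rightarrow> real) \<Rightarrow> ('a measure \<Rightarrow> 'a \<Rightarrow> real \<Rightarrow> 'a) \<Rightarrow>
    ('a \<Rightarrow> real \<Rightarrow> real \<Rightarrow> 'a) \<Rightarrow> (real \<Rightarrow> 'a measure) \<Rightarrow> 'a \<Rightarrow> marks \<Rightarrow> nat \<Rightarrow> 'a" where
  "jump_position l lam G H \<mu> x \<omega> 0 = x"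
| "jump_position l lam G H \<mu> x \<omega> (Suc n) =
     (let (s, u, v, w) = \<omega> n;
          \<nu> = \<mu> (jump_time l \<omega> (Suc n));
          y = H (jump_position l lam G H \<mu> x \<omega> n) u (s / l)
      in if v \<le> lam \<nu> y / l then G \<nu> y w else y)"

text \<open>The index \<open>n\<close> is the one with \<open>T\<^sub>n \<le> t < T\<^sub>n\<^sub>+\<^sub>1\<close>; almost surely it exists.\<close>

definition jump_process :: "real \<Rightarrow> ('a measure \<Rightarrow> 'a \<Rightarrow> real) \<Rightarrow> ('a measure \<Rightarrow> 'a \<Rightarrow> real \<Rightarrow> 'a) \<Rightarrow>
    ('a \<Rightarrow> real \<Rightarrow> real \<Rightarrow> 'a) \<Rightarrow> (real \<Rightarrow> 'a measure) \<Rightarrow> 'a \<Rightarrow> marks \<Rightarrow> real \<Rightarrow> 'a" where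
  "jump_process l lam G H \<mu> x \<omega> t =
     (let n = (LEAST n. t < jump_time l \<omega> (Suc n));
          y = jump_position l lam G H \<mu> x \<omega> n
      in if t = jump_time l \<omega> n then y
         else H y (fst (snd (\<omega> n))) (t - jump_time l \<omega> n))"

text \<open>The transition kernel whose action on functions is \<open>R\<^sup>\<mu>\<^sub>s\<^sub>,\<^sub>t f(x) = E f(X\<^sub>t\<^sub>-\<^sub>s)\<close> for the process
  \<open>X\<close> started at \<open>x\<close> and driven by the shifted flow.\<close>

definition jump_kernel :: "real \<Rightarrow> ('a measure \<Rightarrow> 'a \<Rightarrow> real) \<Rightarrow>
    ('a measure \<Rightarrow> 'a \<Rightarrow> real \<Rightarrow> 'a) \<Rightarrow> ('a \<Rightarrow> real \<Rightarrow> real \<Rightarrow> 'a) \<Rightarrow> (real \<Rightarrow> 'a measure) \<Rightarrow>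
    real \<Rightarrow> real \<Rightarrow> 'a::topological_space \<Rightarrow> 'a measure" where
  "jump_kernel l lam G H \<mu> s t x =
     distr mark_space borel (\<lambda>\<omega>. jump_process l lam G H (shift_flow s \<mu>) x \<omega> (t - s))"

text \<open>Solutions of \<open>\<partial>\<^sub>t m\<^sub>t = L' m\<^sub>t + Q'\<^sub>m\<^sub>t (\<lambda>\<^sub>m\<^sub>t m\<^sub>t) - \<lambda>\<^sub>m\<^sub>t m\<^sub>t\<close> with initial condition \<open>m0\<close>,
  understood through the time-inhomogeneous kernels of the process driven by \<open>m\<close> itself.\<close>

definition is_solution :: "real \<Rightarrow> ('a measure \<Rightarrow> 'a \<Rightarrow> real) \<Rightarrow>
    ('a measure \<Rightarrow> 'a \<Rightarrow> real \<Rightarrow> 'a) \<Rightarrow> ('a \<Rightarrow> real \<Rightarrow> real \<Rightarrow> 'a) \<Rightarrow>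
    'a::topological_space measure \<Rightarrow> (real \<Rightarrow> 'a measure) \<Rightarrow> bool" where
  "is_solution l lam G H m0 m \<longleftrightarrow>
     m \<in> measure_flows \<and> m 0 = m0 \<and> (\<forall>t\<ge>0. m0 \<bind> jump_kernel l lam G H m 0 t = m t)"

end

theory Submission
  imports Defs
begin

text \<open>A solution with initial distribution \<open>m0\<close> is a fixed point of the map that sends a flow \<open>\<mu>\<close> to
  the flow of laws at time \<open>t\<close> of the process driven by \<open>\<mu>\<close> and started from \<open>m0\<close>. On every bounded
  time interval this map is a contraction for the supremum over time of the \<open>V\<close>-weighted distance,
  multiplied by \<open>exp (- \<beta> * t)\<close> with \<open>\<beta>\<close> large (\<open>evolve_contraction\<close>). The Picard iterates
  therefore converge, their limit is a solution (\<open>solution_exists\<close>), and there is no other one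
  (\<open>solution_unique\<close>).

  Two estimates on the kernels yield the contraction. First, whatever the driving flow, the
  expectation of \<open>V\<close> grows at most exponentially (\<open>killed_growth\<close>), since \<open>V\<close> grows at a bounded
  rate between the marks and almost surely at most by the factor \<open>\<gamma>\<close> at each of them. Second, if two
  flows are at distance \<open>exp (\<beta> * r)\<close> at time \<open>r\<close>, then their kernels up to time \<open>t\<close> differ, as
  functionals on test functions below \<open>V\<close>, by at most \<open>exp (\<beta> * t) * V\<close> times a factor of order
  \<open>1 / \<beta>\<close> (\<open>killed_comparison\<close>). The assumed Lipschitz bound concerns test functions bounded by 1,
  but a jump from \<open>y\<close> almost surely ends in the set where \<open>V \<le> \<gamma> * V y\<close>, on which a test function
  below \<open>V\<close> is bounded (\<open>jump_operator_lipschitz\<close>). Both estimates are proved by conditioning on the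
  first mark and by induction on the number of marks that have been used; the number of marks up to
  a given time is almost surely finite.

  Distances are expressed by the relation \<open>weighted_close\<close>, that is, by tests with nonnegative
  functions below \<open>V\<close>. It controls the weighted variation norm by a Hahn decomposition
  (\<open>weighted_norm_diff_le\<close>), and probability measures are complete for it
  (\<open>setwise_limit_exists\<close>, \<open>weighted_close_limit\<close>). The kernels are measurable because evaluation at
  a time is Borel measurable for the Skorokhod topology (\<open>measurable_evaluation\<close>).

  The moment bound follows from the drift condition along the solution itself, a linear integral
  inequality for the moment: each application of it reduces by the factor \<open>\<eta>\<close> the amount by which
  the moment may exceed the asserted bound (\<open>drift_inequality_bound\<close>).\<close>

section \<open>Evaluating Skorokhod paths\<close>

lemma skorokhod_open_sets_into_paths:
  "{U. openin skorokhod_topology U} \<subseteq> Pow (cadlag_paths :: (real \<Rightarrow> 'a::metric_space) set)"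
  using openin_subset[of skorokhod_topology] by (auto simp: topspace_skorokhod_topology)

lemma space_skorokhod_borel: "space skorokhod_borel = cadlag_paths"
  unfolding skorokhod_borel_def using skorokhod_open_sets_into_paths by (rule space_measure_of)

lemma sets_skorokhod_borel:
  "sets skorokhod_borel = sigma_sets cadlag_paths {U. openin skorokhod_topology U}"
  unfolding skorokhod_borel_def using skorokhod_open_sets_into_paths by (rule sets_measure_of)

text \<open>A small time change keeps a visit to \<open>U\<close> at an interior time of the interval inside this
  interval, and a small perturbation of the value keeps it in \<open>U\<close>.\<close>

lemma skorokhod_open_hits_open:
  fixes U :: "'a::metric_space set"
  assumes "open U" "0 \<le> a"
  shows "skorokhod_open {w \<in> cadlag_paths. \<exists>s\<in>{a<..<b}. w s \<in> U}"
  unfolding skorokhod_open_def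
proof (intro conjI ballI)
  fix w assume "w \<in> {w \<in> cadlag_paths. \<exists>s\<in>{a<..<b}. w s \<in> U}"
  then obtain s where s: "a < s" "s < b" "w s \<in> U" by auto
  then obtain r where r: "r > 0" "ball (w s) r \<subseteq> U"
    using assms(1) open_contains_ball by blast
  define e where "e = min r (min (s - a) (b - s))"
  have "v \<in> {w \<in> cadlag_paths. \<exists>s\<in>{a<..<b}. w s \<in> U}" if v: "v \<in> skorokhod_nbhd w s e" for v
  proof -
    obtain \<tau> where \<tau>: "\<And>t. t \<in> {0..s} \<Longrightarrow> \<bar>\<tau> t - t\<bar> < e \<and> dist (v (\<tau> t)) (w t) < e"
      using v unfolding skorokhod_nbhd_def by blast
    have "\<bar>\<tau> s - s\<bar> < e" "dist (v (\<tau> s)) (w s) < e"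
      using \<tau>[of s] s(1) assms(2) by auto
    then have "\<tau> s \<in> {a<..<b}" "v (\<tau> s) \<in> U"
      using r(2) by (auto simp: e_def dist_commute subset_iff)
    then show ?thesis
      using v unfolding skorokhod_nbhd_def by blast
  qed
  moreover have "e > 0"
    using r s by (simp add: e_def)
  ultimately show "\<exists>N. \<exists>e>0. skorokhod_nbhd w N e \<subseteq> {w \<in> cadlag_paths. \<exists>s\<in>{a<..<b}. w s \<in> U}"
    by (intro exI[of _ s] exI[of _ e]) auto
qed auto

text \<open>The path is in \<open>U\<close> at time \<open>t\<close> iff it stays, right after \<open>t\<close>, in one of the closed sets of
  points at distance at least \<open>1/(k+1)\<close> from the complement of \<open>U\<close>; the paths that leave a closed
  set during an open time interval form a Skorokhod open set.\<close>

lemma measurable_evaluation_at: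
  assumes "0 \<le> t"
  shows "(\<lambda>w. w t) \<in> skorokhod_borel \<rightarrow>\<^sub>M (borel :: 'a::metric_space measure)"
proof (rule borel_measurableI)
  fix U :: "'a set" assume "open U"
  define C where "C k = - (\<Union>y\<in>-U. ball y (1 / real (Suc k)))" for k
  define E where "E k n = {w \<in> cadlag_paths. \<exists>s\<in>{t<..<t + 1 / real (Suc n)}. w s \<in> - C k}" for k n
  have clC: "closed (C k)" for k
    unfolding C_def closed_def by auto
  have E[measurable]: "E k n \<in> sets skorokhod_borel" for k n
    unfolding E_def sets_skorokhod_borel
    using skorokhod_open_hits_open[of "- C k" t] clC[of k] assms
    by (intro sigma_sets.Basic) (auto simp: openin_skorokhod_topology open_closed)
  have iff: "w t \<in> U \<longleftrightarrow> (\<exists>k n. w \<notin> E k n)" if w: "w \<in> cadlag_paths" for w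
  proof
    assume "w t \<in> U"
    then obtain r where r: "r > 0" "ball (w t) r \<subseteq> U"
      using \<open>open U\<close> open_contains_ball by blast
    obtain k where k: "1 / real (Suc k) < r / 2"
      using r(1) nat_approx_posE[of "r/2"] by auto
    have "(w \<longlongrightarrow> w t) (at_right t)"
      using w assms unfolding cadlag_paths_def by auto
    then have "\<forall>\<^sub>F s in at_right t. dist (w s) (w t) < r / 2"
      using r(1) by (intro tendstoD) auto
    then obtain b where b: "b > t" "\<And>s. t < s \<Longrightarrow> s < b \<Longrightarrow> dist (w s) (w t) < r / 2"
      unfolding eventually_at_right_field by blast
    obtain n where n: "1 / real (Suc n) < b - t"
      using b(1) nat_approx_posE[of "b - t"] by auto
    have "w s \<in> C k" if s: "s \<in> {t<..<t + 1 / real (Suc n)}" for s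
    proof (rule ccontr)
      assume "w s \<notin> C k"
      then obtain y where y: "y \<notin> U" "dist y (w s) < 1 / real (Suc k)"
        unfolding C_def by auto
      have "dist (w s) (w t) < r / 2"
        using s n by (intro b(2)) auto
      then have "dist (w t) y < r"
        using y(2) k dist_triangle[of "w t" y "w s"] by (simp add: dist_commute)
      then show False
        using r(2) y(1) by auto
    qed
    then have "w \<notin> E k n" unfolding E_def by blast
    then show "\<exists>k n. w \<notin> E k n" by blast
  next
    assume "\<exists>k n. w \<notin> E k n"
    then obtain k n where "w \<notin> E k n" by blast
    then have *: "\<And>s. s \<in> {t<..<t + 1 / real (Suc n)} \<Longrightarrow> w s \<in> C k"
      using w unfolding E_def by blast
    have "(w \<longlongrightarrow> w t) (at_right t)"
      using w assms unfolding cadlag_paths_def by auto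
    moreover have "\<forall>\<^sub>F s in at_right t. w s \<in> C k"
      unfolding eventually_at_right_field
      by (rule exI[of _ "t + 1 / real (Suc n)"]) (auto intro: *)
    ultimately have "w t \<in> C k"
      using clC by (intro Lim_in_closed_set[of "C k" w "at_right t"]) auto
    then show "w t \<in> U"
      unfolding C_def by force
  qed
  have "(\<lambda>w. w t) -` U \<inter> space skorokhod_borel = (\<Union>k n. space skorokhod_borel - E k n)"
    using iff by (auto simp: space_skorokhod_borel)
  also have "\<dots> \<in> sets skorokhod_borel" by measurable
  finally show "(\<lambda>w. w t) -` U \<inter> space skorokhod_borel \<in> sets skorokhod_borel" .
qed

text \<open>By right-continuity the value at \<open>t\<close> is the limit of the values at the next points of ever
  finer grids, which involve countably many times only.\<close>

lemma measurable_evaluation: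
  assumes [measurable]: "w \<in> N \<rightarrow>\<^sub>M skorokhod_borel" "t \<in> borel_measurable N"
  shows "(\<lambda>z. w z (t z)) \<in> N \<rightarrow>\<^sub>M (borel :: 'a::metric_space measure)"
proof -
  define g where "g n r = (real_of_int \<lfloor>r * real (Suc n)\<rfloor> + 1) / real (Suc n)" for n r
  have above: "r < g n r" "g n r \<le> r + 1 / real (Suc n)" for n and r :: real
  proof -
    have "r * real (Suc n) < real_of_int \<lfloor>r * real (Suc n)\<rfloor> + 1" by linarith
    then show "r < g n r"
      unfolding g_def by (subst pos_less_divide_eq) auto
    have "real_of_int \<lfloor>r * real (Suc n)\<rfloor> + 1 \<le> r * real (Suc n) + 1" by linarith
    then have "g n r \<le> (r * real (Suc n) + 1) / real (Suc n)"
      unfolding g_def by (rule divide_right_mono) simp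
    also have "\<dots> = r + 1 / real (Suc n)" by (simp add: add_divide_distrib)
    finally show "g n r \<le> r + 1 / real (Suc n)" .
  qed
  define v where "v n z = (if t z < 0 then undefined else w z (g n (t z)))" for n z
  have path: "w z \<in> cadlag_paths" if "z \<in> space N" for z
    using measurable_space[OF assms(1) that] by (simp add: space_skorokhod_borel)
  have [measurable]: "(\<lambda>z. w z (max 0 ((real_of_int i + 1) / real (Suc n)))) \<in> N \<rightarrow>\<^sub>M borel" for i n
    by (rule measurable_compose[OF assms(1) measurable_evaluation_at]) simp
  have "(\<lambda>z. w z (max 0 ((real_of_int \<lfloor>t z * real (Suc n)\<rfloor> + 1) / real (Suc n)))) \<in> N \<rightarrow>\<^sub>M borel" for n
    by (rule measurable_compose_countable[where g="\<lambda>z. \<lfloor>t z * real (Suc n)\<rfloor>"]) measurable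
  then have [measurable]: "(\<lambda>z. w z (max 0 (g n (t z)))) \<in> N \<rightarrow>\<^sub>M borel" for n
    by (simp add: g_def)
  have "v n = (\<lambda>z. if t z < 0 then undefined else w z (max 0 (g n (t z))))" for n
  proof
    fix z show "v n z = (if t z < 0 then undefined else w z (max 0 (g n (t z))))"
      using above(1)[of "t z" n] by (auto simp: v_def max_def)
  qed
  then have "v n \<in> N \<rightarrow>\<^sub>M borel" for n by simp
  moreover have "(\<lambda>n. v n z) \<longlonglongrightarrow> w z (t z)" if z: "z \<in> space N" for z
  proof (cases "t z < 0")
    case True
    then show ?thesis
      using path[OF z] by (auto simp: v_def cadlag_paths_def extensional_def)
  next
    case False
    then have "(w z \<longlongrightarrow> w z (t z)) (at_right (t z))"
      using path[OF z] by (auto simp: cadlag_paths_def)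
    moreover have "filterlim (\<lambda>n. g n (t z)) (at_right (t z)) sequentially"
      unfolding filterlim_at
    proof
      have "(\<lambda>n. t z + 1 / real (Suc n)) \<longlonglongrightarrow> t z + 0"
        by (intro tendsto_intros LIMSEQ_Suc[OF lim_1_over_n])
      then have upper: "(\<lambda>n. t z + 1 / real (Suc n)) \<longlonglongrightarrow> t z" by simp
      show "(\<lambda>n. g n (t z)) \<longlonglongrightarrow> t z"
      proof (rule tendsto_sandwich[OF _ _ tendsto_const upper])
        show "\<forall>\<^sub>F n in sequentially. t z \<le> g n (t z)"
          by (intro always_eventually allI less_imp_le above(1))
        show "\<forall>\<^sub>F n in sequentially. g n (t z) \<le> t z + 1 / real (Suc n)"
          by (intro always_eventually allI above(2))
      qed
      show "\<forall>\<^sub>F n in sequentially. g n (t z) \<in> {t z<..} \<and> g n (t z) \<noteq> t z"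
        using above(1)[of "t z"] by (intro always_eventually allI) (metis greaterThan_iff less_irrefl)
    qed
    ultimately have "(\<lambda>n. w z (g n (t z))) \<longlonglongrightarrow> w z (t z)"
      by (rule filterlim_compose)
    then show ?thesis
      using False by (simp add: v_def)
  qed
  ultimately show ?thesis
    by (rule borel_measurable_LIMSEQ_metric)
qed

section \<open>The marks\<close>

text \<open>The factors of \<^const>\<open>mark_space\<close>, named so that integrals over a single mark can be
  written one variable at a time.\<close>

definition exponential_law :: "real measure" where
  "exponential_law = restrict_space (density lborel (\<lambda>s. ennreal (exponential_density 1 s))) {0..}"

definition mark_law :: "(real \<times> real \<times> real \<times> real) measure" where
  "mark_law = exponential_law \<Otimes>\<^sub>M (unit_uniform \<Otimes>\<^sub>M (unit_uniform \<Otimes>\<^sub>M unit_uniform))"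

lemma mark_space_eq: "mark_space = (\<Pi>\<^sub>M n\<in>UNIV. mark_law)"
  unfolding mark_space_def mark_law_def exponential_law_def ..

lemma sets_unit_uniform: "sets unit_uniform = sets (restrict_space borel {0..1})"
  unfolding unit_uniform_def by (simp add: sets_restrict_space)

lemma space_unit_uniform: "space unit_uniform = {0..1}"
  unfolding unit_uniform_def by (simp add: space_restrict_space)

lemma prob_space_unit_uniform: "prob_space unit_uniform"
  by (rule prob_spaceI) (simp add: unit_uniform_def emeasure_restrict_space space_restrict_space)

lemma sets_exponential_law: "sets exponential_law = sets (restrict_space borel {0..})"
  unfolding exponential_law_def by (simp add: sets_restrict_space)

lemma space_exponential_law: "space exponential_law = {0..}"
  unfolding exponential_law_def by (simp add: space_restrict_space)

lemma nn_integral_exponential_law: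
  assumes "f \<in> borel_measurable borel"
  shows "(\<integral>\<^sup>+s. f s \<partial>exponential_law) = (\<integral>\<^sup>+s. ennreal (exp (- s)) * f s * indicator {0..} s \<partial>lborel)"
proof -
  have "(\<integral>\<^sup>+s. f s \<partial>exponential_law)
      = (\<integral>\<^sup>+s. ennreal (exponential_density 1 s) * (f s * indicator {0..} s) \<partial>lborel)"
    unfolding exponential_law_def using assms
    by (subst nn_integral_restrict_space) (auto simp: nn_integral_density)
  also have "\<dots> = (\<integral>\<^sup>+s. ennreal (exp (- s)) * f s * indicator {0..} s \<partial>lborel)"
    by (intro nn_integral_cong) (auto simp: exponential_density_def indicator_def)
  finally show ?thesis .
qed

lemma nn_integral_exponential_law_exp:
  assumes "0 \<le> p"
  shows "(\<integral>\<^sup>+s. ennreal (exp (- p * s)) \<partial>exponential_law) = ennreal (1 / (1 + p))"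
proof -
  have "(\<integral>\<^sup>+s. ennreal (exp (- p * s)) \<partial>exponential_law)
      = (\<integral>\<^sup>+s. ennreal (exp (- (1 + p) * s)) * indicator {0..} s \<partial>lborel)"
    by (subst nn_integral_exponential_law)
      (auto intro!: nn_integral_cong simp: ennreal_mult[symmetric] exp_add[symmetric] algebra_simps)
  also have "\<dots> = ennreal (0 - (- exp (- (1 + p) * 0) / (1 + p)))"
  proof (rule nn_integral_FTC_atLeast)
    show "DERIV (\<lambda>s. - exp (- (1 + p) * s) / (1 + p)) s :> exp (- (1 + p) * s)" for s
      using assms by (auto intro!: derivative_eq_intros simp: divide_simps) (simp add: algebra_simps)
    have "((\<lambda>s. exp (- ((1 + p) * s))) \<longlongrightarrow> 0) at_top"
      using assms
      by (intro filterlim_compose[OF exp_at_bot] filterlim_compose[OF filterlim_uminus_at_bot_at_top]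
          filterlim_tendsto_pos_mult_at_top[OF tendsto_const _ filterlim_ident]) auto
    from tendsto_mult_left[OF this, of "- 1 / (1 + p)"]
    show "((\<lambda>s. - exp (- (1 + p) * s) / (1 + p)) \<longlongrightarrow> 0) at_top"
      by (simp add: algebra_simps)
  qed auto
  finally show ?thesis by simp
qed

lemma prob_space_exponential_law: "prob_space exponential_law"
  using nn_integral_exponential_law_exp[of 0] by (intro prob_spaceI) simp

lemma exponential_law_pos: "AE a in exponential_law. 0 < a"
proof (rule AE_I)
  have "emeasure exponential_law {0} = (\<integral>\<^sup>+a. indicator {0} a \<partial>exponential_law)"
    by (subst nn_integral_indicator) (auto simp: sets_exponential_law sets_restrict_space_iff)
  also have "\<dots> = (\<integral>\<^sup>+a. indicator {0} a \<partial>(lborel :: real measure))"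
  proof (subst nn_integral_exponential_law)
    show "(\<integral>\<^sup>+s. ennreal (exp (- s)) * indicator {0} s * indicator {0..} s \<partial>lborel)
        = (\<integral>\<^sup>+s. indicator {0} s \<partial>(lborel :: real measure))"
      by (rule nn_integral_cong) (auto simp: indicator_def)
  qed simp
  finally show "emeasure exponential_law {0} = 0" by simp
qed (auto simp: space_exponential_law sets_exponential_law sets_restrict_space_iff)

lemma prob_space_mark_law: "prob_space mark_law"
  unfolding mark_law_def
  by (intro prob_space_pair prob_space_exponential_law prob_space_unit_uniform)

interpretation marks: sequence_space mark_law
  by (intro sequence_space.intro product_prob_spaceI prob_space_mark_law)

lemma prob_space_mark_space: "prob_space mark_space"
  unfolding mark_space_eq by (rule marks.P.prob_space_axioms)

lemma space_mark_law: "space mark_law = {0..} \<times> {0..1} \<times> {0..1} \<times> {0..1}"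
  unfolding mark_law_def by (simp add: space_pair_measure space_exponential_law space_unit_uniform)

lemma mark_in_mark_law: "\<omega> \<in> space mark_space \<Longrightarrow> \<omega> n \<in> space mark_law"
  unfolding mark_space_eq by (auto simp: space_PiM PiE_iff)

lemma first_mark_nonneg: "\<omega> \<in> space mark_space \<Longrightarrow> 0 \<le> fst (\<omega> n)"
  using mark_in_mark_law[of \<omega> n] by (auto simp: space_mark_law)

lemma measurable_mark_law_components:
  assumes "m \<in> N \<rightarrow>\<^sub>M mark_law"
  shows "(\<lambda>z. fst (m z)) \<in> N \<rightarrow>\<^sub>M exponential_law"
    "(\<lambda>z. fst (snd (m z))) \<in> N \<rightarrow>\<^sub>M unit_uniform"
    "(\<lambda>z. fst (snd (snd (m z)))) \<in> N \<rightarrow>\<^sub>M unit_uniform"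
    "(\<lambda>z. snd (snd (snd (m z)))) \<in> N \<rightarrow>\<^sub>M unit_uniform"
proof -
  note [measurable] = assms[unfolded mark_law_def]
  show "(\<lambda>z. fst (m z)) \<in> N \<rightarrow>\<^sub>M exponential_law"
    "(\<lambda>z. fst (snd (m z))) \<in> N \<rightarrow>\<^sub>M unit_uniform"
    "(\<lambda>z. fst (snd (snd (m z)))) \<in> N \<rightarrow>\<^sub>M unit_uniform"
    "(\<lambda>z. snd (snd (snd (m z)))) \<in> N \<rightarrow>\<^sub>M unit_uniform"
    by measurable
qed

lemma measurable_exponential_law_from_borel:
  "f \<in> borel \<rightarrow>\<^sub>M M \<Longrightarrow> f \<in> exponential_law \<rightarrow>\<^sub>M M"
  by (simp add: sets_exponential_law measurable_restrict_space1 cong: measurable_cong_sets)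

lemma measurable_from_exponential_law:
  assumes "f \<in> N \<rightarrow>\<^sub>M exponential_law" shows "f \<in> borel_measurable N"
proof -
  have "f \<in> N \<rightarrow>\<^sub>M restrict_space borel {0..}"
    using assms by (simp cong: measurable_cong_sets add: sets_exponential_law)
  then show ?thesis by (simp add: measurable_restrict_space2_iff)
qed

lemma measurable_from_unit_uniform:
  assumes "f \<in> N \<rightarrow>\<^sub>M unit_uniform"
  shows "f \<in> borel_measurable N" "f \<in> N \<rightarrow>\<^sub>M restrict_space borel {0..1}"
proof -
  show "f \<in> N \<rightarrow>\<^sub>M restrict_space borel {0..1}"
    using assms by (simp cong: measurable_cong_sets add: sets_unit_uniform)
  then show "f \<in> borel_measurable N" by (simp add: measurable_restrict_space2_iff)
qed

lemma measurable_mark: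
  assumes "\<omega> \<in> N \<rightarrow>\<^sub>M mark_space" shows "(\<lambda>z. \<omega> z n) \<in> N \<rightarrow>\<^sub>M mark_law"
  by (rule measurable_compose[OF assms]) (simp add: mark_space_eq)

lemma measurable_jump_time:
  assumes "\<omega> \<in> N \<rightarrow>\<^sub>M mark_space"
  shows "(\<lambda>z. jump_time l (\<omega> z) n) \<in> borel_measurable N"
proof (induction n)
  case (Suc n)
  have "(\<lambda>z. fst (\<omega> z n)) \<in> borel_measurable N"
    by (intro measurable_from_exponential_law measurable_mark_law_components measurable_mark assms)
  with Suc show ?case by simp
qed simp

lemma jump_time_mono:
  assumes "\<omega> \<in> space mark_space" "0 < l" "n \<le> k"
  shows "jump_time l \<omega> n \<le> jump_time l \<omega> k"
  using assms(3)
proof (induction k rule: dec_induct)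
  case (step k)
  then show ?case using first_mark_nonneg[OF assms(1), of k] assms(2) by (simp add: add_increasing2)
qed simp

lemma jump_time_nonneg: "\<omega> \<in> space mark_space \<Longrightarrow> 0 < l \<Longrightarrow> 0 \<le> jump_time l \<omega> n"
  using jump_time_mono[of \<omega> l 0 n] by simp

text \<open>The marks form an i.i.d. sequence, so the sequence obtained by putting a fresh mark in front
  of it has the same law.\<close>

lemma nn_integral_first_mark:
  assumes F: "F \<in> borel_measurable mark_space"
  shows "(\<integral>\<^sup>+\<omega>. F \<omega> \<partial>mark_space) =
    (\<integral>\<^sup>+a. \<integral>\<^sup>+u. \<integral>\<^sup>+v. \<integral>\<^sup>+w. \<integral>\<^sup>+\<omega>. F (case_nat (a, u, v, w) \<omega>) \<partial>mark_space \<partial>unit_uniform \<partial>unit_uniform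
       \<partial>unit_uniform \<partial>exponential_law)"
proof -
  interpret U: prob_space unit_uniform by (rule prob_space_unit_uniform)
  interpret UU: prob_space "unit_uniform \<Otimes>\<^sub>M unit_uniform"
    by (intro prob_space_pair prob_space_unit_uniform)
  interpret UUU: prob_space "unit_uniform \<Otimes>\<^sub>M (unit_uniform \<Otimes>\<^sub>M unit_uniform)"
    by (intro prob_space_pair prob_space_unit_uniform)
  interpret S: prob_space mark_space by (rule prob_space_mark_space)
  define f where "f m = (\<integral>\<^sup>+\<omega>. F (case_nat m \<omega>) \<partial>mark_space)" for m
  have case_nat_measurable: "(\<lambda>z. case_nat (fst z) (snd z)) \<in> mark_law \<Otimes>\<^sub>M mark_space \<rightarrow>\<^sub>M mark_space"
    unfolding mark_space_eq by (intro measurable_case_nat') measurable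
  have F'[measurable]: "(\<lambda>z. F (case_nat (fst z) (snd z))) \<in> borel_measurable (mark_law \<Otimes>\<^sub>M mark_space)"
    by (rule measurable_compose[OF case_nat_measurable F])
  have f[measurable]: "f \<in> borel_measurable (exponential_law \<Otimes>\<^sub>M (unit_uniform \<Otimes>\<^sub>M (unit_uniform \<Otimes>\<^sub>M unit_uniform)))"
    unfolding f_def mark_law_def[symmetric]
    by (rule S.borel_measurable_nn_integral) (use F' in \<open>simp add: split_beta'\<close>)
  have "(\<integral>\<^sup>+\<omega>. F \<omega> \<partial>mark_space) = (\<integral>\<^sup>+z. F (case_nat (fst z) (snd z)) \<partial>(mark_law \<Otimes>\<^sub>M mark_space))"
    using case_nat_measurable F
    by (subst marks.PiM_iter[symmetric, folded mark_space_eq], subst nn_integral_distr) (auto simp: split_beta')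
  also have "\<dots> = (\<integral>\<^sup>+m. f m \<partial>mark_law)"
    unfolding f_def by (subst S.nn_integral_fst[symmetric, OF F']) simp
  also have "\<dots> = (\<integral>\<^sup>+a. \<integral>\<^sup>+u. \<integral>\<^sup>+v. \<integral>\<^sup>+w. f (a, u, v, w) \<partial>unit_uniform \<partial>unit_uniform \<partial>unit_uniform \<partial>exponential_law)"
    unfolding mark_law_def UUU.nn_integral_fst[OF f, symmetric]
  proof (rule nn_integral_cong)
    fix a assume a: "a \<in> space exponential_law"
    have fa: "(\<lambda>r. f (a, r)) \<in> borel_measurable (unit_uniform \<Otimes>\<^sub>M (unit_uniform \<Otimes>\<^sub>M unit_uniform))"
      using a f by measurable
    show "(\<integral>\<^sup>+r. f (a, r) \<partial>(unit_uniform \<Otimes>\<^sub>M (unit_uniform \<Otimes>\<^sub>M unit_uniform)))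
      = (\<integral>\<^sup>+u. \<integral>\<^sup>+v. \<integral>\<^sup>+w. f (a, u, v, w) \<partial>unit_uniform \<partial>unit_uniform \<partial>unit_uniform)"
      unfolding UU.nn_integral_fst[OF fa, symmetric]
    proof (rule nn_integral_cong)
      fix u assume "u \<in> space unit_uniform"
      then have fu: "(\<lambda>r. f (a, u, r)) \<in> borel_measurable (unit_uniform \<Otimes>\<^sub>M unit_uniform)"
        using fa by measurable
      show "(\<integral>\<^sup>+r. f (a, u, r) \<partial>(unit_uniform \<Otimes>\<^sub>M unit_uniform))
        = (\<integral>\<^sup>+v. \<integral>\<^sup>+w. f (a, u, v, w) \<partial>unit_uniform \<partial>unit_uniform)"
        by (rule U.nn_integral_fst[OF fu, symmetric])
    qed
  qed
  finally show ?thesis unfolding f_def .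
qed

text \<open>Since \<open>E exp (- T\<^sub>n)\<close> is the \<open>n\<close>-th power of a number below 1, the jump times do not
  accumulate.\<close>

lemma AE_jump_time_unbounded:
  assumes "0 < l"
  shows "AE \<omega> in mark_space. \<exists>n. t < jump_time l \<omega> n"
proof -
  interpret S: prob_space mark_space by (rule prob_space_mark_space)
  interpret U: prob_space unit_uniform by (rule prob_space_unit_uniform)
  have [measurable]: "(\<lambda>\<omega>. jump_time l \<omega> n) \<in> borel_measurable mark_space" for n
    by (rule measurable_jump_time) simp
  define q where "q = 1 / (1 + 1 / l)"
  have q: "0 \<le> q" "q < 1" using assms by (auto simp: q_def field_simps)
  have step: "jump_time l (case_nat (a, m) \<omega>) (Suc n) = a / l + jump_time l \<omega> n" for a m \<omega> n
    by (induction n) auto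
  have laplace: "(\<integral>\<^sup>+\<omega>. ennreal (exp (- jump_time l \<omega> n)) \<partial>mark_space) = ennreal (q ^ n)" for n
  proof (induction n)
    case 0
    then show ?case by (simp add: S.emeasure_space_1)
  next
    case (Suc n)
    have "(\<integral>\<^sup>+\<omega>. ennreal (exp (- jump_time l \<omega> (Suc n))) \<partial>mark_space)
      = (\<integral>\<^sup>+a. ennreal (exp (- (1 / l) * a)) * ennreal (q ^ n) \<partial>exponential_law)"
      using Suc by (subst nn_integral_first_mark)
        (simp_all add: step del: jump_time.simps add: exp_diff exp_minus ennreal_mult divide_inverse
          nn_integral_cmult U.emeasure_space_1, simp add: mult.commute)
    also have "\<dots> = (\<integral>\<^sup>+a. ennreal (exp (- (1 / l) * a)) \<partial>exponential_law) * ennreal (q ^ n)"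
      by (rule nn_integral_multc)
        (auto simp: sets_exponential_law cong: measurable_cong_sets intro!: measurable_restrict_space1)
    also have "\<dots> = ennreal (q ^ Suc n)"
      using assms q by (subst nn_integral_exponential_law_exp) (auto simp: q_def[symmetric] ennreal_mult[symmetric])
    finally show ?case .
  qed
  define B where "B = {\<omega> \<in> space mark_space. \<forall>n. jump_time l \<omega> n \<le> t}"
  have B[measurable]: "B \<in> sets mark_space" unfolding B_def by measurable
  have "emeasure mark_space B \<le> ennreal (exp t * q ^ n)" for n
  proof -
    have "emeasure mark_space B = (\<integral>\<^sup>+\<omega>. indicator B \<omega> \<partial>mark_space)" by simp
    also have "\<dots> \<le> (\<integral>\<^sup>+\<omega>. ennreal (exp t) * ennreal (exp (- jump_time l \<omega> n)) \<partial>mark_space)"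
      by (intro nn_integral_mono)
        (auto simp: B_def indicator_def ennreal_mult[symmetric] exp_add[symmetric] ennreal_le_iff2)
    also have "\<dots> = ennreal (exp t * q ^ n)"
      using q by (simp add: nn_integral_cmult laplace ennreal_mult)
    finally show ?thesis .
  qed
  moreover have "(\<lambda>n. ennreal (exp t * q ^ n)) \<longlonglongrightarrow> ennreal (exp t * 0)"
    using q by (intro tendsto_intros LIMSEQ_power_zero) auto
  ultimately have "emeasure mark_space B \<le> ennreal (exp t * 0)"
    by (intro LIMSEQ_le_const) auto
  then have "B \<in> null_sets mark_space" by (auto simp: null_sets_def)
  then show ?thesis
    by (rule AE_I') (auto simp: B_def not_less)
qed

section \<open>Closeness of measures in weighted variation\<close>

text \<open>The weighted variation norm of \<open>\<mu> - \<nu>\<close> is the supremum over tests with \<open>\<bar>f\<bar> \<le> V\<close>; the tests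
  with \<open>0 \<le> f \<le> V\<close> used here give it up to a factor of at most 2. With them, closeness is an
  inequality between nonnegative integrals, which makes sense without integrability, and a bound
  \<open>e\<close> that depends on time can be chosen measurable even if the norm itself is not known to be.\<close>

definition weighted_close ::
    "('a::topological_space \<Rightarrow> real) \<Rightarrow> real \<Rightarrow> 'a measure \<Rightarrow> 'a measure \<Rightarrow> bool" where
  "weighted_close V e \<mu> \<nu> \<longleftrightarrow> (\<forall>f\<in>borel_measurable borel. (\<forall>x. f x \<le> ennreal (V x)) \<longrightarrow>
     (\<integral>\<^sup>+x. f x \<partial>\<mu>) \<le> (\<integral>\<^sup>+x. f x \<partial>\<nu>) + ennreal e \<and>
     (\<integral>\<^sup>+x. f x \<partial>\<nu>) \<le> (\<integral>\<^sup>+x. f x \<partial>\<mu>) + ennreal e)"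

lemma weighted_closeD:
  assumes "weighted_close V e \<mu> \<nu>" "f \<in> borel_measurable borel" "\<And>x. f x \<le> ennreal (V x)"
  shows "(\<integral>\<^sup>+x. f x \<partial>\<mu>) \<le> (\<integral>\<^sup>+x. f x \<partial>\<nu>) + ennreal e"
    "(\<integral>\<^sup>+x. f x \<partial>\<nu>) \<le> (\<integral>\<^sup>+x. f x \<partial>\<mu>) + ennreal e"
  using assms unfolding weighted_close_def by auto

lemma weighted_close_sym: "weighted_close V e \<mu> \<nu> \<Longrightarrow> weighted_close V e \<nu> \<mu>"
  unfolding weighted_close_def by blast

lemma weighted_close_mono:
  assumes "weighted_close V d \<mu> \<nu>" "d \<le> e" shows "weighted_close V e \<mu> \<nu>"
  using assms(1) ennreal_leI[OF assms(2)] unfolding weighted_close_def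
  by (meson add_left_mono order_trans)

lemma weighted_close_trans:
  assumes "weighted_close V d \<mu> \<nu>" "weighted_close V e \<nu> \<kappa>" "0 \<le> d" "0 \<le> e"
  shows "weighted_close V (d + e) \<mu> \<kappa>"
  unfolding weighted_close_def
proof (intro ballI impI conjI)
  fix f :: "'a \<Rightarrow> ennreal" assume f: "f \<in> borel_measurable borel" "\<forall>x. f x \<le> ennreal (V x)"
  note 1 = weighted_closeD[OF assms(1) f(1)] and 2 = weighted_closeD[OF assms(2) f(1)]
  have "(\<integral>\<^sup>+x. f x \<partial>\<mu>) \<le> (\<integral>\<^sup>+x. f x \<partial>\<nu>) + ennreal d" using 1 f by blast
  also have "\<dots> \<le> (\<integral>\<^sup>+x. f x \<partial>\<kappa>) + ennreal e + ennreal d" using 2 f by (intro add_right_mono) blast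
  finally show "(\<integral>\<^sup>+x. f x \<partial>\<mu>) \<le> (\<integral>\<^sup>+x. f x \<partial>\<kappa>) + ennreal (d + e)"
    using assms by (simp add: add_ac)
  have "(\<integral>\<^sup>+x. f x \<partial>\<kappa>) \<le> (\<integral>\<^sup>+x. f x \<partial>\<nu>) + ennreal e" using 2 f by blast
  also have "\<dots> \<le> (\<integral>\<^sup>+x. f x \<partial>\<mu>) + ennreal d + ennreal e" using 1 f by (intro add_right_mono) blast
  finally show "(\<integral>\<^sup>+x. f x \<partial>\<kappa>) \<le> (\<integral>\<^sup>+x. f x \<partial>\<mu>) + ennreal (d + e)"
    using assms by (simp add: add_ac)
qed

lemma in_prob_algebraD:
  assumes "\<mu> \<in> space (prob_algebra (borel :: 'a::topological_space measure))"
  shows "prob_space \<mu>" "sets \<mu> = sets borel" "space \<mu> = UNIV"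
  using assms sets_eq_imp_space_eq[of \<mu> borel] by (auto simp: space_prob_algebra)

lemma weighted_close_measure:
  assumes close: "weighted_close V e \<mu> \<nu>" and V: "\<And>x. 1 \<le> V x" and "0 \<le> e"
    and \<mu>: "\<mu> \<in> space (prob_algebra borel)" and \<nu>: "\<nu> \<in> space (prob_algebra borel)"
    and A: "A \<in> sets borel"
  shows "\<bar>measure \<mu> A - measure \<nu> A\<bar> \<le> e"
proof -
  interpret \<mu>: prob_space \<mu> by (rule in_prob_algebraD[OF \<mu>])
  interpret \<nu>: prob_space \<nu> by (rule in_prob_algebraD[OF \<nu>])
  have ind: "indicator A x \<le> ennreal (V x)" for x
    using V[of x] by (auto simp: indicator_def)
  have "emeasure \<mu> A \<le> emeasure \<nu> A + ennreal e" "emeasure \<nu> A \<le> emeasure \<mu> A + ennreal e"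
    using weighted_closeD[OF close _ ind] A in_prob_algebraD(2)[OF \<mu>] in_prob_algebraD(2)[OF \<nu>]
    by auto
  then show ?thesis
    using \<open>0 \<le> e\<close>
    by (auto simp: \<mu>.emeasure_eq_measure \<nu>.emeasure_eq_measure ennreal_plus[symmetric] abs_le_iff
        simp del: ennreal_plus)
qed

lemma halving_tendsto_zero: "(\<lambda>n. a / 2 ^ n * b) \<longlonglongrightarrow> (0 :: real)"
proof -
  have "(\<lambda>n. a * b * (1 / 2) ^ n) \<longlonglongrightarrow> a * b * 0"
    by (intro tendsto_intros LIMSEQ_power_zero) auto
  then show ?thesis by (simp add: power_divide mult.commute mult.left_commute)
qed

lemma eq_of_weighted_close:
  assumes close: "\<And>n. weighted_close V (e n) \<mu> \<nu>" and V: "\<And>x. 1 \<le> V x"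
    and e: "\<And>n. 0 \<le> e n" "e \<longlonglongrightarrow> 0"
    and \<mu>: "\<mu> \<in> space (prob_algebra borel)" and \<nu>: "\<nu> \<in> space (prob_algebra borel)"
  shows "\<mu> = \<nu>"
proof (rule measure_eqI)
  interpret \<mu>: prob_space \<mu> by (rule in_prob_algebraD[OF \<mu>])
  interpret \<nu>: prob_space \<nu> by (rule in_prob_algebraD[OF \<nu>])
  show "sets \<mu> = sets \<nu>" using \<mu> \<nu> by (simp add: space_prob_algebra)
  fix A assume "A \<in> sets \<mu>"
  then have A: "A \<in> sets borel" using \<mu> by (simp add: space_prob_algebra)
  have "\<bar>measure \<mu> A - measure \<nu> A\<bar> \<le> 0"
    using weighted_close_measure[OF close V e(1) \<mu> \<nu> A] by (intro LIMSEQ_le_const[OF e(2)]) auto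
  then show "emeasure \<mu> A = emeasure \<nu> A"
    by (simp add: \<mu>.emeasure_eq_measure \<nu>.emeasure_eq_measure)
qed

lemma nn_integral_simple_indicator:
  assumes "sets M = sets borel" "simple_function borel g" "A \<in> sets borel"
  shows "(\<integral>\<^sup>+x. g x * indicator A x \<partial>M) = (\<Sum>y\<in>range g. y * emeasure M (g -` {y} \<inter> A))"
proof -
  have sp: "space M = UNIV" using sets_eq_imp_space_eq[OF assms(1)] by simp
  have g: "simple_function M g"
    using assms(2) simple_function_cong_algebra[of borel M g] assms(1) sp by simp
  have "(\<integral>\<^sup>+x. g x * indicator A x \<partial>M) = (\<integral>\<^sup>Sx. g x * indicator A x \<partial>M)"
    using g assms by (intro nn_integral_eq_simple_integral simple_function_mult simple_function_indicator) auto
  also have "\<dots> = (\<Sum>y\<in>range g. y * emeasure M (g -` {y} \<inter> A))"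
    using simple_integral_indicator[of A M g] g assms sp by simp
  finally show ?thesis .
qed

text \<open>On a Hahn decomposition \<open>Y\<close>, \<open>- Y\<close> of \<open>\<mu> - \<nu>\<close> the total variation is the sum of the
  measures \<open>\<mu> - \<nu>\<close> on \<open>Y\<close> and \<open>\<nu> - \<mu>\<close> on \<open>- Y\<close>; each of the two is controlled by testing
  against functions below \<open>V\<close> that vanish on the other half. Differences are moved to the other
  side of the inequality, so that only nonnegative integrals occur.\<close>

lemma weighted_norm_diff_le:
  assumes close: "weighted_close V e \<mu> \<nu>" and e: "0 \<le> e"
    and \<mu>: "\<mu> \<in> weighted_probs V" and \<nu>: "\<nu> \<in> weighted_probs V"
  shows "weighted_norm_diff V \<mu> \<nu> \<le> ennreal (2 * e)"
proof -
  have \<mu>': "\<mu> \<in> space (prob_algebra borel)" and \<nu>': "\<nu> \<in> space (prob_algebra borel)"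
    using \<mu> \<nu> by (auto simp: weighted_probs_def)
  note [simp] = in_prob_algebraD(2,3)[OF \<mu>'] in_prob_algebraD(2,3)[OF \<nu>']
  interpret \<mu>: prob_space \<mu> by (rule in_prob_algebraD[OF \<mu>'])
  interpret \<nu>: prob_space \<nu> by (rule in_prob_algebraD[OF \<nu>'])
  obtain Y where Y: "Y \<in> sets borel"
    "\<And>X. X \<in> sets borel \<Longrightarrow> X \<subseteq> Y \<Longrightarrow> emeasure \<nu> X \<le> emeasure \<mu> X"
    "\<And>X. X \<in> sets borel \<Longrightarrow> X \<inter> Y = {} \<Longrightarrow> emeasure \<mu> X \<le> emeasure \<nu> X"
    using finite_unsigned_Hahn_decomposition[of \<mu> \<nu>] \<mu>.finite_measure_axioms \<nu>.finite_measure_axioms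
    by auto
  define \<tau> where "\<tau> = variation_measure \<mu> \<nu>"
  define d where "d B = measure \<mu> (B \<inter> Y) + measure \<nu> (B \<inter> - Y) - measure \<nu> (B \<inter> Y) - measure \<mu> (B \<inter> - Y)" for B
  have split: "measure \<mu> B = measure \<mu> (B \<inter> Y) + measure \<mu> (B \<inter> - Y)"
    "measure \<nu> B = measure \<nu> (B \<inter> Y) + measure \<nu> (B \<inter> - Y)" if "B \<in> sets borel" for B
    using that Y(1) \<mu>.finite_measure_Union'[of "B \<inter> Y" "B \<inter> - Y"] \<nu>.finite_measure_Union'[of "B \<inter> Y" "B \<inter> - Y"]
    by (auto simp: Int_Un_distrib[symmetric] Diff_triv Int_assoc[symmetric])
  have bound: "\<bar>measure \<mu> B - measure \<nu> B\<bar> \<le> d B" if B: "B \<in> sets borel" for B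
  proof -
    have "measure \<nu> (B \<inter> Y) \<le> measure \<mu> (B \<inter> Y)"
      using Y(2)[of "B \<inter> Y"] B Y(1) by (simp add: \<mu>.emeasure_eq_measure \<nu>.emeasure_eq_measure)
    moreover have "measure \<mu> (B \<inter> - Y) \<le> measure \<nu> (B \<inter> - Y)"
      using Y(3)[of "B \<inter> - Y"] B Y(1) by (simp add: \<mu>.emeasure_eq_measure \<nu>.emeasure_eq_measure)
    ultimately show ?thesis
      unfolding d_def split[OF B] by linarith
  qed
  have sum_d: "(\<Sum>B\<in>\<C>. d B) = d (\<Union>\<C>)"
    if \<C>: "finite \<C>" "\<C> \<subseteq> sets borel" "disjoint \<C>" for \<C>
  proof -
    have disj: "disjoint_family_on (\<lambda>B. B \<inter> Z) \<C>" for Z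
      using \<C>(3) by (auto simp: disjoint_family_on_def disjoint_def)
    have 1: "(\<Sum>B\<in>\<C>. measure \<mu> (B \<inter> Z)) = measure \<mu> (\<Union>\<C> \<inter> Z)" if "Z \<in> sets borel" for Z
      unfolding Int_Union2
      by (rule \<mu>.finite_measure_finite_Union[OF \<C>(1) _ disj, symmetric]) (use \<C>(2) that in auto)
    have 2: "(\<Sum>B\<in>\<C>. measure \<nu> (B \<inter> Z)) = measure \<nu> (\<Union>\<C> \<inter> Z)" if "Z \<in> sets borel" for Z
      unfolding Int_Union2
      by (rule \<nu>.finite_measure_finite_Union[OF \<C>(1) _ disj, symmetric]) (use \<C>(2) that in auto)
    show ?thesis
      using Y(1) unfolding d_def by (simp add: sum.distrib sum_subtractf 1 2)
  qed
  have sets_\<tau>: "sets \<tau> = sets borel"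
    unfolding \<tau>_def variation_measure_def using sets.sigma_sets_eq[of \<mu>] sets.space_closed[of \<mu>]
    by (simp add: sets_measure_of)
  (* variation_measure is defined through measure_of, which is its set function or else 0; an upper
     bound on the set function is enough in both cases. *)
  have \<tau>_le: "emeasure \<tau> A \<le> ennreal (d A)" if A: "A \<in> sets borel" for A
  proof -
    have "emeasure \<tau> A \<le> (SUP \<C>\<in>{\<C>. finite \<C> \<and> \<C> \<subseteq> sets \<mu> \<and> disjoint \<C> \<and> \<Union>\<C> = A}.
       ennreal (\<Sum>B\<in>\<C>. \<bar>measure \<mu> B - measure \<nu> B\<bar>))"
      unfolding \<tau>_def variation_measure_def emeasure_measure_of_conv by simp
    also have "\<dots> \<le> ennreal (d A)"
    proof (intro SUP_least ennreal_leI)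
      fix \<C> assume \<C>: "\<C> \<in> {\<C>. finite \<C> \<and> \<C> \<subseteq> sets \<mu> \<and> disjoint \<C> \<and> \<Union>\<C> = A}"
      then have "(\<Sum>B\<in>\<C>. \<bar>measure \<mu> B - measure \<nu> B\<bar>) \<le> (\<Sum>B\<in>\<C>. d B)"
        by (intro sum_mono bound) auto
      also have "\<dots> = d A" using \<C> by (subst sum_d) auto
      finally show "(\<Sum>B\<in>\<C>. \<bar>measure \<mu> B - measure \<nu> B\<bar>) \<le> d A" .
    qed
    finally show ?thesis .
  qed
  have \<tau>_add: "emeasure \<tau> A + emeasure \<nu> (A \<inter> Y) + emeasure \<mu> (A \<inter> - Y)
      \<le> emeasure \<mu> (A \<inter> Y) + emeasure \<nu> (A \<inter> - Y)" if A: "A \<in> sets borel" for A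
  proof -
    have "emeasure \<tau> A + emeasure \<nu> (A \<inter> Y) + emeasure \<mu> (A \<inter> - Y)
      \<le> ennreal (d A) + ennreal (measure \<nu> (A \<inter> Y)) + ennreal (measure \<mu> (A \<inter> - Y))"
      using \<tau>_le[OF A] by (simp add: \<mu>.emeasure_eq_measure \<nu>.emeasure_eq_measure add_right_mono)
    also have "\<dots> = ennreal (d A + measure \<nu> (A \<inter> Y) + measure \<mu> (A \<inter> - Y))"
      using bound[OF A] by (simp add: ennreal_plus[symmetric] del: ennreal_plus)
    also have "\<dots> = emeasure \<mu> (A \<inter> Y) + emeasure \<nu> (A \<inter> - Y)"
      by (simp add: d_def \<mu>.emeasure_eq_measure \<nu>.emeasure_eq_measure)
    finally show ?thesis .
  qed
  have "weighted_norm_diff V \<mu> \<nu> = (SUP g\<in>{g. simple_function \<tau> g \<and> g \<le> (\<lambda>x. ennreal (V x))}. integral\<^sup>S \<tau> g)"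
    unfolding weighted_norm_diff_def \<tau>_def[symmetric] nn_integral_def ..
  also have "\<dots> \<le> ennreal (2 * e)"
  proof (rule SUP_least)
    fix g assume "g \<in> {g. simple_function \<tau> g \<and> g \<le> (\<lambda>x. ennreal (V x))}"
    then have g\<tau>: "simple_function \<tau> g" and gV: "\<And>x. g x \<le> ennreal (V x)"
      by (auto simp: le_fun_def)
    then have g: "simple_function borel g"
      using simple_function_cong_algebra[of borel \<tau> g] sets_\<tau> sets_eq_imp_space_eq[OF sets_\<tau>] by simp
    then have gm[measurable]: "g \<in> borel_measurable borel" by (rule borel_measurable_simple_function)
    define I where "I M A = (\<integral>\<^sup>+x. g x * indicator A x \<partial>M)" for M A
    have I: "I M A = (\<Sum>y\<in>range g. y * emeasure M (g -` {y} \<inter> A))"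
      if "sets M = sets borel" "A \<in> sets borel" for M A
      unfolding I_def using nn_integral_simple_indicator[OF that(1) g that(2)] .
    have level: "g -` {y} \<in> sets borel" for y
      using measurable_sets[OF gm, of "{y}"] by simp
    have I_close: "I \<mu> A \<le> I \<nu> A + ennreal e" "I \<nu> A \<le> I \<mu> A + ennreal e" if "A \<in> sets borel" for A
      unfolding I_def using that gV
      by (auto intro!: weighted_closeD[OF close] simp: indicator_def)
    have finite: "I M A < \<infinity>" if "M \<in> weighted_probs V" for M A
    proof -
      have "I M A \<le> (\<integral>\<^sup>+x. ennreal (V x) \<partial>M)"
        unfolding I_def using gV by (intro nn_integral_mono) (auto simp: indicator_def)
      then show ?thesis using that by (auto simp: weighted_probs_def)
    qed
    have "I \<tau> UNIV + I \<nu> Y + I \<mu> (- Y)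
      = (\<Sum>y\<in>range g. y * (emeasure \<tau> (g -` {y}) + emeasure \<nu> (g -` {y} \<inter> Y) + emeasure \<mu> (g -` {y} \<inter> - Y)))"
      using Y(1) by (simp add: I sets_\<tau> sum.distrib distrib_left)
    also have "\<dots> \<le> (\<Sum>y\<in>range g. y * (emeasure \<mu> (g -` {y} \<inter> Y) + emeasure \<nu> (g -` {y} \<inter> - Y)))"
      by (intro sum_mono mult_left_mono \<tau>_add level) simp
    also have "\<dots> = I \<mu> Y + I \<nu> (- Y)"
      using Y(1) by (simp add: I sum.distrib distrib_left)
    also have "\<dots> \<le> (I \<nu> Y + ennreal e) + (I \<mu> (- Y) + ennreal e)"
      using Y(1) by (intro add_mono I_close) auto
    finally have "(I \<nu> Y + I \<mu> (- Y)) + I \<tau> UNIV \<le> (I \<nu> Y + I \<mu> (- Y)) + ennreal (2 * e)"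
      using e by (simp add: add_ac ennreal_plus[symmetric] del: ennreal_plus)
    then have "I \<tau> UNIV \<le> ennreal (2 * e)"
      using finite[OF \<nu>, of Y] finite[OF \<mu>, of "- Y"] by (auto simp: ennreal_add_left_cancel_le)
    then show "integral\<^sup>S \<tau> g \<le> ennreal (2 * e)"
      using nn_integral_eq_simple_integral[OF g\<tau>] by (simp add: I_def)
  qed
  finally show ?thesis .
qed

lemma nn_integral_le_of_simple:
  fixes M :: "'a::topological_space measure"
  assumes "sets M = sets borel"
    and "\<And>g. simple_function borel g \<Longrightarrow> (\<And>x. g x \<le> f x) \<Longrightarrow> (\<And>x. g x < top) \<Longrightarrow> (\<integral>\<^sup>+x. g x \<partial>M) \<le> c"
  shows "(\<integral>\<^sup>+x. f x \<partial>M) \<le> c"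
  unfolding nn_integral_def_finite
proof (rule SUP_least)
  fix g assume g: "g \<in> {g. simple_function M g \<and> g \<le> f \<and> (\<forall>x. g x < top)}"
  then have "simple_function borel g"
    using simple_function_cong_algebra[of borel M g] assms(1) sets_eq_imp_space_eq[OF assms(1)] by simp
  then have "(\<integral>\<^sup>+x. g x \<partial>M) \<le> c"
    using g by (intro assms(2)) (auto simp: le_fun_def)
  then show "integral\<^sup>S M g \<le> c"
    using g nn_integral_eq_simple_integral[of M g] by simp
qed

text \<open>Closeness passes to setwise limits because integrals of simple functions do.\<close>

lemma weighted_close_limit:
  fixes m :: "nat \<Rightarrow> 'a::topological_space measure"
  assumes m: "\<And>k. m k \<in> space (prob_algebra borel)" and \<mu>: "\<mu> \<in> space (prob_algebra borel)"
    and \<nu>: "\<nu> \<in> space (prob_algebra borel)"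
    and conv: "\<And>A. A \<in> sets borel \<Longrightarrow> (\<lambda>k. emeasure (m k) A) \<longlonglongrightarrow> emeasure \<mu> A"
    and close: "\<And>k. j \<le> k \<Longrightarrow> weighted_close V e \<nu> (m k)"
  shows "weighted_close V e \<nu> \<mu>"
  unfolding weighted_close_def
proof (intro ballI impI conjI)
  note sets[simp] = in_prob_algebraD(2)[OF m] in_prob_algebraD(2)[OF \<mu>] in_prob_algebraD(2)[OF \<nu>]
  have simple: "(\<lambda>k. \<integral>\<^sup>+x. g x \<partial>m k) \<longlonglongrightarrow> (\<integral>\<^sup>+x. g x \<partial>\<mu>)"
    if g: "simple_function borel g" "\<And>x. g x < top" for g
  proof -
    have level: "g -` {y} \<in> sets borel" for y
      using measurable_sets[OF borel_measurable_simple_function[OF g(1)], of "{y}"] by simp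
    have "(\<lambda>k. \<Sum>y\<in>range g. y * emeasure (m k) (g -` {y})) \<longlonglongrightarrow> (\<Sum>y\<in>range g. y * emeasure \<mu> (g -` {y}))"
      using g(2) by (intro tendsto_sum ennreal_tendsto_cmult conv level) auto
    then show ?thesis
      using nn_integral_simple_indicator[OF sets(1) g(1), of UNIV]
        nn_integral_simple_indicator[OF sets(2) g(1), of UNIV] by simp
  qed
  fix f :: "'a \<Rightarrow> ennreal" assume f: "f \<in> borel_measurable borel" "\<forall>x. f x \<le> ennreal (V x)"
  have g_close: "(\<integral>\<^sup>+x. g x \<partial>\<nu>) \<le> (\<integral>\<^sup>+x. g x \<partial>m k) + ennreal e"
    "(\<integral>\<^sup>+x. g x \<partial>m k) \<le> (\<integral>\<^sup>+x. g x \<partial>\<nu>) + ennreal e"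
    if "simple_function borel g" "\<And>x. g x \<le> f x" "j \<le> k" for g k
    using that f(2) borel_measurable_simple_function[OF that(1)]
    by (auto intro!: weighted_closeD[OF close] intro: order_trans)
  show "(\<integral>\<^sup>+x. f x \<partial>\<nu>) \<le> (\<integral>\<^sup>+x. f x \<partial>\<mu>) + ennreal e"
  proof (rule nn_integral_le_of_simple[OF sets(3)])
    fix g assume g: "simple_function borel g" "\<And>x. g x \<le> f x" "\<And>x. g x < top"
    have "(\<integral>\<^sup>+x. g x \<partial>\<nu>) \<le> (\<integral>\<^sup>+x. g x \<partial>\<mu>) + ennreal e"
      by (rule LIMSEQ_le_const[OF tendsto_add[OF simple[OF g(1,3)] tendsto_const]])
        (use g_close(1)[OF g(1,2)] in blast)
    also have "\<dots> \<le> (\<integral>\<^sup>+x. f x \<partial>\<mu>) + ennreal e"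
      using g(2) by (intro add_right_mono nn_integral_mono) auto
    finally show "(\<integral>\<^sup>+x. g x \<partial>\<nu>) \<le> (\<integral>\<^sup>+x. f x \<partial>\<mu>) + ennreal e" .
  qed
  show "(\<integral>\<^sup>+x. f x \<partial>\<mu>) \<le> (\<integral>\<^sup>+x. f x \<partial>\<nu>) + ennreal e"
  proof (rule nn_integral_le_of_simple[OF sets(2)])
    fix g assume g: "simple_function borel g" "\<And>x. g x \<le> f x" "\<And>x. g x < top"
    have "(\<integral>\<^sup>+x. g x \<partial>\<mu>) \<le> (\<integral>\<^sup>+x. g x \<partial>\<nu>) + ennreal e"
      by (rule LIMSEQ_le_const2[OF simple[OF g(1,3)]]) (use g_close(2)[OF g(1,2)] in blast)
    also have "\<dots> \<le> (\<integral>\<^sup>+x. f x \<partial>\<nu>) + ennreal e"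
      using g(2) by (intro add_right_mono nn_integral_mono) auto
    finally show "(\<integral>\<^sup>+x. g x \<partial>\<mu>) \<le> (\<integral>\<^sup>+x. f x \<partial>\<nu>) + ennreal e" .
  qed
qed

text \<open>As \<open>V \<ge> 1\<close>, closeness bounds the difference of the measures on every measurable set. So the
  sequence converges uniformly over these sets, and the limit inherits continuity at the empty
  set, hence countable additivity.\<close>

lemma setwise_limit_exists:
  fixes m :: "nat \<Rightarrow> 'a::topological_space measure"
  assumes m: "\<And>k. m k \<in> space (prob_algebra borel)" and V: "\<And>x. 1 \<le> V x"
    and e: "\<And>k. 0 \<le> e k" "e \<longlonglongrightarrow> 0"
    and close: "\<And>j k. j \<le> k \<Longrightarrow> weighted_close V (e j) (m j) (m k)"
  obtains \<mu> where "\<mu> \<in> space (prob_algebra borel)"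
    "\<And>A. A \<in> sets borel \<Longrightarrow> (\<lambda>k. emeasure (m k) A) \<longlonglongrightarrow> emeasure \<mu> A"
proof -
  note prob[simp] = in_prob_algebraD(2,3)[OF m]
  interpret m: prob_space "m k" for k by (rule in_prob_algebraD[OF m])
  have dist: "\<bar>measure (m j) A - measure (m k) A\<bar> \<le> e j" if "A \<in> sets borel" "j \<le> k" for A j k
    by (rule weighted_close_measure[OF close V e(1) m m]) (use that in auto)
  have "convergent (\<lambda>k. measure (m k) A)" if A: "A \<in> sets borel" for A
    unfolding Cauchy_convergent_iff[symmetric]
  proof (rule metric_CauchyI)
    fix r :: real assume "r > 0"
    then obtain j where j: "e j < r / 2"
      using order_tendstoD(2)[OF e(2), of "r / 2"] by (auto simp: eventually_sequentially)
    have "dist (measure (m k) A) (measure (m n) A) < r" if "k \<ge> j" "n \<ge> j" for k n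
      using dist[OF A that(1)] dist[OF A that(2)] j by (auto simp: dist_real_def)
    then show "\<exists>j. \<forall>k\<ge>j. \<forall>n\<ge>j. dist (measure (m k) A) (measure (m n) A) < r" by blast
  qed
  then have lim: "(\<lambda>k. measure (m k) A) \<longlonglongrightarrow> lim (\<lambda>k. measure (m k) A)" if "A \<in> sets borel" for A
    using that by (simp add: convergent_LIMSEQ_iff)
  define L where "L A = lim (\<lambda>k. measure (m k) A)" for A
  note lim = lim[folded L_def]
  have L_nonneg: "0 \<le> L A" if "A \<in> sets borel" for A
    by (rule LIMSEQ_le_const[OF lim[OF that]]) auto
  have L_dist: "\<bar>measure (m j) A - L A\<bar> \<le> e j" if A: "A \<in> sets borel" for A j
    by (rule LIMSEQ_le_const2[OF tendsto_rabs[OF tendsto_diff[OF tendsto_const lim[OF A]]]])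
      (use dist[OF A] in blast)
  have L_add: "L (A \<union> B) = L A + L B" if "A \<in> sets borel" "B \<in> sets borel" "A \<inter> B = {}" for A B
    using that m.finite_measure_Union[of A _ B] tendsto_add[OF lim[of A] lim[of B]]
    by (intro LIMSEQ_unique[OF lim]) auto
  have "L {} = 0" "L UNIV = 1"
    using LIMSEQ_unique[OF lim[of "{}"], of 0] LIMSEQ_unique[OF lim[of UNIV], of 1]
      m.prob_space by (auto)
  define \<mu> where "\<mu> = measure_of (UNIV :: 'a set) (sets borel) (\<lambda>A. ennreal (L A))"
  have sets_\<mu>: "sets \<mu> = sets borel"
    unfolding \<mu>_def using sets.sigma_sets_eq[of "borel :: 'a measure"] by (simp add: sets_measure_of)
  have ca: "countably_additive (sets borel) (\<lambda>A. ennreal (L A))"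
  proof (rule ring_of_sets.empty_continuous_imp_countably_additive)
    show "ring_of_sets UNIV (sets (borel :: 'a measure))"
      using sets.ring_of_sets_axioms[of "borel :: 'a measure"] by simp
    show "positive (sets borel) (\<lambda>A. ennreal (L A))"
      by (simp add: positive_def \<open>L {} = 0\<close>)
    show "additive (sets borel) (\<lambda>A. ennreal (L A))"
      by (auto simp: additive_def L_add L_nonneg)
    show "\<forall>A\<in>sets borel. ennreal (L A) \<noteq> \<infinity>" by simp
    fix A :: "nat \<Rightarrow> 'a set" assume A: "range A \<subseteq> sets borel" "decseq A" "(\<Inter>i. A i) = {}"
    have "(\<lambda>i. L (A i)) \<longlonglongrightarrow> 0"
    proof (rule LIMSEQ_I)
      fix r :: real assume "0 < r"
      then obtain j where j: "e j < r / 2"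
        using order_tendstoD(2)[OF e(2), of "r / 2"] by (auto simp: eventually_sequentially)
      have "(\<lambda>i. measure (m j) (A i)) \<longlonglongrightarrow> measure (m j) (\<Inter>i. A i)"
        using A by (intro m.finite_Lim_measure_decseq) auto
      then obtain n where n: "\<And>i. i \<ge> n \<Longrightarrow> measure (m j) (A i) < r / 2"
        using order_tendstoD(2)[of "\<lambda>i. measure (m j) (A i)" 0 sequentially "r / 2"] \<open>0 < r\<close> A(3)
        by (auto simp: eventually_sequentially)
      have "norm (L (A i) - 0) < r" if "i \<ge> n" for i
        using n[OF that] j L_dist[of "A i" j] L_nonneg[of "A i"] A(1) by auto
      then show "\<exists>n. \<forall>i\<ge>n. norm (L (A i) - 0) < r" by blast
    qed
    then show "(\<lambda>i. ennreal (L (A i))) \<longlonglongrightarrow> 0"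
      using tendsto_ennrealI by fastforce
  qed
  have em: "emeasure \<mu> A = ennreal (L A)" if "A \<in> sets borel" for A
    unfolding \<mu>_def
  proof (rule emeasure_measure_of_sigma[OF _ _ ca that])
    show "sigma_algebra UNIV (sets (borel :: 'a measure))"
      using sets.sigma_algebra_axioms[of "borel :: 'a measure"] by simp
    show "positive (sets borel) (\<lambda>A. ennreal (L A))"
      by (simp add: positive_def \<open>L {} = 0\<close>)
  qed
  have sp: "space \<mu> = UNIV" using sets_eq_imp_space_eq[OF sets_\<mu>] by simp
  have "prob_space \<mu>"
    by (rule prob_spaceI) (simp add: em sp \<open>L UNIV = 1\<close>)
  then have \<mu>: "\<mu> \<in> space (prob_algebra borel)"
    using sets_\<mu> by (simp add: space_prob_algebra)
  have conv: "(\<lambda>k. emeasure (m k) A) \<longlonglongrightarrow> emeasure \<mu> A" if A: "A \<in> sets borel" for A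
    unfolding em[OF A] m.emeasure_eq_measure using lim[OF A] by (rule tendsto_ennrealI)
  show ?thesis by (rule that[OF \<mu> conv])
qed

section \<open>The jump process and its kernels\<close>

lemma shift_flow_nonneg: "0 \<le> t \<Longrightarrow> shift_flow s \<mu> t = \<mu> (s + t)"
  by (simp add: shift_flow_def)

lemma constant_flow:
  assumes "\<nu> \<in> space (prob_algebra borel)"
  shows "(\<lambda>t\<in>{0..}. \<nu>) \<in> measure_flows"
proof -
  have "(\<lambda>t\<in>{0..}. \<nu>) \<in> restrict_space borel {0..} \<rightarrow>\<^sub>M prob_algebra borel"
    using assms by (subst measurable_cong[where g="\<lambda>_. \<nu>"]) (auto simp: space_restrict_space)
  then show ?thesis unfolding measure_flows_def by (intro IntI restrict_extensional)
qed

locale jump_construction =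
  fixes l :: real
    and lam :: "'a::polish_space measure \<Rightarrow> 'a \<Rightarrow> real"
    and G :: "'a measure \<Rightarrow> 'a \<Rightarrow> real \<Rightarrow> 'a"
    and H :: "'a \<Rightarrow> real \<Rightarrow> real \<Rightarrow> 'a"
  assumes l_pos: "0 < l"
    and H_measurable:
      "(\<lambda>(x, u). H x u) \<in> borel \<Otimes>\<^sub>M restrict_space borel {0..1} \<rightarrow>\<^sub>M skorokhod_borel"
    and lam_measurable: "(\<lambda>(\<nu>, x). lam \<nu> x) \<in> borel_measurable (prob_algebra borel \<Otimes>\<^sub>M borel)"
    and G_measurable: "(\<lambda>(\<nu>, x, u). G \<nu> x u) \<in>
          prob_algebra borel \<Otimes>\<^sub>M (borel \<Otimes>\<^sub>M restrict_space borel {0..1}) \<rightarrow>\<^sub>M borel"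
begin

definition jump :: "'a measure \<Rightarrow> 'a \<Rightarrow> real \<Rightarrow> real \<Rightarrow> 'a" where
  "jump \<nu> y v w = (if v \<le> lam \<nu> y / l then G \<nu> y w else y)"

definition jump_operator :: "'a measure \<Rightarrow> ('a \<Rightarrow> ennreal) \<Rightarrow> 'a \<Rightarrow> ennreal" where
  "jump_operator \<nu> g y = (\<integral>\<^sup>+v. \<integral>\<^sup>+w. g (jump \<nu> y v w) \<partial>unit_uniform \<partial>unit_uniform)"

abbreviation position where "position \<equiv> jump_position l lam G H"
abbreviation trajectory where "trajectory \<equiv> jump_process l lam G H"
abbreviation kernel where "kernel \<equiv> jump_kernel l lam G H"

text \<open>Measurability is stated for arbitrary measurable arguments, because the state, the marks
  and the starting time of the flow vary together below.\<close>

lemma measurable_H: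
  assumes "x \<in> N \<rightarrow>\<^sub>M borel" "u \<in> N \<rightarrow>\<^sub>M unit_uniform" "t \<in> borel_measurable N"
  shows "(\<lambda>z. H (x z) (u z) (t z)) \<in> N \<rightarrow>\<^sub>M borel"
proof (rule measurable_evaluation[OF _ assms(3)])
  have "(\<lambda>z. (x z, u z)) \<in> N \<rightarrow>\<^sub>M borel \<Otimes>\<^sub>M restrict_space borel {0..1}"
    using assms(1) measurable_from_unit_uniform(2)[OF assms(2)] by measurable
  from measurable_compose[OF this H_measurable]
  show "(\<lambda>z. H (x z) (u z)) \<in> N \<rightarrow>\<^sub>M skorokhod_borel" by simp
qed

lemma measurable_jump:
  assumes "\<nu> \<in> N \<rightarrow>\<^sub>M prob_algebra borel" "y \<in> N \<rightarrow>\<^sub>M borel"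
    "v \<in> N \<rightarrow>\<^sub>M unit_uniform" "w \<in> N \<rightarrow>\<^sub>M unit_uniform"
  shows "(\<lambda>z. jump (\<nu> z) (y z) (v z) (w z)) \<in> N \<rightarrow>\<^sub>M borel"
proof -
  note [measurable] = assms(1,2) measurable_from_unit_uniform[OF assms(3)]
    measurable_from_unit_uniform[OF assms(4)]
  have [measurable]: "(\<lambda>z. lam (\<nu> z) (y z)) \<in> borel_measurable N"
    using measurable_compose[OF _ lam_measurable, of "\<lambda>z. (\<nu> z, y z)" N] by simp
  have [measurable]: "(\<lambda>z. G (\<nu> z) (y z) (w z)) \<in> N \<rightarrow>\<^sub>M borel"
    using measurable_compose[OF _ G_measurable, of "\<lambda>z. (\<nu> z, y z, w z)" N] by simp
  show ?thesis unfolding jump_def by measurable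
qed

lemma measurable_flow:
  assumes \<mu>: "\<mu> \<in> measure_flows" and s: "s \<in> borel_measurable N" "\<And>z. z \<in> space N \<Longrightarrow> 0 \<le> s z"
  shows "(\<lambda>z. \<mu> (s z)) \<in> N \<rightarrow>\<^sub>M prob_algebra borel"
proof -
  have "s \<in> N \<rightarrow>\<^sub>M restrict_space borel {0..}"
    using s by (auto simp: measurable_restrict_space2_iff)
  then show ?thesis
    using \<mu> by (auto simp: measure_flows_def intro: measurable_compose)
qed

lemma flow_prob: "\<mu> \<in> measure_flows \<Longrightarrow> 0 \<le> t \<Longrightarrow> \<mu> t \<in> space (prob_algebra borel)"
  using measurable_flow[of \<mu> "\<lambda>_. t" "count_space {()}"] by (auto dest: measurable_space)

lemma measurable_position:
  assumes \<mu>: "\<mu> \<in> measure_flows" and s: "s \<in> borel_measurable N" "\<And>z. z \<in> space N \<Longrightarrow> 0 \<le> s z"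
    and x: "x \<in> N \<rightarrow>\<^sub>M borel" and \<omega>: "\<omega> \<in> N \<rightarrow>\<^sub>M mark_space"
  shows "(\<lambda>z. position (shift_flow (s z) \<mu>) (x z) (\<omega> z) n) \<in> N \<rightarrow>\<^sub>M borel"
proof (induction n)
  case 0
  then show ?case using x by simp
next
  case (Suc n)
  note mark[measurable] = measurable_mark_law_components[OF measurable_mark[OF \<omega>, of n]]
  note [measurable] = s(1) measurable_from_exponential_law[OF mark(1)] measurable_jump_time[OF \<omega>]
  have nonneg: "0 \<le> jump_time l (\<omega> z) (Suc n)" if "z \<in> space N" for z
    using measurable_space[OF \<omega> that] l_pos by (rule jump_time_nonneg)
  have flow: "(\<lambda>z. \<mu> (s z + jump_time l (\<omega> z) (Suc n))) \<in> N \<rightarrow>\<^sub>M prob_algebra borel"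
    using s(2) nonneg by (intro measurable_flow[OF \<mu>] borel_measurable_add s(1) measurable_jump_time \<omega> add_nonneg_nonneg)
  have "(\<lambda>z. jump (\<mu> (s z + jump_time l (\<omega> z) (Suc n)))
      (H (position (shift_flow (s z) \<mu>) (x z) (\<omega> z) n) (fst (snd (\<omega> z n))) (fst (\<omega> z n) / l))
      (fst (snd (snd (\<omega> z n)))) (snd (snd (snd (\<omega> z n))))) \<in> N \<rightarrow>\<^sub>M borel"
    by (intro measurable_jump flow mark measurable_H Suc) measurable
  also have "?this \<longleftrightarrow> ?case"
    using nonneg by (intro measurable_cong)
      (simp add: jump_def Let_def split_beta shift_flow_nonneg del: jump_time.simps)
  finally show ?case .
qed

lemma measurable_trajectory:
  assumes \<mu>: "\<mu> \<in> measure_flows" and s: "s \<in> borel_measurable N" "\<And>z. z \<in> space N \<Longrightarrow> 0 \<le> s z"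
    and x: "x \<in> N \<rightarrow>\<^sub>M borel" and \<omega>: "\<omega> \<in> N \<rightarrow>\<^sub>M mark_space" and t: "t \<in> borel_measurable N"
  shows "(\<lambda>z. trajectory (shift_flow (s z) \<mu>) (x z) (\<omega> z) (t z)) \<in> N \<rightarrow>\<^sub>M borel"
proof -
  note [measurable] = measurable_jump_time[OF \<omega>] t measurable_position[OF \<mu> s x \<omega>]
    measurable_from_exponential_law[OF measurable_mark_law_components(1)[OF measurable_mark[OF \<omega>]]]
  define X where "X n z = (let y = position (shift_flow (s z) \<mu>) (x z) (\<omega> z) n
      in if t z = jump_time l (\<omega> z) n then y
         else H y (fst (snd (\<omega> z n))) (t z - jump_time l (\<omega> z) n))" for n z
  have H[measurable]: "(\<lambda>z. H (position (shift_flow (s z) \<mu>) (x z) (\<omega> z) n) (fst (snd (\<omega> z n)))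
      (t z - jump_time l (\<omega> z) n)) \<in> N \<rightarrow>\<^sub>M borel" for n
    by (intro measurable_H measurable_mark_law_components measurable_mark[OF \<omega>]) measurable
  have "X n \<in> N \<rightarrow>\<^sub>M borel" for n
    unfolding X_def Let_def by measurable
  then have "(\<lambda>z. X (LEAST n. t z < jump_time l (\<omega> z) (Suc n)) z) \<in> N \<rightarrow>\<^sub>M borel"
    by (rule measurable_compose_countable) measurable
  then show ?thesis
    unfolding jump_process_def X_def Let_def .
qed

lemma measurable_kernel:
  assumes \<mu>: "\<mu> \<in> measure_flows" and t: "t \<in> borel_measurable N" and x: "x \<in> N \<rightarrow>\<^sub>M borel"
  shows "(\<lambda>z. kernel \<mu> 0 (t z) (x z)) \<in> N \<rightarrow>\<^sub>M prob_algebra borel"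
  unfolding jump_kernel_def
proof (rule measurable_distr_prob_space2)
  show "(\<lambda>z. mark_space) \<in> N \<rightarrow>\<^sub>M prob_algebra mark_space"
    by (intro measurable_const) (simp add: space_prob_algebra prob_space_mark_space)
  note [measurable] = t x
  show "(\<lambda>(z, \<omega>). trajectory (shift_flow 0 \<mu>) (x z) \<omega> (t z - 0)) \<in> N \<Otimes>\<^sub>M mark_space \<rightarrow>\<^sub>M borel"
    unfolding split_beta by (rule measurable_trajectory[OF \<mu>]) measurable
qed

text \<open>Once the first mark has been used, the process is the one driven by the remaining marks and
  by the flow shifted by the time of the first mark; this is what the recursions over the number
  of marks rest on.\<close>

lemma position_Suc_first_mark:
  assumes \<omega>: "\<omega> \<in> space mark_space" and "0 \<le> a" "0 \<le> s"
  shows "position (shift_flow s \<mu>) x (case_nat (a, u, v, w) \<omega>) (Suc n)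
    = position (shift_flow (s + a / l) \<mu>) (jump (\<mu> (s + a / l)) (H x u (a / l)) v w) \<omega> n"
proof (induction n)
  case 0
  then show ?case using assms l_pos by (simp add: jump_def shift_flow_nonneg)
next
  case (Suc n)
  have time: "jump_time l (case_nat (a, u, v, w) \<omega>) (Suc n) = a / l + jump_time l \<omega> n" for n
    by (induction n) auto
  have "shift_flow s \<mu> (a / l + jump_time l \<omega> (Suc n))
      = shift_flow (s + a / l) \<mu> (jump_time l \<omega> (Suc n))"
    using jump_time_nonneg[OF \<omega> l_pos, of "Suc n"] assms l_pos
    by (simp add: shift_flow_nonneg add.assoc del: jump_time.simps)
  then show ?case
    unfolding jump_position.simps(2)[of l lam G H _ _ _ "Suc n"]
      jump_position.simps(2)[of l lam G H _ _ \<omega> n] time Suc.IH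
    by simp
qed

lemma trajectory_first_mark:
  assumes \<omega>: "\<omega> \<in> space mark_space" and "0 \<le> a" "0 \<le> s" "0 \<le> t"
    and reach: "t < jump_time l (case_nat (a, u, v, w) \<omega>) (Suc n)"
  shows "trajectory (shift_flow s \<mu>) x (case_nat (a, u, v, w) \<omega>) t =
    (if t < a / l then (if t = 0 then x else H x u t)
     else trajectory (shift_flow (s + a / l) \<mu>) (jump (\<mu> (s + a / l)) (H x u (a / l)) v w) \<omega> (t - a / l))"
proof -
  define \<omega>' where "\<omega>' = case_nat (a, u, v, w) \<omega>"
  have \<omega>'_simps: "\<omega>' (Suc n) = \<omega> n" "\<omega>' 0 = (a, u, v, w)" for n by (simp_all add: \<omega>'_def)
  have time: "jump_time l \<omega>' (Suc n) = a / l + jump_time l \<omega> n" for n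
    unfolding \<omega>'_def by (induction n) auto
  show ?thesis
  proof (cases "t < a / l")
    case True
    then have "(LEAST n. t < jump_time l \<omega>' (Suc n)) = 0"
      by (intro Least_eq_0) (unfold time, simp)
    then show ?thesis
      using True unfolding jump_process_def \<omega>'_def[symmetric]
      by (simp add: \<omega>'_simps Let_def)
  next
    case False
    from reach have "t < jump_time l \<omega>' (Suc n)" by (simp add: \<omega>'_def)
    then have "(LEAST n. t < jump_time l \<omega>' (Suc n)) = Suc (LEAST n. t < jump_time l \<omega>' (Suc (Suc n)))"
      using False unfolding time by (intro Least_Suc[where n=n]) simp_all
    also have "(LEAST n. t < jump_time l \<omega>' (Suc (Suc n))) = (LEAST n. t - a / l < jump_time l \<omega> (Suc n))"
      unfolding time by (intro arg_cong[where f=Least] ext) (auto simp del: jump_time.simps)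
    finally have Least: "(LEAST n. t < jump_time l \<omega>' (Suc n))
      = Suc (LEAST n. t - a / l < jump_time l \<omega> (Suc n))" .
    have cond: "t = a / l + r \<longleftrightarrow> t - a / l = r" "t - (a / l + r) = t - a / l - r" for r by auto
    show ?thesis
      using False
      unfolding jump_process_def \<omega>'_def[symmetric] Let_def Least
      unfolding time \<omega>'_simps cond
        position_Suc_first_mark[OF assms(1-3), of _ _ u v w, folded \<omega>'_def]
      by simp
  qed
qed

text \<open>\<open>killed n\<close> is the expectation of \<open>f\<close> at time \<open>t\<close>, on the event that fewer than \<open>n\<close> marks
  have been used by then; estimates on the process are obtained by induction on \<open>n\<close>.\<close>

definition killed :: "(real \<Rightarrow> 'a measure) \<Rightarrow> ('a \<Rightarrow> ennreal) \<Rightarrow> real \<Rightarrow> nat \<Rightarrow> real \<Rightarrow> 'a \<Rightarrow> ennreal" where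
  "killed \<mu> f t n s x = (\<integral>\<^sup>+\<omega>. (if t - s < jump_time l \<omega> n
      then f (trajectory (shift_flow s \<mu>) x \<omega> (t - s)) else 0) \<partial>mark_space)"

lemma measurable_killed_integrand:
  assumes \<mu>: "\<mu> \<in> measure_flows" and s: "s \<in> borel_measurable N" "\<And>z. z \<in> space N \<Longrightarrow> 0 \<le> s z"
    and x: "x \<in> N \<rightarrow>\<^sub>M borel" and \<omega>: "\<omega> \<in> N \<rightarrow>\<^sub>M mark_space"
    and f[measurable]: "f \<in> borel_measurable borel"
  shows "(\<lambda>z. if t - s z < jump_time l (\<omega> z) n
      then f (trajectory (shift_flow (s z) \<mu>) (x z) (\<omega> z) (t - s z)) else 0) \<in> borel_measurable N"
proof -
  note [measurable] = s(1)
  note [measurable] = measurable_jump_time[OF \<omega>]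
    measurable_trajectory[OF \<mu> s x \<omega>, of "\<lambda>z. t - s z", simplified]
  show ?thesis by measurable
qed

lemma measurable_killed:
  assumes \<mu>: "\<mu> \<in> measure_flows" and s: "s \<in> borel_measurable N" "\<And>z. z \<in> space N \<Longrightarrow> 0 \<le> s z"
    and x: "x \<in> N \<rightarrow>\<^sub>M borel" and f: "f \<in> borel_measurable borel"
  shows "(\<lambda>z. killed \<mu> f t n (s z) (x z)) \<in> borel_measurable N"
proof -
  interpret S: prob_space mark_space by (rule prob_space_mark_space)
  note [measurable] = s(1) x
  show ?thesis unfolding killed_def
    by (rule S.borel_measurable_nn_integral, unfold split_beta, rule measurable_killed_integrand[OF \<mu>])
      (use s(2) f in \<open>auto simp: space_pair_measure\<close>)
qed

lemma measurable_killed_state: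
  assumes "\<mu> \<in> measure_flows" "0 \<le> s" "f \<in> borel_measurable borel"
  shows "killed \<mu> f t n s \<in> borel_measurable borel"
  by (rule measurable_killed) (use assms in auto)

lemma killed_0: "0 \<le> t - s \<Longrightarrow> killed \<mu> f t 0 s x = 0"
  unfolding killed_def by simp

text \<open>The value at time \<open>s\<close> is \<open>x\<close> itself, not \<open>H x u 0\<close>; the two agree for almost all \<open>u\<close>.\<close>

lemma killed_Suc:
  assumes \<mu>: "\<mu> \<in> measure_flows" and s: "0 \<le> s" "s \<le> t" and f: "f \<in> borel_measurable borel"
    and start: "\<And>x. AE u in unit_uniform. H x u 0 = x"
  shows "killed \<mu> f t (Suc n) s x = (\<integral>\<^sup>+a. \<integral>\<^sup>+u. (if t - s < a / l then f (H x u (t - s))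
      else jump_operator (\<mu> (s + a / l)) (killed \<mu> f t n (s + a / l)) (H x u (a / l)))
      \<partial>unit_uniform \<partial>exponential_law)"
proof -
  interpret U: prob_space unit_uniform by (rule prob_space_unit_uniform)
  interpret S: prob_space mark_space by (rule prob_space_mark_space)
  let ?F = "\<lambda>\<omega>. if t - s < jump_time l \<omega> (Suc n) then f (trajectory (shift_flow s \<mu>) x \<omega> (t - s)) else 0"
  have meas: "?F \<in> borel_measurable mark_space"
    by (rule measurable_killed_integrand[OF \<mu>]) (use s f in auto)
  have time: "jump_time l (case_nat m \<omega>) (Suc n) = fst m / l + jump_time l \<omega> n" for m \<omega> n
    by (induction n) auto
  show ?thesis
    unfolding killed_def[of \<mu> f t "Suc n"] nn_integral_first_mark[OF meas]
  proof (rule nn_integral_cong, rule nn_integral_cong_AE)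
    fix a assume "a \<in> space exponential_law"
    then have a: "0 \<le> a" by (simp add: space_exponential_law)
    have *: "(\<integral>\<^sup>+\<omega>. ?F (case_nat (a, u, v, w) \<omega>) \<partial>mark_space) =
      (if t - s < a / l then f (H x u (t - s))
       else killed \<mu> f t n (s + a / l) (jump (\<mu> (s + a / l)) (H x u (a / l)) v w))"
      if u: "H x u 0 = x" for u v w
    proof -
      have "(\<integral>\<^sup>+\<omega>. ?F (case_nat (a, u, v, w) \<omega>) \<partial>mark_space) = (\<integral>\<^sup>+\<omega>. (if t - s < a / l then f (H x u (t - s))
         else if t - (s + a / l) < jump_time l \<omega> n then
           f (trajectory (shift_flow (s + a / l) \<mu>) (jump (\<mu> (s + a / l)) (H x u (a / l)) v w) \<omega> (t - (s + a / l)))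
           else 0) \<partial>mark_space)"
      proof (rule nn_integral_cong)
        fix \<omega> assume \<omega>: "\<omega> \<in> space mark_space"
        have nn: "0 \<le> jump_time l \<omega> n" by (rule jump_time_nonneg[OF \<omega> l_pos])
        have assoc: "t - (s + a / l) = t - s - a / l" by simp
        show "?F (case_nat (a, u, v, w) \<omega>) = (if t - s < a / l then f (H x u (t - s))
         else if t - (s + a / l) < jump_time l \<omega> n then
           f (trajectory (shift_flow (s + a / l) \<mu>) (jump (\<mu> (s + a / l)) (H x u (a / l)) v w) \<omega> (t - (s + a / l)))
           else 0)"
        proof (cases "t - s < jump_time l (case_nat (a, u, v, w) \<omega>) (Suc n)")
          case True
          then show ?thesis
            using u s trajectory_first_mark[OF \<omega> a s(1) _ True, of \<mu> x]
            by (auto simp: time assoc simp del: jump_time.simps)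
        next
          case False
          then show ?thesis using nn by (auto simp: time assoc simp del: jump_time.simps)
        qed
      qed
      then show ?thesis
        by (simp add: killed_def S.emeasure_space_1)
    qed
    show "AE u in unit_uniform. (\<integral>\<^sup>+v. \<integral>\<^sup>+w. \<integral>\<^sup>+\<omega>. ?F (case_nat (a, u, v, w) \<omega>) \<partial>mark_space \<partial>unit_uniform \<partial>unit_uniform) =
      (if t - s < a / l then f (H x u (t - s))
       else jump_operator (\<mu> (s + a / l)) (killed \<mu> f t n (s + a / l)) (H x u (a / l)))"
      using start[of x]
      by eventually_elim (simp add: * jump_operator_def U.emeasure_space_1 del: jump_time.simps)
  qed
qed

text \<open>Almost surely finitely many marks are used up to time \<open>t\<close>, so that monotone convergence
  recovers the kernel from the killed expectations.\<close>

lemma nn_integral_kernel: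
  assumes \<mu>: "\<mu> \<in> measure_flows" and f: "f \<in> borel_measurable borel"
  shows "(\<integral>\<^sup>+y. f y \<partial>kernel \<mu> 0 t x) = (SUP n. killed \<mu> f t n 0 x)"
proof -
  let ?F = "\<lambda>n \<omega>. if t < jump_time l \<omega> n then f (trajectory (shift_flow 0 \<mu>) x \<omega> t) else 0"
  have traj: "(\<lambda>\<omega>. trajectory (shift_flow 0 \<mu>) x \<omega> t) \<in> mark_space \<rightarrow>\<^sub>M borel"
    by (rule measurable_trajectory[OF \<mu>]) auto
  have F: "?F n \<in> borel_measurable mark_space" for n
  proof -
    note [measurable] = traj f
    have [measurable]: "(\<lambda>\<omega>. jump_time l \<omega> n) \<in> borel_measurable mark_space"
      by (rule measurable_jump_time) simp
    show ?thesis by measurable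
  qed
  have "(\<integral>\<^sup>+y. f y \<partial>kernel \<mu> 0 t x) = (\<integral>\<^sup>+\<omega>. f (trajectory (shift_flow 0 \<mu>) x \<omega> t) \<partial>mark_space)"
    unfolding jump_kernel_def by (subst nn_integral_distr) (use traj f in auto)
  also have "\<dots> = (\<integral>\<^sup>+\<omega>. (SUP n. ?F n \<omega>) \<partial>mark_space)"
  proof (rule nn_integral_cong_AE)
    show "AE \<omega> in mark_space. f (trajectory (shift_flow 0 \<mu>) x \<omega> t) = (SUP n. ?F n \<omega>)"
      using AE_jump_time_unbounded[OF l_pos, of t]
    proof eventually_elim
      case (elim \<omega>)
      then obtain n where "t < jump_time l \<omega> n" by blast
      then have "f (trajectory (shift_flow 0 \<mu>) x \<omega> t) = ?F n \<omega>" by simp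
      then show ?case
        by (intro antisym SUP_upper2[of n] SUP_least) auto
    qed
  qed
  also have "\<dots> = (SUP n. integral\<^sup>N mark_space (\<lambda>\<omega>. if \<omega> \<in> space mark_space then ?F n \<omega> else 0))"
  proof (subst nn_integral_monotone_convergence_SUP[symmetric])
    show "incseq (\<lambda>n \<omega>. if \<omega> \<in> space mark_space then ?F n \<omega> else 0)"
    proof (intro incseq_SucI le_funI)
      fix n \<omega>
      show "(if \<omega> \<in> space mark_space then ?F n \<omega> else 0) \<le> (if \<omega> \<in> space mark_space then ?F (Suc n) \<omega> else 0)"
        using jump_time_mono[of \<omega> l n "Suc n"] l_pos by (auto simp del: jump_time.simps)
    qed
    show "(\<lambda>\<omega>. if \<omega> \<in> space mark_space then ?F n \<omega> else 0) \<in> borel_measurable mark_space" for n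
      using F[of n] by (subst measurable_cong[where g="?F n"]) auto
    show "(\<integral>\<^sup>+\<omega>. (SUP n. ?F n \<omega>) \<partial>mark_space)
      = (\<integral>\<^sup>+\<omega>. (SUP n. if \<omega> \<in> space mark_space then ?F n \<omega> else 0) \<partial>mark_space)"
      by (intro nn_integral_cong) simp
  qed
  also have "\<dots> = (SUP n. killed \<mu> f t n 0 x)"
    unfolding killed_def by (intro SUP_cong refl nn_integral_cong) simp
  finally show ?thesis .
qed

end

section \<open>Integrals over an exponential time\<close>

lemma nn_integral_exponential_law_interval:
  assumes f: "f \<in> borel_measurable borel" and "0 \<le> r"
    and F: "\<And>a. 0 \<le> a \<Longrightarrow> a \<le> r \<Longrightarrow> DERIV F a :> exp (- a) * f a" and nonneg: "\<And>a. 0 \<le> f a"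
  shows "(\<integral>\<^sup>+a. ennreal (f a) * indicator {..r} a \<partial>exponential_law) = ennreal (F r - F 0)"
proof -
  have "(\<integral>\<^sup>+a. ennreal (f a) * indicator {..r} a \<partial>exponential_law)
    = (\<integral>\<^sup>+a. ennreal (exp (- a) * f a) * indicator {0..r} a \<partial>lborel)"
    using f nonneg
    by (subst nn_integral_exponential_law) (auto intro!: nn_integral_cong simp: indicator_def ennreal_mult)
  also have "\<dots> = ennreal (F r - F 0)"
    using assms by (intro nn_integral_FTC_Icc) auto
  finally show ?thesis .
qed

lemma exponential_law_tail:
  assumes "0 \<le> r"
  shows "emeasure exponential_law {r<..} \<le> ennreal (exp (- r))"
proof -
  have "emeasure exponential_law {r<..} = (\<integral>\<^sup>+a. indicator {r<..} a \<partial>exponential_law)"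
    using assms by (subst nn_integral_indicator) (auto simp: sets_exponential_law sets_restrict_space_iff)
  also have "\<dots> \<le> (\<integral>\<^sup>+a. ennreal (exp (- a)) * indicator {r..} a \<partial>lborel)"
    using assms by (subst nn_integral_exponential_law) (auto intro!: nn_integral_mono simp: indicator_def)
  also have "\<dots> = ennreal (0 - (- exp (- r)))"
  proof (rule nn_integral_FTC_atLeast)
    show "DERIV (\<lambda>a. - exp (- a)) a :> exp (- a)" for a :: real
      by (auto intro!: derivative_eq_intros)
    have "((\<lambda>a. exp (- a :: real)) \<longlongrightarrow> 0) at_top"
      by (rule filterlim_compose[OF exp_at_bot filterlim_uminus_at_bot_at_top])
    then show "((\<lambda>a. - exp (- a :: real)) \<longlongrightarrow> 0) at_top"
      using tendsto_minus by fastforce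
  qed auto
  finally show ?thesis by simp
qed

text \<open>A quantity that grows at rate \<open>\<kappa>\<close> and is multiplied by \<open>\<gamma>\<close> at each point of a Poisson process
  of rate \<open>l\<close> has a mean that grows at rate \<open>b\<close>; this is the first-point decomposition of the
  mean, and it closes the induction in the growth estimate.\<close>

lemma exponential_law_growth:
  fixes l \<kappa> \<gamma> \<tau> :: real
  assumes "0 < l" "1 \<le> \<gamma>" "0 \<le> \<tau>"
  defines "b \<equiv> \<kappa> + l * (\<gamma> - 1)"
  shows "(\<integral>\<^sup>+a. (if \<tau> < a / l then ennreal (exp (\<kappa> * \<tau>))
      else ennreal (\<gamma> * exp (b * (\<tau> - a / l)) * exp (\<kappa> * (a / l)))) \<partial>exponential_law)
    \<le> ennreal (exp (b * \<tau>))"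
proof -
  define f where "f a = \<gamma> * exp (b * (\<tau> - a / l)) * exp (\<kappa> * (a / l))" for a
  have [measurable]: "f \<in> borel_measurable borel" unfolding f_def by measurable
  have meas: "g \<in> borel_measurable borel \<Longrightarrow> g \<in> borel_measurable exponential_law" for g :: "real \<Rightarrow> ennreal"
    by (simp add: sets_exponential_law measurable_restrict_space1 cong: measurable_cong_sets)
  have "{l * \<tau><..} \<subseteq> {0..}"
    using mult_nonneg_nonneg[OF less_imp_le[OF assms(1)] assms(3)]
    by (intro subsetI) (metis atLeast_iff greaterThan_iff less_imp_le order_trans)
  then have tail: "{l * \<tau><..} \<in> sets exponential_law"
    by (simp add: sets_exponential_law sets_restrict_space_iff)
  have der: "DERIV (\<lambda>a. - exp (b * \<tau> - \<gamma> * a)) a :> exp (- a) * f a" for a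
  proof -
    have "exp (- a) * f a = \<gamma> * exp (- a + b * (\<tau> - a / l) + \<kappa> * (a / l))"
      unfolding f_def exp_add by (simp only: mult_ac)
    also have "- a + b * (\<tau> - a / l) + \<kappa> * (a / l) = b * \<tau> - \<gamma> * a"
      using assms(1) by (simp add: b_def field_simps)
    finally show ?thesis by (auto intro!: derivative_eq_intros)
  qed
  have iff: "\<tau> < a / l \<longleftrightarrow> l * \<tau> < a" for a using assms(1) by (simp add: field_simps)
  have "(\<integral>\<^sup>+a. (if \<tau> < a / l then ennreal (exp (\<kappa> * \<tau>)) else ennreal (f a)) \<partial>exponential_law)
    = (\<integral>\<^sup>+a. ennreal (exp (\<kappa> * \<tau>)) * indicator {l * \<tau><..} a + ennreal (f a) * indicator {..l * \<tau>} a \<partial>exponential_law)"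
    by (intro nn_integral_cong) (auto simp: iff indicator_def)
  also have "\<dots> = ennreal (exp (\<kappa> * \<tau>)) * emeasure exponential_law {l * \<tau><..}
      + (\<integral>\<^sup>+a. ennreal (f a) * indicator {..l * \<tau>} a \<partial>exponential_law)"
    using tail by (subst nn_integral_add) (auto intro!: meas simp: nn_integral_cmult_indicator)
  also have "(\<integral>\<^sup>+a. ennreal (f a) * indicator {..l * \<tau>} a \<partial>exponential_law)
      = ennreal (- exp (b * \<tau> - \<gamma> * (l * \<tau>)) - - exp (b * \<tau> - \<gamma> * 0))"
    using assms by (intro nn_integral_exponential_law_interval der) (auto simp: f_def)
  also have "ennreal (exp (\<kappa> * \<tau>)) * emeasure exponential_law {l * \<tau><..} + \<dots>
      \<le> ennreal (exp (\<kappa> * \<tau>)) * ennreal (exp (- (l * \<tau>))) + \<dots>"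
    using assms by (intro add_right_mono mult_left_mono exponential_law_tail) auto
  also have "\<dots> = ennreal (exp (\<kappa> * \<tau> + - (l * \<tau>))) + ennreal (exp (b * \<tau>) - exp (b * \<tau> - \<gamma> * (l * \<tau>)))"
    by (simp add: ennreal_mult[symmetric] exp_add[symmetric])
  also have "\<kappa> * \<tau> + - (l * \<tau>) = b * \<tau> - \<gamma> * (l * \<tau>)"
    by (simp add: b_def algebra_simps)
  also have "ennreal (exp (b * \<tau> - \<gamma> * (l * \<tau>))) + ennreal (exp (b * \<tau>) - exp (b * \<tau> - \<gamma> * (l * \<tau>)))
      = ennreal (exp (b * \<tau>))"
    using assms by (subst ennreal_plus[symmetric]) auto
  finally show ?thesis unfolding f_def .
qed

text \<open>As before, but with a source term in place of the event that the first point comes after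
  \<open>\<tau>\<close>. The source makes up for that event: the two terms of the antiderivative \<open>F\<close> cancel at
  \<open>l * \<tau>\<close>.\<close>

lemma exponential_law_comparison:
  fixes l \<kappa> \<gamma> \<tau> \<beta> C :: real
  assumes "0 < l" "1 \<le> \<gamma>" "0 \<le> \<tau>" "0 \<le> C" "0 < \<kappa> + \<beta> - l"
  defines "b \<equiv> \<kappa> + l * (\<gamma> - 1)"
  shows "(\<integral>\<^sup>+a. (if \<tau> < a / l then 0
      else ennreal ((\<gamma> * C * exp (b * (\<tau> - a / l)) + C * ((\<kappa> + \<beta> - l) / l) * exp (\<beta> * (a / l - \<tau>))) * exp (\<kappa> * (a / l))))
        \<partial>exponential_law)
    \<le> ennreal (C * exp (b * \<tau>))"
proof -
  define \<beta>' where "\<beta>' = \<kappa> + \<beta> - l"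
  define f where "f a = (\<gamma> * C * exp (b * (\<tau> - a / l)) + C * (\<beta>' / l) * exp (\<beta> * (a / l - \<tau>))) * exp (\<kappa> * (a / l))" for a
  define F where "F a = C * (exp (\<beta>' * a / l - \<beta> * \<tau>) - exp (b * \<tau> - \<gamma> * a))" for a
  have [measurable]: "f \<in> borel_measurable borel" unfolding f_def by measurable
  have der: "DERIV F a :> exp (- a) * f a" for a
  proof -
    have "exp (- a) * f a = \<gamma> * C * exp (- a + b * (\<tau> - a / l) + \<kappa> * (a / l))
        + C * (\<beta>' / l) * exp (- a + \<beta> * (a / l - \<tau>) + \<kappa> * (a / l))"
      unfolding f_def exp_add by (simp only: distrib_left distrib_right mult_ac)
    also have "- a + b * (\<tau> - a / l) + \<kappa> * (a / l) = b * \<tau> - \<gamma> * a"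
      using assms(1) by (simp add: b_def field_simps)
    also have "- a + \<beta> * (a / l - \<tau>) + \<kappa> * (a / l) = \<beta>' * a / l - \<beta> * \<tau>"
      using assms(1) by (simp add: \<beta>'_def field_simps)
    finally show ?thesis
      unfolding F_def using assms(1) by (auto intro!: derivative_eq_intros simp: algebra_simps)
  qed
  have iff: "\<tau> < a / l \<longleftrightarrow> l * \<tau> < a" for a using assms(1) by (simp add: field_simps)
  have "(\<integral>\<^sup>+a. (if \<tau> < a / l then 0 else ennreal (f a)) \<partial>exponential_law)
    = (\<integral>\<^sup>+a. ennreal (f a) * indicator {..l * \<tau>} a \<partial>exponential_law)"
    by (intro nn_integral_cong) (auto simp: iff indicator_def)
  also have "\<dots> = ennreal (F (l * \<tau>) - F 0)"
    using assms by (intro nn_integral_exponential_law_interval der) (auto simp: f_def \<beta>'_def)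
  also have "\<dots> \<le> ennreal (C * exp (b * \<tau>))"
  proof (rule ennreal_leI)
    have "\<beta>' * (l * \<tau>) / l - \<beta> * \<tau> = b * \<tau> - \<gamma> * (l * \<tau>)"
      using assms(1) by (simp add: \<beta>'_def b_def field_simps)
    then have "F (l * \<tau>) - F 0 = C * exp (b * \<tau>) - C * exp (- (\<beta> * \<tau>))"
      by (simp add: F_def algebra_simps)
    then show "F (l * \<tau>) - F 0 \<le> C * exp (b * \<tau>)" using assms(4) by simp
  qed
  finally show ?thesis unfolding f_def \<beta>'_def .
qed

section \<open>The jump operator in the weighted norm\<close>

locale weighted_jump_construction = jump_construction l lam G H
  for l :: real
    and lam :: "'a::polish_space measure \<Rightarrow> 'a \<Rightarrow> real"
    and G :: "'a measure \<Rightarrow> 'a \<Rightarrow> real \<Rightarrow> 'a"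
    and H :: "'a \<Rightarrow> real \<Rightarrow> real \<Rightarrow> 'a" +
  fixes V :: "'a \<Rightarrow> real" and \<kappa> \<gamma> \<theta> :: real
  assumes V_measurable[measurable]: "V \<in> borel_measurable borel" and V_ge_1: "\<And>x. 1 \<le> V x"
    and \<kappa>_nonneg: "0 \<le> \<kappa>" and \<gamma>_ge_1: "1 \<le> \<gamma>" and \<theta>_nonneg: "0 \<le> \<theta>"
    and lam_nonneg: "\<And>\<nu> x. \<nu> \<in> space (prob_algebra borel) \<Longrightarrow> 0 \<le> lam \<nu> x"
    and lam_le: "\<And>\<nu> x. \<nu> \<in> space (prob_algebra borel) \<Longrightarrow> lam \<nu> x \<le> l"
    and H_start: "\<And>x. AE u in unit_uniform. H x u 0 = x"
    and H_growth: "\<And>x t. 0 \<le> t \<Longrightarrow>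
      (\<integral>\<^sup>+u. ennreal (V (H x u t)) \<partial>unit_uniform) \<le> ennreal (exp (\<kappa> * t) * V x)"
    and G_growth: "\<And>\<nu> x. \<nu> \<in> space (prob_algebra borel) \<Longrightarrow>
      AE u in unit_uniform. V (G \<nu> x u) \<le> \<gamma> * V x"
    and lipschitz: "\<And>\<nu>1 \<nu>2 e f x. \<nu>1 \<in> weighted_probs V \<Longrightarrow> \<nu>2 \<in> weighted_probs V \<Longrightarrow> 0 \<le> e \<Longrightarrow>
      weighted_close V e \<nu>1 \<nu>2 \<Longrightarrow> f \<in> borel_measurable borel \<Longrightarrow> (\<And>x. \<bar>f x\<bar> \<le> 1) \<Longrightarrow>
      lam \<nu>1 x * ((\<integral>w. f (G \<nu>1 x w) \<partial>unit_uniform) - f x)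
        - lam \<nu>2 x * ((\<integral>w. f (G \<nu>2 x w) \<partial>unit_uniform) - f x) \<le> 2 * \<theta> * e"
begin

definition growth_rate :: real where
  "growth_rate = \<kappa> + l * (\<gamma> - 1)"

lemma growth_rate_nonneg: "0 \<le> growth_rate"
  using \<kappa>_nonneg \<gamma>_ge_1 l_pos by (simp add: growth_rate_def)

lemma measurable_jump_operator:
  assumes \<nu>: "\<nu> \<in> N \<rightarrow>\<^sub>M prob_algebra borel" and y: "y \<in> N \<rightarrow>\<^sub>M borel"
    and g: "(\<lambda>p. g (fst p) (snd p)) \<in> borel_measurable (N \<Otimes>\<^sub>M borel)"
  shows "(\<lambda>z. jump_operator (\<nu> z) (g z) (y z)) \<in> borel_measurable N"
proof -
  interpret U: prob_space unit_uniform by (rule prob_space_unit_uniform)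
  have jump[measurable]: "(\<lambda>q. jump (\<nu> (fst (fst q))) (y (fst (fst q))) (snd (fst q)) (snd q))
      \<in> (N \<Otimes>\<^sub>M unit_uniform) \<Otimes>\<^sub>M unit_uniform \<rightarrow>\<^sub>M borel"
    by (intro measurable_jump measurable_compose[OF _ \<nu>] measurable_compose[OF _ y]) measurable
  have "(\<lambda>q. g (fst (fst q)) (jump (\<nu> (fst (fst q))) (y (fst (fst q))) (snd (fst q)) (snd q)))
      \<in> borel_measurable ((N \<Otimes>\<^sub>M unit_uniform) \<Otimes>\<^sub>M unit_uniform)"
    using measurable_compose[OF _ g, of "\<lambda>q. (fst (fst q), jump (\<nu> (fst (fst q))) (y (fst (fst q))) (snd (fst q)) (snd q))"]
    by simp
  then show ?thesis
    unfolding jump_operator_def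
    by (intro U.borel_measurable_nn_integral) (simp add: split_beta' U.borel_measurable_nn_integral)
qed

lemma measurable_G:
  assumes "\<nu> \<in> space (prob_algebra borel)"
  shows "G \<nu> y \<in> unit_uniform \<rightarrow>\<^sub>M borel"
proof -
  have [measurable]: "(\<lambda>w. w) \<in> unit_uniform \<rightarrow>\<^sub>M restrict_space borel {0..1}"
    by (rule measurable_from_unit_uniform) simp
  show ?thesis
    using measurable_compose[OF _ G_measurable, of "\<lambda>w. (\<nu>, y, w)" unit_uniform] assms by simp
qed

lemma jump_operator_eq:
  assumes \<nu>: "\<nu> \<in> space (prob_algebra borel)"
  shows "jump_operator \<nu> g y = ennreal (lam \<nu> y / l) * (\<integral>\<^sup>+w. g (G \<nu> y w) \<partial>unit_uniform)
    + ennreal (1 - lam \<nu> y / l) * g y"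
proof -
  interpret U: prob_space unit_uniform by (rule prob_space_unit_uniform)
  define p where "p = lam \<nu> y / l"
  have p: "0 \<le> p" "p \<le> 1"
    using lam_nonneg[OF \<nu>, of y] lam_le[OF \<nu>, of y] l_pos by (auto simp: p_def)
  have sets: "{0..p} \<in> sets unit_uniform" "{p<..1} \<in> sets unit_uniform"
    using p by (auto simp: sets_unit_uniform sets_restrict_space_iff)
  have "{p<..1} \<subseteq> {0..1}" using p by auto
  then have measure: "emeasure unit_uniform {0..p} = ennreal p" "emeasure unit_uniform {p<..1} = ennreal (1 - p)"
    using p emeasure_restrict_space[of "{0..1}" lborel "{0..p}"]
      emeasure_restrict_space[of "{0..1}" lborel "{p<..1}"]
    by (auto simp: unit_uniform_def)
  have "jump_operator \<nu> g y = (\<integral>\<^sup>+v. (\<integral>\<^sup>+w. g (G \<nu> y w) \<partial>unit_uniform) * indicator {0..p} v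
      + g y * indicator {p<..1} v \<partial>unit_uniform)"
    unfolding jump_operator_def jump_def p_def[symmetric]
    by (intro nn_integral_cong) (auto simp: space_unit_uniform indicator_def U.emeasure_space_1[unfolded space_unit_uniform])
  also have "\<dots> = (\<integral>\<^sup>+w. g (G \<nu> y w) \<partial>unit_uniform) * ennreal p + g y * ennreal (1 - p)"
    using sets by (subst nn_integral_add) (auto simp: nn_integral_cmult_indicator measure)
  finally show ?thesis by (simp add: p_def mult.commute)
qed

lemma jump_operator_growth:
  assumes \<nu>: "\<nu> \<in> space (prob_algebra borel)" and g: "\<And>x. g x \<le> ennreal (C * V x)" and "0 \<le> C"
  shows "jump_operator \<nu> g y \<le> ennreal (\<gamma> * C * V y)"
proof -
  interpret U: prob_space unit_uniform by (rule prob_space_unit_uniform)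
  have Vy: "V y \<le> \<gamma> * V y" using \<gamma>_ge_1 V_ge_1[of y] by simp
  have le: "g z \<le> ennreal (\<gamma> * C * V y)" if "V z \<le> \<gamma> * V y" for z
    using mult_left_mono[OF that \<open>0 \<le> C\<close>] by (intro order_trans[OF g] ennreal_leI) (simp add: mult_ac)
  have "jump_operator \<nu> g y \<le> (\<integral>\<^sup>+v. \<integral>\<^sup>+w. ennreal (\<gamma> * C * V y) \<partial>unit_uniform \<partial>unit_uniform)"
    unfolding jump_operator_def
  proof (rule nn_integral_mono)
    fix v
    show "(\<integral>\<^sup>+w. g (jump \<nu> y v w) \<partial>unit_uniform) \<le> (\<integral>\<^sup>+w. ennreal (\<gamma> * C * V y) \<partial>unit_uniform)"
      using G_growth[OF \<nu>, of y]
      by (intro nn_integral_mono_AE) (auto simp: jump_def le Vy elim!: eventually_mono)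
  qed
  then show ?thesis by (simp add: U.emeasure_space_1)
qed

lemma jump_operator_add_growth:
  assumes \<nu>: "\<nu> \<in> space (prob_algebra borel)" and g[measurable]: "g \<in> borel_measurable borel" and "0 \<le> C"
  shows "jump_operator \<nu> (\<lambda>x. g x + ennreal (C * V x)) y \<le> jump_operator \<nu> g y + ennreal (\<gamma> * C * V y)"
proof -
  note [measurable] = measurable_G[OF \<nu>]
  have "jump_operator \<nu> (\<lambda>x. g x + ennreal (C * V x)) y
      = jump_operator \<nu> g y + jump_operator \<nu> (\<lambda>x. ennreal (C * V x)) y"
    unfolding jump_operator_eq[OF \<nu>] by (subst nn_integral_add) (auto simp: distrib_left add_ac)
  also have "\<dots> \<le> jump_operator \<nu> g y + ennreal (\<gamma> * C * V y)"
    using assms by (intro add_left_mono jump_operator_growth) auto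
  finally show ?thesis .
qed

lemma jump_operator_mono: "(\<And>x. g x \<le> h x) \<Longrightarrow> jump_operator \<nu> g y \<le> jump_operator \<nu> h y"
  unfolding jump_operator_def by (intro nn_integral_mono)

text \<open>The Lipschitz bound concerns bounded functions, while \<open>g\<close> is only bounded by a multiple of
  \<open>V\<close>. But a jump from \<open>y\<close> almost surely leads to the set where \<open>V \<le> \<gamma> * V y\<close>, and outside
  this set \<open>g\<close> may be replaced by 0.\<close>

lemma jump_operator_lipschitz:
  assumes \<nu>1: "\<nu>1 \<in> weighted_probs V" and \<nu>2: "\<nu>2 \<in> weighted_probs V" and e: "0 \<le> e"
    and close: "weighted_close V e \<nu>1 \<nu>2"
    and g[measurable]: "g \<in> borel_measurable borel" and gV: "\<And>x. g x \<le> ennreal (C * V x)" and C: "0 < C"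
  shows "jump_operator \<nu>1 g y \<le> jump_operator \<nu>2 g y + ennreal (2 * \<theta> * e / l * (C * \<gamma> * V y))"
proof -
  interpret U: prob_space unit_uniform by (rule prob_space_unit_uniform)
  define c where "c = C * \<gamma> * V y"
  have c: "0 < c" using C \<gamma>_ge_1 V_ge_1[of y] by (auto simp: c_def intro!: mult_pos_pos)
  define h where "h z = (if V z \<le> \<gamma> * V y then enn2real (g z) / c else 0)" for z
  have h[measurable]: "h \<in> borel_measurable borel" unfolding h_def by measurable
  have g_finite: "g z < top" for z
    using order_le_less_trans[OF gV ennreal_less_top] .
  have h_nonneg: "0 \<le> h z" for z using c by (simp add: h_def)
  have h_le: "h z \<le> 1" for z
  proof (cases "V z \<le> \<gamma> * V y")
    case True
    have "enn2real (g z) \<le> C * V z"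
      using gV[of z] C V_ge_1[of z] by (intro enn2real_leI) auto
    also have "\<dots> \<le> c" using True C by (simp add: c_def)
    finally show ?thesis using c by (simp add: h_def)
  qed (simp add: h_def)
  have g_eq: "g z = ennreal (c * h z)" if "V z \<le> \<gamma> * V y" for z
    using that c g_finite[of z] by (simp add: h_def)
  have op: "jump_operator \<nu> g y = ennreal (c * (lam \<nu> y / l * ((\<integral>w. h (G \<nu> y w) \<partial>unit_uniform) - h y) + h y))"
      "0 \<le> c * (lam \<nu> y / l * ((\<integral>w. h (G \<nu> y w) \<partial>unit_uniform) - h y) + h y)"
    if \<nu>': "\<nu> \<in> weighted_probs V" for \<nu>
  proof -
    have \<nu>: "\<nu> \<in> space (prob_algebra borel)" using \<nu>' by (simp add: weighted_probs_def)
    note [measurable] = measurable_G[OF \<nu>]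
    define p where "p = lam \<nu> y / l"
    have p: "0 \<le> p" "p \<le> 1"
      using lam_nonneg[OF \<nu>, of y] lam_le[OF \<nu>, of y] l_pos by (auto simp: p_def)
    define I where "I = (\<integral>w. h (G \<nu> y w) \<partial>unit_uniform)"
    have "integrable unit_uniform (\<lambda>w. h (G \<nu> y w))"
      using h_nonneg h_le by (intro U.integrable_const_bound[where B=1]) auto
    then have I: "(\<integral>\<^sup>+w. ennreal (c * h (G \<nu> y w)) \<partial>unit_uniform) = ennreal (c * I)"
      using h_nonneg c unfolding I_def by (subst nn_integral_eq_integral) auto
    have "0 \<le> I" unfolding I_def using h_nonneg by (intro Bochner_Integration.integral_nonneg) auto
    have "(\<integral>\<^sup>+w. g (G \<nu> y w) \<partial>unit_uniform) = ennreal (c * I)"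
      unfolding I[symmetric] using G_growth[OF \<nu>, of y]
      by (intro nn_integral_cong_AE) (auto elim!: eventually_mono intro: g_eq)
    moreover have "g y = ennreal (c * h y)"
      using \<gamma>_ge_1 V_ge_1[of y] by (intro g_eq) simp
    ultimately have "jump_operator \<nu> g y = ennreal p * ennreal (c * I) + ennreal (1 - p) * ennreal (c * h y)"
      unfolding jump_operator_eq[OF \<nu>] p_def by simp
    also have "\<dots> = ennreal (p * (c * I) + (1 - p) * (c * h y))"
      using p c \<open>0 \<le> I\<close> h_nonneg[of y] by (simp add: ennreal_mult)
    also have "p * (c * I) + (1 - p) * (c * h y) = c * (p * (I - h y) + h y)"
      by (simp add: algebra_simps)
    finally show "jump_operator \<nu> g y = ennreal (c * (lam \<nu> y / l * ((\<integral>w. h (G \<nu> y w) \<partial>unit_uniform) - h y) + h y))"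
      by (simp add: p_def I_def)
    have "0 \<le> p * (c * I) + (1 - p) * (c * h y)"
      using p c \<open>0 \<le> I\<close> h_nonneg[of y] by simp
    also have "\<dots> = c * (p * (I - h y) + h y)"
      by (simp add: algebra_simps)
    finally show "0 \<le> c * (lam \<nu> y / l * ((\<integral>w. h (G \<nu> y w) \<partial>unit_uniform) - h y) + h y)"
      by (simp add: p_def I_def)
  qed
  have "lam \<nu>1 y * ((\<integral>w. h (G \<nu>1 y w) \<partial>unit_uniform) - h y)
      - lam \<nu>2 y * ((\<integral>w. h (G \<nu>2 y w) \<partial>unit_uniform) - h y) \<le> 2 * \<theta> * e"
    using h_nonneg h_le by (intro lipschitz[OF \<nu>1 \<nu>2 e close h]) auto
  then have "(c / l) * (lam \<nu>1 y * ((\<integral>w. h (G \<nu>1 y w) \<partial>unit_uniform) - h y)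
      - lam \<nu>2 y * ((\<integral>w. h (G \<nu>2 y w) \<partial>unit_uniform) - h y)) \<le> (c / l) * (2 * \<theta> * e)"
    using c l_pos by (intro mult_left_mono) auto
  then have "c * (lam \<nu>1 y / l * ((\<integral>w. h (G \<nu>1 y w) \<partial>unit_uniform) - h y) + h y)
    \<le> c * (lam \<nu>2 y / l * ((\<integral>w. h (G \<nu>2 y w) \<partial>unit_uniform) - h y) + h y) + 2 * \<theta> * e / l * c"
    by (simp add: algebra_simps diff_divide_distrib)
  then have "jump_operator \<nu>1 g y
    \<le> ennreal (c * (lam \<nu>2 y / l * ((\<integral>w. h (G \<nu>2 y w) \<partial>unit_uniform) - h y) + h y) + 2 * \<theta> * e / l * c)"
    unfolding op(1)[OF \<nu>1] by (rule ennreal_leI)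
  also have "\<dots> = jump_operator \<nu>2 g y + ennreal (2 * \<theta> * e / l * c)"
    unfolding op(1)[OF \<nu>2] using op(2)[OF \<nu>2] \<theta>_nonneg e l_pos c by (subst ennreal_plus) auto
  finally show ?thesis unfolding c_def .
qed

section \<open>Growth and comparison of the kernels\<close>


lemma nn_integral_H_growth:
  assumes "0 \<le> C" "0 \<le> r"
  shows "(\<integral>\<^sup>+u. ennreal (C * V (H x u r)) \<partial>unit_uniform) \<le> ennreal (C * exp (\<kappa> * r)) * ennreal (V x)"
proof -
  have [measurable]: "(\<lambda>u. H x u r) \<in> unit_uniform \<rightarrow>\<^sub>M borel"
    by (intro measurable_H) auto
  have "(\<integral>\<^sup>+u. ennreal (C * V (H x u r)) \<partial>unit_uniform) = ennreal C * (\<integral>\<^sup>+u. ennreal (V (H x u r)) \<partial>unit_uniform)"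
    using assms(1) V_ge_1 order_trans[OF zero_le_one V_ge_1]
    by (subst nn_integral_cmult[symmetric]) (auto intro!: nn_integral_cong simp: ennreal_mult)
  also have "\<dots> \<le> ennreal C * ennreal (exp (\<kappa> * r) * V x)"
    by (intro mult_left_mono H_growth assms) simp
  also have "\<dots> = ennreal (C * exp (\<kappa> * r)) * ennreal (V x)"
    using assms(1) order_trans[OF zero_le_one V_ge_1[of x]] by (simp add: ennreal_mult[symmetric] mult.assoc)
  finally show ?thesis .
qed

text \<open>Between the marks \<open>V\<close> grows at most at the exponential rate \<open>\<kappa>\<close>, and each of the marks, which
  come at rate \<open>l\<close>, multiplies it by \<open>\<gamma>\<close> at most.\<close>

lemma killed_growth:
  assumes \<mu>: "\<mu> \<in> measure_flows" and f: "f \<in> borel_measurable borel" "\<And>x. f x \<le> ennreal (V x)"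
    and "0 \<le> s" "s \<le> t"
  shows "killed \<mu> f t n s x \<le> ennreal (exp (growth_rate * (t - s)) * V x)"
  using assms(4,5)
proof (induction n arbitrary: s x)
  case 0
  then show ?case by (simp add: killed_0)
next
  case (Suc n)
  define \<tau> where "\<tau> = t - s"
  have \<tau>: "0 \<le> \<tau>" using Suc.prems by (simp add: \<tau>_def)
  define h where "h a = (if \<tau> < a / l then ennreal (exp (\<kappa> * \<tau>))
      else ennreal (\<gamma> * exp (growth_rate * (\<tau> - a / l)) * exp (\<kappa> * (a / l))))" for a
  have h: "h \<in> borel_measurable exponential_law"
    unfolding h_def by (rule measurable_exponential_law_from_borel) measurable
  have "killed \<mu> f t (Suc n) s x \<le> (\<integral>\<^sup>+a. h a * ennreal (V x) \<partial>exponential_law)"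
    unfolding killed_Suc[OF \<mu> Suc.prems f(1) H_start] \<tau>_def[symmetric]
  proof (rule nn_integral_mono)
    fix a assume "a \<in> space exponential_law"
    then have a: "0 \<le> a / l" using l_pos by (simp add: space_exponential_law)
    show "(\<integral>\<^sup>+u. (if \<tau> < a / l then f (H x u \<tau>)
        else jump_operator (\<mu> (s + a / l)) (killed \<mu> f t n (s + a / l)) (H x u (a / l))) \<partial>unit_uniform)
      \<le> h a * ennreal (V x)"
    proof (cases "\<tau> < a / l")
      case True
      have "(\<integral>\<^sup>+u. f (H x u \<tau>) \<partial>unit_uniform) \<le> (\<integral>\<^sup>+u. ennreal (1 * V (H x u \<tau>)) \<partial>unit_uniform)"
        using f(2) by (intro nn_integral_mono) simp
      also have "\<dots> \<le> ennreal (1 * exp (\<kappa> * \<tau>)) * ennreal (V x)"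
        using \<tau> by (intro nn_integral_H_growth) auto
      finally show ?thesis using True by (simp add: h_def)
    next
      case False
      have "jump_operator (\<mu> (s + a / l)) (killed \<mu> f t n (s + a / l)) y
          \<le> ennreal (\<gamma> * exp (growth_rate * (\<tau> - a / l)) * V y)" for y
      proof (rule jump_operator_growth)
        show "\<mu> (s + a / l) \<in> space (prob_algebra borel)"
          using a Suc.prems by (intro flow_prob[OF \<mu>]) auto
        show "killed \<mu> f t n (s + a / l) z \<le> ennreal (exp (growth_rate * (\<tau> - a / l)) * V z)" for z
          using Suc.IH[of "s + a / l" z] a Suc.prems False by (simp add: \<tau>_def diff_diff_eq)
      qed simp
      then have "(\<integral>\<^sup>+u. jump_operator (\<mu> (s + a / l)) (killed \<mu> f t n (s + a / l)) (H x u (a / l)) \<partial>unit_uniform)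
        \<le> (\<integral>\<^sup>+u. ennreal (\<gamma> * exp (growth_rate * (\<tau> - a / l)) * V (H x u (a / l))) \<partial>unit_uniform)"
        by (intro nn_integral_mono)
      also have "\<dots> \<le> ennreal (\<gamma> * exp (growth_rate * (\<tau> - a / l)) * exp (\<kappa> * (a / l))) * ennreal (V x)"
        using a \<gamma>_ge_1 by (intro nn_integral_H_growth) auto
      finally show ?thesis using False by (simp add: h_def)
    qed
  qed
  also have "\<dots> = (\<integral>\<^sup>+a. h a \<partial>exponential_law) * ennreal (V x)"
    using h by (rule nn_integral_multc)
  also have "\<dots> \<le> ennreal (exp (growth_rate * \<tau>)) * ennreal (V x)"
    unfolding h_def growth_rate_def
    by (intro mult_right_mono exponential_law_growth l_pos \<gamma>_ge_1 \<tau>) simp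
  also have "\<dots> = ennreal (exp (growth_rate * \<tau>) * V x)"
    using order_trans[OF zero_le_one V_ge_1[of x]] by (simp add: ennreal_mult)
  finally show ?case by (simp add: \<tau>_def)
qed

text \<open>Two flows that are \<open>d * exp (\<beta> * r)\<close>-close at time \<open>r\<close> produce, at each mark, an error that is
  proportional to this distance and to \<open>V\<close>; the error then grows like \<open>V\<close> does. Integrated over the
  time of the mark, the factor \<open>exp (\<beta> * r)\<close> becomes \<open>exp (\<beta> * t)\<close> divided by a constant of order
  \<open>\<beta>\<close>, so that a large \<open>\<beta>\<close> yields a contraction.\<close>

lemma killed_comparison:
  assumes \<mu>: "\<mu> \<in> measure_flows" and \<nu>: "\<nu> \<in> measure_flows"
    and f: "f \<in> borel_measurable borel" "\<And>x. f x \<le> ennreal (V x)"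
    and \<beta>: "0 < \<kappa> + \<beta> - l" and d: "0 \<le> d"
    and \<mu>V: "\<And>r. 0 \<le> r \<Longrightarrow> r \<le> t \<Longrightarrow> \<mu> r \<in> weighted_probs V"
    and \<nu>V: "\<And>r. 0 \<le> r \<Longrightarrow> r \<le> t \<Longrightarrow> \<nu> r \<in> weighted_probs V"
    and close: "\<And>r. 0 \<le> r \<Longrightarrow> r \<le> t \<Longrightarrow> weighted_close V (d * exp (\<beta> * r)) (\<mu> r) (\<nu> r)"
    and C: "C = 2 * \<theta> * \<gamma> * exp (growth_rate * t) * d / (\<kappa> + \<beta> - l) * exp (\<beta> * t)"
    and "0 \<le> s" "s \<le> t"
  shows "killed \<mu> f t n s x \<le> killed \<nu> f t n s x + ennreal (C * exp (growth_rate * (t - s)) * V x)"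
  using assms(11,12)
proof (induction n arbitrary: s x)
  case 0
  then show ?case by (simp add: killed_0)
next
  case (Suc n)
  interpret U: prob_space unit_uniform by (rule prob_space_unit_uniform)
  have C_nonneg: "0 \<le> C" using \<theta>_nonneg \<gamma>_ge_1 d \<beta> unfolding C by auto
  define \<tau> where "\<tau> = t - s"
  have \<tau>: "0 \<le> \<tau>" using Suc.prems by (simp add: \<tau>_def)
  define c where "c a = \<gamma> * C * exp (growth_rate * (\<tau> - a / l))
    + C * ((\<kappa> + \<beta> - l) / l) * exp (\<beta> * (a / l - \<tau>))" for a
  have c_nonneg: "0 \<le> c a" for a
    using C_nonneg \<gamma>_ge_1 \<beta> l_pos unfolding c_def by (intro add_nonneg_nonneg mult_nonneg_nonneg) auto
  define A where "A a u = (if \<tau> < a / l then f (H x u \<tau>)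
    else jump_operator (\<nu> (s + a / l)) (killed \<nu> f t n (s + a / l)) (H x u (a / l)))" for a u
  define B where "B a u = (if \<tau> < a / l then 0 else ennreal (c a * V (H x u (a / l))))" for a u
  define h where "h a = (if \<tau> < a / l then 0 else ennreal (c a * exp (\<kappa> * (a / l))))" for a
  have h: "h \<in> borel_measurable exponential_law"
    unfolding h_def c_def by (rule measurable_exponential_law_from_borel) measurable
  have time[measurable]: "(\<lambda>z. fst z) \<in> borel_measurable (exponential_law \<Otimes>\<^sub>M unit_uniform)"
    by (rule measurable_from_exponential_law) measurable
  note [measurable] = f(1)
  have [measurable]: "(\<lambda>z. H x (snd z) \<tau>) \<in> exponential_law \<Otimes>\<^sub>M unit_uniform \<rightarrow>\<^sub>M borel"
      "(\<lambda>z. H x (snd z) (fst z / l)) \<in> exponential_law \<Otimes>\<^sub>M unit_uniform \<rightarrow>\<^sub>M borel"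
    by (intro measurable_H; measurable)+
  have [measurable]: "(\<lambda>z. jump_operator (\<nu> (s + fst z / l)) (killed \<nu> f t n (s + fst z / l)) (H x (snd z) (fst z / l)))
      \<in> borel_measurable (exponential_law \<Otimes>\<^sub>M unit_uniform)"
  proof (rule measurable_jump_operator)
    have nonneg: "0 \<le> s + fst z / l" if "z \<in> space (exponential_law \<Otimes>\<^sub>M unit_uniform)" for z
      using that Suc.prems l_pos by (auto simp: space_pair_measure space_exponential_law)
    show "(\<lambda>z. \<nu> (s + fst z / l)) \<in> exponential_law \<Otimes>\<^sub>M unit_uniform \<rightarrow>\<^sub>M prob_algebra borel"
      using nonneg by (intro measurable_flow[OF \<nu>]) auto
    show "(\<lambda>p. killed \<nu> f t n (s + fst (fst p) / l) (snd p))
        \<in> borel_measurable ((exponential_law \<Otimes>\<^sub>M unit_uniform) \<Otimes>\<^sub>M borel)"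
      using nonneg by (intro measurable_killed[OF \<nu>]) (auto simp: space_pair_measure)
  qed measurable
  have A: "(\<lambda>z. A (fst z) (snd z)) \<in> borel_measurable (exponential_law \<Otimes>\<^sub>M unit_uniform)"
    unfolding A_def by measurable
  have B: "(\<lambda>z. B (fst z) (snd z)) \<in> borel_measurable (exponential_law \<Otimes>\<^sub>M unit_uniform)"
    unfolding B_def c_def by measurable
  have step: "jump_operator (\<mu> (s + a / l)) (killed \<mu> f t n (s + a / l)) y
      \<le> jump_operator (\<nu> (s + a / l)) (killed \<nu> f t n (s + a / l)) y + ennreal (c a * V y)"
    if a: "0 \<le> a / l" "a / l \<le> \<tau>" for a y
  proof -
    define r where "r = s + a / l"
    have r: "0 \<le> r" "r \<le> t" "t - r = \<tau> - a / l"
      using a Suc.prems by (auto simp: r_def \<tau>_def)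
    let ?E = "exp (growth_rate * (\<tau> - a / l))"
    have V0: "0 \<le> V y" using V_ge_1[of y] by simp
    have "jump_operator (\<mu> r) (killed \<mu> f t n r) y
        \<le> jump_operator (\<mu> r) (\<lambda>z. killed \<nu> f t n r z + ennreal (C * ?E * V z)) y"
      using Suc.IH[OF r(1,2)] unfolding r(3) by (rule jump_operator_mono)
    also have "\<dots> \<le> jump_operator (\<mu> r) (killed \<nu> f t n r) y + ennreal (\<gamma> * (C * ?E) * V y)"
      using C_nonneg r
      by (intro jump_operator_add_growth flow_prob[OF \<mu>] measurable_killed_state[OF \<nu> _ f(1)]) auto
    also have "jump_operator (\<mu> r) (killed \<nu> f t n r) y
        \<le> jump_operator (\<nu> r) (killed \<nu> f t n r) y + ennreal (2 * \<theta> * (d * exp (\<beta> * r)) / l * (?E * \<gamma> * V y))"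
    proof (rule jump_operator_lipschitz[OF \<mu>V[OF r(1,2)] \<nu>V[OF r(1,2)] _ close[OF r(1,2)]])
      show "killed \<nu> f t n r z \<le> ennreal (?E * V z)" for z
        using killed_growth[OF \<nu> f r(1,2), of n z] unfolding r(3) .
      show "killed \<nu> f t n r \<in> borel_measurable borel"
        by (rule measurable_killed_state[OF \<nu> r(1) f(1)])
    qed (use d in auto)
    also have "ennreal (2 * \<theta> * (d * exp (\<beta> * r)) / l * (?E * \<gamma> * V y))
        \<le> ennreal (C * ((\<kappa> + \<beta> - l) / l) * exp (\<beta> * (a / l - \<tau>)) * V y)"
    proof (rule ennreal_leI)
      have "?E \<le> exp (growth_rate * t)"
        using growth_rate_nonneg a Suc.prems unfolding \<tau>_def by (auto intro: mult_left_mono)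
      then have "2 * \<theta> * (d * exp (\<beta> * r)) / l * (?E * \<gamma> * V y)
          \<le> 2 * \<theta> * (d * exp (\<beta> * r)) / l * (exp (growth_rate * t) * \<gamma> * V y)"
        using \<theta>_nonneg d l_pos \<gamma>_ge_1 V0 by (intro mult_left_mono mult_right_mono) auto
      also have "\<dots> = C * ((\<kappa> + \<beta> - l) / l) * exp (\<beta> * (a / l - \<tau>)) * V y"
      proof -
        have "exp (\<beta> * r) = exp (\<beta> * t) * exp (\<beta> * (a / l - \<tau>))"
          unfolding exp_add[symmetric] r_def \<tau>_def by (simp add: algebra_simps)
        moreover have "2 * \<theta> * (d * (X * Y)) / l * (Z * \<gamma> * v) = 2 * \<theta> * \<gamma> * Z * d / D * X * (D / l) * Y * v"
          if "0 < D" for X Y Z v D :: real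
          using that l_pos by (simp add: field_simps)
        ultimately show ?thesis using \<beta> unfolding C by simp
      qed
      finally show "2 * \<theta> * (d * exp (\<beta> * r)) / l * (?E * \<gamma> * V y)
        \<le> C * ((\<kappa> + \<beta> - l) / l) * exp (\<beta> * (a / l - \<tau>)) * V y" .
    qed
    also have "jump_operator (\<nu> r) (killed \<nu> f t n r) y + ennreal (C * ((\<kappa> + \<beta> - l) / l) * exp (\<beta> * (a / l - \<tau>)) * V y)
        + ennreal (\<gamma> * (C * ?E) * V y) = jump_operator (\<nu> r) (killed \<nu> f t n r) y
        + (ennreal (\<gamma> * (C * ?E) * V y) + ennreal (C * ((\<kappa> + \<beta> - l) / l) * exp (\<beta> * (a / l - \<tau>)) * V y))"
      by (simp only: add_ac)
    also have "ennreal (\<gamma> * (C * ?E) * V y) + ennreal (C * ((\<kappa> + \<beta> - l) / l) * exp (\<beta> * (a / l - \<tau>)) * V y)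
        = ennreal (c a * V y)"
    proof (subst ennreal_plus[symmetric])
      show "ennreal (\<gamma> * (C * ?E) * V y + C * ((\<kappa> + \<beta> - l) / l) * exp (\<beta> * (a / l - \<tau>)) * V y)
          = ennreal (c a * V y)"
        by (simp add: c_def distrib_right mult.assoc)
    qed (use C_nonneg \<gamma>_ge_1 V0 \<beta> l_pos in auto)
    finally show ?thesis unfolding r_def by (simp add: add_left_mono add_right_mono)
  qed
  have "killed \<mu> f t (Suc n) s x \<le> (\<integral>\<^sup>+a. \<integral>\<^sup>+u. A a u + B a u \<partial>unit_uniform \<partial>exponential_law)"
    unfolding killed_Suc[OF \<mu> Suc.prems f(1) H_start] \<tau>_def[symmetric]
  proof (intro nn_integral_mono)
    fix a u assume "a \<in> space exponential_law"
    then have "0 \<le> a / l" using l_pos by (simp add: space_exponential_law)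
    then show "(if \<tau> < a / l then f (H x u \<tau>)
        else jump_operator (\<mu> (s + a / l)) (killed \<mu> f t n (s + a / l)) (H x u (a / l))) \<le> A a u + B a u"
      using step[of a "H x u (a / l)"] by (auto simp: A_def B_def)
  qed
  also have "\<dots> = (\<integral>\<^sup>+a. (\<integral>\<^sup>+u. A a u \<partial>unit_uniform) + (\<integral>\<^sup>+u. B a u \<partial>unit_uniform) \<partial>exponential_law)"
  proof (intro nn_integral_cong nn_integral_add)
    fix a assume a: "a \<in> space exponential_law"
    show "A a \<in> borel_measurable unit_uniform"
      using measurable_compose[OF measurable_Pair1'[OF a] A] by simp
    show "B a \<in> borel_measurable unit_uniform"
      using measurable_compose[OF measurable_Pair1'[OF a] B] by simp
  qed
  also have "\<dots> = (\<integral>\<^sup>+a. \<integral>\<^sup>+u. A a u \<partial>unit_uniform \<partial>exponential_law)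
      + (\<integral>\<^sup>+a. \<integral>\<^sup>+u. B a u \<partial>unit_uniform \<partial>exponential_law)"
    using A B by (intro nn_integral_add U.borel_measurable_nn_integral) (auto simp: split_beta')
  also have "(\<integral>\<^sup>+a. \<integral>\<^sup>+u. A a u \<partial>unit_uniform \<partial>exponential_law) = killed \<nu> f t (Suc n) s x"
    unfolding killed_Suc[OF \<nu> Suc.prems f(1) H_start] A_def \<tau>_def ..
  also have "(\<integral>\<^sup>+a. \<integral>\<^sup>+u. B a u \<partial>unit_uniform \<partial>exponential_law)
      \<le> (\<integral>\<^sup>+a. h a * ennreal (V x) \<partial>exponential_law)"
  proof (rule nn_integral_mono)
    fix a assume "a \<in> space exponential_law"
    then have a: "0 \<le> a / l" using l_pos by (simp add: space_exponential_law)
    show "(\<integral>\<^sup>+u. B a u \<partial>unit_uniform) \<le> h a * ennreal (V x)"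
      using nn_integral_H_growth[OF c_nonneg a, of a x] by (auto simp: B_def h_def)
  qed
  also have "\<dots> = (\<integral>\<^sup>+a. h a \<partial>exponential_law) * ennreal (V x)"
    using h by (rule nn_integral_multc)
  also have "\<dots> \<le> ennreal (C * exp (growth_rate * \<tau>)) * ennreal (V x)"
    unfolding h_def c_def growth_rate_def
    by (intro mult_right_mono exponential_law_comparison l_pos \<gamma>_ge_1 \<tau> \<beta> C_nonneg) simp
  also have "\<dots> = ennreal (C * exp (growth_rate * \<tau>) * V x)"
    using C_nonneg order_trans[OF zero_le_one V_ge_1[of x]] by (simp add: ennreal_mult)
  finally show ?case by (simp add: \<tau>_def add_left_mono)
qed

section \<open>The fixed point\<close>


abbreviation evolve where "evolve m0 \<mu> t \<equiv> m0 \<bind> kernel \<mu> 0 t"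

lemma kernel_growth:
  assumes "\<mu> \<in> measure_flows" "f \<in> borel_measurable borel" "\<And>x. f x \<le> ennreal (V x)" "0 \<le> t"
  shows "(\<integral>\<^sup>+y. f y \<partial>kernel \<mu> 0 t x) \<le> ennreal (exp (growth_rate * t) * V x)"
  using killed_growth[OF assms(1-3), of 0 t]
  by (subst nn_integral_kernel[OF assms(1,2)]) (auto intro!: SUP_least assms(4))

lemma kernel_measurable: "\<mu> \<in> measure_flows \<Longrightarrow> kernel \<mu> 0 t \<in> borel \<rightarrow>\<^sub>M prob_algebra borel"
  by (rule measurable_kernel) auto

lemma evolve_prob:
  assumes "\<mu> \<in> measure_flows" "m0 \<in> space (prob_algebra borel)"
  shows "evolve m0 \<mu> t \<in> space (prob_algebra borel)"
  using prob_space_bind'[OF assms(2) kernel_measurable[OF assms(1)]]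
    sets_bind'[OF assms(2) kernel_measurable[OF assms(1)]] by (simp add: space_prob_algebra)

lemma nn_integral_evolve:
  assumes \<mu>: "\<mu> \<in> measure_flows" and m0: "m0 \<in> space (prob_algebra borel)"
    and f: "f \<in> borel_measurable borel"
  shows "(\<integral>\<^sup>+y. f y \<partial>evolve m0 \<mu> t) = (\<integral>\<^sup>+x. \<integral>\<^sup>+y. f y \<partial>kernel \<mu> 0 t x \<partial>m0)"
  using measurable_prob_algebraD[OF kernel_measurable[OF \<mu>]] in_prob_algebraD(2)[OF m0] f
  by (intro nn_integral_bind[where B=borel]) (simp_all cong: measurable_cong_sets)

lemma evolve_flow:
  assumes \<mu>: "\<mu> \<in> measure_flows" and m0: "m0 \<in> space (prob_algebra borel)"
  shows "(\<lambda>t\<in>{0..}. evolve m0 \<mu> t) \<in> measure_flows"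
proof -
  have "(\<lambda>t. evolve m0 \<mu> t) \<in> restrict_space borel {0..} \<rightarrow>\<^sub>M prob_algebra borel"
  proof (rule measurable_bind_prob_space2)
    show "(\<lambda>t. m0) \<in> restrict_space borel {0..} \<rightarrow>\<^sub>M prob_algebra borel"
      using m0 by simp
    have "(\<lambda>z. kernel \<mu> 0 (fst z) (snd z)) \<in> restrict_space borel {0..} \<Otimes>\<^sub>M borel \<rightarrow>\<^sub>M prob_algebra borel"
      by (rule measurable_kernel[OF \<mu>]) (auto intro!: measurable_compose[OF measurable_fst] measurable_restrict_space1)
    then show "(\<lambda>(t, x). kernel \<mu> 0 t x) \<in> restrict_space borel {0..} \<Otimes>\<^sub>M borel \<rightarrow>\<^sub>M prob_algebra borel"
      by (simp add: split_beta')
  qed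
  then have "(\<lambda>t\<in>{0..}. evolve m0 \<mu> t) \<in> restrict_space borel {0..} \<rightarrow>\<^sub>M prob_algebra borel"
    by (subst measurable_cong[where g="\<lambda>t. evolve m0 \<mu> t"]) (auto simp: space_restrict_space)
  then show ?thesis by (simp add: measure_flows_def)
qed

text \<open>The first mark almost surely comes after time 0.\<close>

lemma evolve_start:
  assumes \<mu>: "\<mu> \<in> measure_flows" and m0: "m0 \<in> space (prob_algebra borel)"
  shows "evolve m0 \<mu> 0 = m0"
proof (rule measure_eqI)
  show sets: "sets (evolve m0 \<mu> 0) = sets m0"
    using evolve_prob[OF assms, of 0] m0 by (simp add: space_prob_algebra)
  fix A assume "A \<in> sets (evolve m0 \<mu> 0)"
  then have A: "A \<in> sets borel"
    using evolve_prob[OF assms, of 0] by (simp add: space_prob_algebra)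
  interpret U: prob_space unit_uniform by (rule prob_space_unit_uniform)
  interpret S: prob_space exponential_law by (rule prob_space_exponential_law)
  have kernel: "(\<integral>\<^sup>+y. indicator A y \<partial>kernel \<mu> 0 0 x) = indicator A x" for x
  proof -
    have "killed \<mu> (indicator A) 0 (Suc n) 0 x = (\<integral>\<^sup>+a. indicator A x \<partial>exponential_law)" for n
      unfolding killed_Suc[OF \<mu> order_refl order_refl borel_measurable_indicator[OF A] H_start]
    proof (rule nn_integral_cong_AE)
      have "(\<integral>\<^sup>+u. indicator A (H x u 0) \<partial>unit_uniform) = (\<integral>\<^sup>+u. indicator A x \<partial>unit_uniform)"
        using H_start[of x] by (intro nn_integral_cong_AE) (auto elim!: eventually_mono)
      then have start: "(\<integral>\<^sup>+u. indicator A (H x u 0) \<partial>unit_uniform) = indicator A x"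
        by (simp add: U.emeasure_space_1)
      show "AE a in exponential_law. (\<integral>\<^sup>+u. (if 0 - 0 < a / l then indicator A (H x u (0 - 0))
        else jump_operator (\<mu> (0 + a / l)) (killed \<mu> (indicator A) 0 n (0 + a / l)) (H x u (a / l))) \<partial>unit_uniform)
        = indicator A x"
        by (rule eventually_mono[OF exponential_law_pos]) (use l_pos in \<open>simp add: start\<close>)
    qed
    then have "killed \<mu> (indicator A) 0 (Suc n) 0 x = indicator A x" for n
      by (simp add: S.emeasure_space_1)
    then have "killed \<mu> (indicator A) 0 n 0 x = (if n = 0 then 0 else indicator A x)" for n
      by (cases n) (auto simp: killed_0)
    then show ?thesis
      unfolding nn_integral_kernel[OF \<mu> borel_measurable_indicator[OF A]]
      by (intro antisym SUP_least SUP_upper2[of 1]) auto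
  qed
  show "emeasure (evolve m0 \<mu> 0) A = emeasure m0 A"
    using nn_integral_evolve[OF assms borel_measurable_indicator[OF A], of 0]
      A sets in_prob_algebraD(2)[OF m0] by (simp add: kernel)
qed

context
  fixes m0 :: "'a measure"
  assumes m0: "m0 \<in> weighted_probs V"
begin

definition initial_moment :: real where
  "initial_moment = enn2real (\<integral>\<^sup>+x. ennreal (V x) \<partial>m0)"

lemma m0_prob: "m0 \<in> space (prob_algebra borel)"
  using m0 by (simp add: weighted_probs_def)

lemma m0_moment: "(\<integral>\<^sup>+x. ennreal (V x) \<partial>m0) = ennreal initial_moment"
  using m0 by (simp add: weighted_probs_def initial_moment_def)

lemma initial_moment_nonneg: "0 \<le> initial_moment"
  by (simp add: initial_moment_def)

lemma nn_integral_moment: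
  assumes "0 \<le> c"
  shows "(\<integral>\<^sup>+x. ennreal (c * V x) \<partial>m0) = ennreal (c * initial_moment)"
proof -
  have [measurable]: "V \<in> borel_measurable m0"
    using in_prob_algebraD(2)[OF m0_prob] by (simp cong: measurable_cong_sets)
  have "(\<integral>\<^sup>+x. ennreal (c * V x) \<partial>m0) = (\<integral>\<^sup>+x. ennreal c * ennreal (V x) \<partial>m0)"
    using assms order_trans[OF zero_le_one V_ge_1] by (intro nn_integral_cong) (simp add: ennreal_mult)
  also have "\<dots> = ennreal (c * initial_moment)"
    using assms initial_moment_nonneg by (simp add: nn_integral_cmult m0_moment ennreal_mult)
  finally show ?thesis .
qed

lemma evolve_growth:
  assumes \<mu>: "\<mu> \<in> measure_flows" and f: "f \<in> borel_measurable borel" "\<And>x. f x \<le> ennreal (V x)" and "0 \<le> t"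
  shows "(\<integral>\<^sup>+y. f y \<partial>evolve m0 \<mu> t) \<le> ennreal (exp (growth_rate * t) * initial_moment)"
proof -
  have "(\<integral>\<^sup>+y. f y \<partial>evolve m0 \<mu> t) \<le> (\<integral>\<^sup>+x. ennreal (exp (growth_rate * t) * V x) \<partial>m0)"
    unfolding nn_integral_evolve[OF \<mu> m0_prob f(1)]
    using assms by (intro nn_integral_mono kernel_growth) auto
  then show ?thesis by (simp add: nn_integral_moment)
qed

lemma evolve_weighted_probs:
  assumes "\<mu> \<in> measure_flows" "0 \<le> t"
  shows "evolve m0 \<mu> t \<in> weighted_probs V"
  using evolve_growth[OF assms(1) _ _ assms(2), of "\<lambda>x. ennreal (V x)"] evolve_prob[OF assms(1) m0_prob, of t]
  by (auto simp: weighted_probs_def intro: order_le_less_trans[OF _ ennreal_less_top])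

text \<open>Contraction by the factor 1/2 for the supremum over \<open>{0..T}\<close> of the distances weighted by
  \<open>exp (- \<beta> * t)\<close>, written in terms of upper bounds for these distances.\<close>

definition contraction_on :: "real \<Rightarrow> real \<Rightarrow> bool" where
  "contraction_on T \<beta> \<longleftrightarrow> (\<forall>\<mu>\<in>measure_flows. \<forall>\<nu>\<in>measure_flows. \<forall>d\<ge>0.
     (\<forall>r\<ge>0. \<mu> r \<in> weighted_probs V \<and> \<nu> r \<in> weighted_probs V) \<longrightarrow>
     (\<forall>r\<in>{0..T}. weighted_close V (d * exp (\<beta> * r)) (\<mu> r) (\<nu> r)) \<longrightarrow>
     (\<forall>t\<in>{0..T}. weighted_close V (d / 2 * exp (\<beta> * t)) (evolve m0 \<mu> t) (evolve m0 \<nu> t)))"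

lemma contraction_onD:
  assumes "contraction_on T \<beta>" "\<mu> \<in> measure_flows" "\<nu> \<in> measure_flows" "0 \<le> d"
    "\<And>r. 0 \<le> r \<Longrightarrow> \<mu> r \<in> weighted_probs V" "\<And>r. 0 \<le> r \<Longrightarrow> \<nu> r \<in> weighted_probs V"
    "\<And>r. 0 \<le> r \<Longrightarrow> r \<le> T \<Longrightarrow> weighted_close V (d * exp (\<beta> * r)) (\<mu> r) (\<nu> r)"
    "0 \<le> t" "t \<le> T"
  shows "weighted_close V (d / 2 * exp (\<beta> * t)) (evolve m0 \<mu> t) (evolve m0 \<nu> t)"
  using assms(1)[unfolded contraction_on_def] assms(2-) by simp

text \<open>The comparison of the kernels, integrated against \<open>m0\<close>, bounds the distance of the images by
  that of the flows times a constant of order \<open>1 / \<beta>\<close> that depends on \<open>T\<close>.\<close>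

lemma evolve_contraction:
  assumes "0 \<le> T"
  obtains \<beta> where "0 \<le> \<beta>" "contraction_on T \<beta>"
proof -
  (* K is the contraction factor of killed_comparison, integrated over m0 and with the growth factors
     taken at time T, multiplied by 2 (kappa + beta - l); so beta >= l + K gives the factor 1/2. *)
  define K where "K = 4 * \<theta> * \<gamma> * exp (growth_rate * T) * exp (growth_rate * T) * initial_moment"
  have K: "0 \<le> K"
    using \<theta>_nonneg \<gamma>_ge_1 initial_moment_nonneg by (simp add: K_def)
  define \<beta> where "\<beta> = l + 1 + K"
  have D: "0 < \<kappa> + \<beta> - l" "K \<le> \<kappa> + \<beta> - l" using K \<kappa>_nonneg by (auto simp: \<beta>_def)
  have one_sided: "(\<integral>\<^sup>+y. f y \<partial>evolve m0 \<mu> t) \<le> (\<integral>\<^sup>+y. f y \<partial>evolve m0 \<nu> t) + ennreal (d / 2 * exp (\<beta> * t))"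
    if \<mu>: "\<mu> \<in> measure_flows" and \<nu>: "\<nu> \<in> measure_flows" and d: "0 \<le> d"
      and \<mu>V: "\<And>r. 0 \<le> r \<Longrightarrow> \<mu> r \<in> weighted_probs V" and \<nu>V: "\<And>r. 0 \<le> r \<Longrightarrow> \<nu> r \<in> weighted_probs V"
      and close: "\<And>r. 0 \<le> r \<Longrightarrow> r \<le> T \<Longrightarrow> weighted_close V (d * exp (\<beta> * r)) (\<mu> r) (\<nu> r)"
      and t: "0 \<le> t" "t \<le> T" and f: "f \<in> borel_measurable borel" "\<And>x. f x \<le> ennreal (V x)"
    for \<mu> \<nu> d t f
  proof -
    define C where "C = 2 * \<theta> * \<gamma> * exp (growth_rate * t) * d / (\<kappa> + \<beta> - l) * exp (\<beta> * t)"
    have C: "0 \<le> C" using \<theta>_nonneg \<gamma>_ge_1 d D by (simp add: C_def)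
    have [measurable]: "(\<lambda>x. \<integral>\<^sup>+y. f y \<partial>kernel \<nu> 0 t x) \<in> borel_measurable m0"
      using nn_integral_measurable_subprob_algebra[OF f(1)] measurable_prob_algebraD[OF kernel_measurable[OF \<nu>, of t]]
        in_prob_algebraD(2)[OF m0_prob]
      by (auto intro: measurable_compose simp: cong: measurable_cong_sets)
    have [measurable]: "V \<in> borel_measurable m0"
      using in_prob_algebraD(2)[OF m0_prob] by (simp cong: measurable_cong_sets)
    have "(\<integral>\<^sup>+y. f y \<partial>kernel \<mu> 0 t x)
        \<le> (\<integral>\<^sup>+y. f y \<partial>kernel \<nu> 0 t x) + ennreal (C * exp (growth_rate * t) * V x)" for x
      unfolding nn_integral_kernel[OF \<mu> f(1)]
    proof (rule SUP_least)
      fix n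
      have "killed \<mu> f t n 0 x \<le> killed \<nu> f t n 0 x + ennreal (C * exp (growth_rate * (t - 0)) * V x)"
        by (rule killed_comparison[OF \<mu> \<nu> f D(1) d \<mu>V \<nu>V close C_def]) (use t in auto)
      also have "\<dots> \<le> (\<integral>\<^sup>+y. f y \<partial>kernel \<nu> 0 t x) + ennreal (C * exp (growth_rate * t) * V x)"
        unfolding nn_integral_kernel[OF \<nu> f(1)] by (intro add_mono SUP_upper) auto
      finally show "killed \<mu> f t n 0 x \<le> (\<integral>\<^sup>+y. f y \<partial>kernel \<nu> 0 t x) + ennreal (C * exp (growth_rate * t) * V x)" .
    qed
    then have "(\<integral>\<^sup>+y. f y \<partial>evolve m0 \<mu> t)
        \<le> (\<integral>\<^sup>+x. (\<integral>\<^sup>+y. f y \<partial>kernel \<nu> 0 t x) + ennreal (C * exp (growth_rate * t) * V x) \<partial>m0)"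
      unfolding nn_integral_evolve[OF \<mu> m0_prob f(1)] by (intro nn_integral_mono)
    also have "\<dots> = (\<integral>\<^sup>+y. f y \<partial>evolve m0 \<nu> t) + ennreal (C * exp (growth_rate * t) * initial_moment)"
      unfolding nn_integral_evolve[OF \<nu> m0_prob f(1)]
      using C by (subst nn_integral_add) (auto simp: nn_integral_moment)
    also have "\<dots> \<le> (\<integral>\<^sup>+y. f y \<partial>evolve m0 \<nu> t) + ennreal (d / 2 * exp (\<beta> * t))"
    proof (intro add_left_mono ennreal_leI)
      have "exp (growth_rate * t) \<le> exp (growth_rate * T)"
        using t growth_rate_nonneg by (simp add: mult_left_mono)
      then have "4 * \<theta> * \<gamma> * exp (growth_rate * t) * exp (growth_rate * t) * initial_moment \<le> K"
        unfolding K_def using \<theta>_nonneg \<gamma>_ge_1 initial_moment_nonneg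
        by (intro mult_right_mono mult_mono) auto
      also note D(2)
      finally have "4 * \<theta> * \<gamma> * exp (growth_rate * t) * exp (growth_rate * t) * initial_moment / (\<kappa> + \<beta> - l) \<le> 1"
        using D(1) by simp
      then have "d / 2 * exp (\<beta> * t) *
          (4 * \<theta> * \<gamma> * exp (growth_rate * t) * exp (growth_rate * t) * initial_moment / (\<kappa> + \<beta> - l))
          \<le> d / 2 * exp (\<beta> * t) * 1"
        using d by (intro mult_left_mono) auto
      then show "C * exp (growth_rate * t) * initial_moment \<le> d / 2 * exp (\<beta> * t)"
        by (simp add: C_def mult_ac)
    qed
    finally show ?thesis .
  qed
  show ?thesis
  proof (rule that)
    show "0 \<le> \<beta>" using K l_pos by (simp add: \<beta>_def)
    have "weighted_close V (d / 2 * exp (\<beta> * t)) (evolve m0 \<mu> t) (evolve m0 \<nu> t)"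
      if *: "\<mu> \<in> measure_flows" "\<nu> \<in> measure_flows" "0 \<le> d"
        "\<And>r. 0 \<le> r \<Longrightarrow> \<mu> r \<in> weighted_probs V" "\<And>r. 0 \<le> r \<Longrightarrow> \<nu> r \<in> weighted_probs V"
        "\<And>r. 0 \<le> r \<Longrightarrow> r \<le> T \<Longrightarrow> weighted_close V (d * exp (\<beta> * r)) (\<mu> r) (\<nu> r)"
        "0 \<le> t" "t \<le> T" for \<mu> \<nu> d t
      unfolding weighted_close_def
      using one_sided[OF *(1-3) *(4) *(5) *(6) *(7,8)]
        one_sided[OF *(2,1,3) *(5) *(4) weighted_close_sym[OF *(6)] *(7,8)] by blast
    then show "contraction_on T \<beta>" unfolding contraction_on_def by auto
  qed
qed

primrec picard :: "nat \<Rightarrow> real \<Rightarrow> 'a measure" where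
  "picard 0 = (\<lambda>t\<in>{0..}. m0)"
| "picard (Suc n) = (\<lambda>t\<in>{0..}. evolve m0 (picard n) t)"

lemma picard_flow: "picard n \<in> measure_flows"
proof (induction n)
  case 0
  show ?case unfolding picard.simps by (rule constant_flow[OF m0_prob])
next
  case (Suc n)
  then show ?case unfolding picard.simps by (rule evolve_flow[OF _ m0_prob])
qed

lemma picard_weighted_probs: "0 \<le> t \<Longrightarrow> picard n t \<in> weighted_probs V"
  using m0 evolve_weighted_probs[OF picard_flow] by (cases n) auto

lemma picard_prob: "0 \<le> t \<Longrightarrow> picard n t \<in> space (prob_algebra borel)"
  using picard_weighted_probs by (auto simp: weighted_probs_def)

lemma weighted_close_of_bounds:
  assumes "\<And>f. f \<in> borel_measurable borel \<Longrightarrow> (\<And>x. f x \<le> ennreal (V x)) \<Longrightarrow> (\<integral>\<^sup>+x. f x \<partial>\<mu>) \<le> ennreal e"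
    "\<And>f. f \<in> borel_measurable borel \<Longrightarrow> (\<And>x. f x \<le> ennreal (V x)) \<Longrightarrow> (\<integral>\<^sup>+x. f x \<partial>\<nu>) \<le> ennreal e"
  shows "weighted_close V e \<mu> \<nu>"
  unfolding weighted_close_def using assms by (auto intro: add_increasing)

text \<open>Successive iterates are at distance \<open>E / 2 ^ n\<close> by the contraction property; the distances of
  the iterates \<open>j\<close> to \<open>k\<close> add up to \<open>2 * E / 2 ^ j - 2 * E / 2 ^ k\<close>.\<close>

lemma picard_cauchy:
  assumes "0 \<le> T"
  obtains E \<beta> where "0 \<le> E" "0 \<le> \<beta>"
    "\<And>j k t. 0 \<le> t \<Longrightarrow> t \<le> T \<Longrightarrow> j \<le> k \<Longrightarrow> weighted_close V (E / 2 ^ j * exp (\<beta> * t)) (picard j t) (picard k t)" "contraction_on T \<beta>"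
proof -
  obtain \<beta> where \<beta>: "0 \<le> \<beta>" and contraction: "contraction_on T \<beta>"
    by (rule evolve_contraction[OF assms])
  define E where "E = exp (growth_rate * T) * initial_moment"
  have E: "0 \<le> E" using initial_moment_nonneg by (simp add: E_def)
  have moment: "(\<integral>\<^sup>+x. f x \<partial>evolve m0 \<mu> t) \<le> ennreal (E * exp (\<beta> * t))"
    if "\<mu> \<in> measure_flows" "0 \<le> t" "t \<le> T" "f \<in> borel_measurable borel" "\<And>x. f x \<le> ennreal (V x)" for \<mu> t f
  proof -
    have "exp (growth_rate * t) * initial_moment \<le> E"
      unfolding E_def using that growth_rate_nonneg initial_moment_nonneg
      by (intro mult_right_mono) (auto simp: mult_left_mono)
    also have "\<dots> \<le> E * exp (\<beta> * t)"
      using E \<beta> that(2) by (simp add: mult_le_cancel_left1)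
    finally show ?thesis
      by (rule order_trans[OF evolve_growth[OF that(1,4,5,2)] ennreal_leI])
  qed
  have successive: "weighted_close V (E / 2 ^ n * exp (\<beta> * t)) (picard n t) (picard (Suc n) t)"
    if "0 \<le> t" "t \<le> T" for n t
    using that
  proof (induction n arbitrary: t)
    case 0
    have "(\<integral>\<^sup>+x. f x \<partial>m0) \<le> ennreal (E * exp (\<beta> * t))"
      if f: "f \<in> borel_measurable borel" "\<And>x. f x \<le> ennreal (V x)" for f
    proof -
      have "(\<integral>\<^sup>+x. f x \<partial>m0) \<le> ennreal (1 * initial_moment)"
        using f(2) by (subst nn_integral_moment[symmetric]) (auto intro!: nn_integral_mono)
      also have "\<dots> \<le> ennreal (E * exp (\<beta> * t))"
      proof (rule ennreal_leI)
        have "1 * initial_moment \<le> E"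
          unfolding E_def using growth_rate_nonneg assms initial_moment_nonneg
          by (intro mult_right_mono) auto
        also have "\<dots> \<le> E * exp (\<beta> * t)"
          using E \<beta> 0(1) by (simp add: mult_le_cancel_left1)
        finally show "1 * initial_moment \<le> E * exp (\<beta> * t)" .
      qed
      finally show ?thesis .
    qed
    then show ?case
      using moment[OF picard_flow[of 0]] 0 by (intro weighted_close_of_bounds) auto
  next
    case (Suc n)
    have "weighted_close V (E / 2 ^ n / 2 * exp (\<beta> * t)) (evolve m0 (picard n) t) (evolve m0 (picard (Suc n)) t)"
      using Suc E by (intro contraction_onD[OF contraction] picard_flow picard_weighted_probs) auto
    then show ?case using Suc.prems by (simp add: mult.commute)
  qed
  have "weighted_close V (2 * E / 2 ^ j * exp (\<beta> * t)) (picard j t) (picard k t)"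
    if t: "0 \<le> t" "t \<le> T" and jk: "j \<le> k" for j k t
  proof -
    have "weighted_close V ((2 * E / 2 ^ j - 2 * E / 2 ^ k) * exp (\<beta> * t)) (picard j t) (picard k t)"
      using jk
    proof (induction k rule: dec_induct)
      case base
      show ?case by (simp add: weighted_close_def)
    next
      case (step k)
      have "2 * E / 2 ^ k \<le> 2 * E / 2 ^ j"
        using step(1) E by (intro divide_left_mono) auto
      then have "weighted_close V ((2 * E / 2 ^ j - 2 * E / 2 ^ k) * exp (\<beta> * t) + E / 2 ^ k * exp (\<beta> * t))
          (picard j t) (picard (Suc k) t)"
        using E by (intro weighted_close_trans[OF step.IH successive[OF t]]) auto
      then show ?case by (simp add: algebra_simps diff_divide_distrib)
    qed
    then show ?thesis
      by (rule weighted_close_mono) (rule mult_right_mono, use E in auto)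
  qed
  then show ?thesis
    using E \<beta> contraction by (intro that[of "2 * E" \<beta>]) auto
qed

text \<open>The limit of the iterates is taken time by time. It has finite moments and is close to the
  iterates uniformly on bounded intervals, so that the contraction property makes its image close
  to the images of the iterates, which are iterates again.\<close>

lemma solution_exists: "\<exists>m. is_solution l lam G H m0 m"
proof -
  have "\<exists>\<mu>. \<mu> \<in> space (prob_algebra borel) \<and>
      (\<forall>A\<in>sets borel. (\<lambda>k. emeasure (picard k t) A) \<longlonglongrightarrow> emeasure \<mu> A)" if t: "0 \<le> t" for t
  proof -
    obtain E \<beta> where E: "0 \<le> E" "0 \<le> \<beta>"
      and cauchy: "\<And>j k r. 0 \<le> r \<Longrightarrow> r \<le> t \<Longrightarrow> j \<le> k \<Longrightarrow>
        weighted_close V (E / 2 ^ j * exp (\<beta> * r)) (picard j r) (picard k r)"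
      and contraction: "contraction_on t \<beta>"
      by (rule picard_cauchy[OF t]) blast
    note cauchy = cauchy[OF t order_refl]
    from halving_tendsto_zero[of E "exp (\<beta> * t)"] obtain \<mu> where "\<mu> \<in> space (prob_algebra borel)"
        "\<And>A. A \<in> sets borel \<Longrightarrow> (\<lambda>k. emeasure (picard k t) A) \<longlonglongrightarrow> emeasure \<mu> A"
      using setwise_limit_exists[of "\<lambda>k. picard k t" V "\<lambda>j. E / 2 ^ j * exp (\<beta> * t)",
          OF picard_prob[OF t] V_ge_1 _ _ cauchy] E by auto
    then show ?thesis by blast
  qed
  then obtain L where L: "\<And>t. 0 \<le> t \<Longrightarrow> L t \<in> space (prob_algebra borel)"
      "\<And>t A. 0 \<le> t \<Longrightarrow> A \<in> sets borel \<Longrightarrow> (\<lambda>k. emeasure (picard k t) A) \<longlonglongrightarrow> emeasure (L t) A"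
    by metis
  define m where "m = restrict L {0..}"
  have m: "m t \<in> space (prob_algebra borel)"
      "A \<in> sets borel \<Longrightarrow> (\<lambda>k. emeasure (picard k t) A) \<longlonglongrightarrow> emeasure (m t) A" if "0 \<le> t" for t A
    using L that by (auto simp: m_def)
  have "m \<in> restrict_space borel {0..} \<rightarrow>\<^sub>M prob_algebra borel"
  proof (rule measurable_prob_algebraI)
    show "prob_space (m t)" if "t \<in> space (restrict_space borel {0..})" for t
      using m(1)[of t] that by (simp add: space_restrict_space space_prob_algebra)
    show "m \<in> restrict_space borel {0..} \<rightarrow>\<^sub>M subprob_algebra borel"
    proof (rule measurable_subprob_algebra)
      fix t :: real assume "t \<in> space (restrict_space borel {0..})"
      then have "m t \<in> space (prob_algebra borel)" using m(1) by (simp add: space_restrict_space)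
      then show "subprob_space (m t)" "sets (m t) = sets borel"
        by (auto simp: space_prob_algebra prob_space_imp_subprob_space)
    next
      fix A :: "'a set" assume A: "A \<in> sets borel"
      have "(\<lambda>t. emeasure (picard k t) A) \<in> borel_measurable (restrict_space borel {0..})" for k
        using picard_flow[of k] A
        by (intro measurable_compose[OF measurable_prob_algebraD measurable_emeasure_subprob_algebra])
          (auto simp: measure_flows_def)
      then show "(\<lambda>t. emeasure (m t) A) \<in> borel_measurable (restrict_space borel {0..})"
        by (rule borel_measurable_LIMSEQ_order[rotated]) (use m(2)[OF _ A] in \<open>auto simp: space_restrict_space\<close>)
    qed
  qed
  then have flow: "m \<in> measure_flows" by (simp add: measure_flows_def m_def)
  have limit: "weighted_close V e (picard j t) (m t)"
    if "0 \<le> t" "\<And>k. j \<le> k \<Longrightarrow> weighted_close V e (picard j t) (picard k t)" for e j t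
    using that m by (intro weighted_close_limit[of "\<lambda>k. picard k t" "m t" "picard j t" j V e] picard_prob) auto
  have V_m: "m t \<in> weighted_probs V" if t: "0 \<le> t" for t
  proof -
    obtain E \<beta> where E: "0 \<le> E" "0 \<le> \<beta>"
      and cauchy: "\<And>j k r. 0 \<le> r \<Longrightarrow> r \<le> t \<Longrightarrow> j \<le> k \<Longrightarrow>
        weighted_close V (E / 2 ^ j * exp (\<beta> * r)) (picard j r) (picard k r)"
      and contraction: "contraction_on t \<beta>"
      by (rule picard_cauchy[OF t]) blast
    have "weighted_close V (E / 2 ^ 0 * exp (\<beta> * t)) (picard 0 t) (m t)"
      by (intro limit t cauchy order_refl)
    then have "(\<integral>\<^sup>+x. ennreal (V x) \<partial>m t) \<le> (\<integral>\<^sup>+x. ennreal (V x) \<partial>picard 0 t) + ennreal (E / 2 ^ 0 * exp (\<beta> * t))"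
      by (rule weighted_closeD(2)) auto
    also have "\<dots> < \<infinity>"
      using picard_weighted_probs[OF t, of 0] by (simp add: weighted_probs_def)
    finally show ?thesis using m(1)[OF t] by (simp add: weighted_probs_def)
  qed
  have fixed: "evolve m0 m t = m t" if t: "0 \<le> t" for t
  proof -
    obtain E \<beta> where E: "0 \<le> E" "0 \<le> \<beta>"
      and cauchy: "\<And>j k r. 0 \<le> r \<Longrightarrow> r \<le> t \<Longrightarrow> j \<le> k \<Longrightarrow>
        weighted_close V (E / 2 ^ j * exp (\<beta> * r)) (picard j r) (picard k r)"
      and contraction: "contraction_on t \<beta>"
      by (rule picard_cauchy[OF t]) blast
    have close: "weighted_close V (E / 2 ^ n * exp (\<beta> * r)) (picard n r) (m r)" if "0 \<le> r" "r \<le> t" for n r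
      using that by (intro limit cauchy) auto
    have "weighted_close V (E / 2 ^ n * exp (\<beta> * t)) (evolve m0 m t) (m t)" for n
    proof -
      have "weighted_close V (E / 2 ^ n / 2 * exp (\<beta> * t)) (evolve m0 (picard n) t) (evolve m0 m t)"
        using E t by (intro contraction_onD[OF contraction] picard_flow flow picard_weighted_probs V_m close) auto
      moreover have "weighted_close V (E / 2 ^ n / 2 * exp (\<beta> * t)) (evolve m0 (picard n) t) (m t)"
        using close[OF t order_refl, of "Suc n"] t by (simp add: mult.commute)
      ultimately have "weighted_close V (E / 2 ^ n / 2 * exp (\<beta> * t) + E / 2 ^ n / 2 * exp (\<beta> * t)) (evolve m0 m t) (m t)"
        using E by (intro weighted_close_trans[OF weighted_close_sym]) auto
      then show ?thesis by (simp add: distrib_right[symmetric])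
    qed
    then show ?thesis
      by (rule eq_of_weighted_close[OF _ V_ge_1 _ halving_tendsto_zero evolve_prob[OF flow m0_prob] m(1)[OF t]])
        (use E in auto)
  qed
  have "m 0 = m0"
    using fixed[of 0] evolve_start[OF flow m0_prob] by simp
  then have "is_solution l lam G H m0 m"
    using flow fixed by (simp add: is_solution_def)
  then show ?thesis by blast
qed

text \<open>Every solution has finite moments, bounded on bounded intervals, because the growth bound of the
  kernels holds for all flows; so the contraction property applies to any two solutions.\<close>

lemma solution_unique:
  assumes "is_solution l lam G H m0 \<mu>" "is_solution l lam G H m0 \<nu>"
  shows "\<mu> = \<nu>"
proof
  have sol: "m \<in> measure_flows \<and> (\<forall>t\<ge>0. evolve m0 m t = m t)" if "is_solution l lam G H m0 m" for m
    using that by (simp add: is_solution_def)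
  note \<mu> = sol[OF assms(1), THEN conjunct1] sol[OF assms(1), THEN conjunct2, rule_format]
  note \<nu> = sol[OF assms(2), THEN conjunct1] sol[OF assms(2), THEN conjunct2, rule_format]
  have wp: "0 \<le> r \<Longrightarrow> \<mu> r \<in> weighted_probs V" "0 \<le> r \<Longrightarrow> \<nu> r \<in> weighted_probs V" for r
    using evolve_weighted_probs[OF \<mu>(1), of r] evolve_weighted_probs[OF \<nu>(1), of r] \<mu>(2)[of r] \<nu>(2)[of r]
    by auto
  fix T :: real
  show "\<mu> T = \<nu> T"
  proof (cases "0 \<le> T")
    case False
    then show ?thesis
      using \<mu>(1) \<nu>(1) by (auto simp: measure_flows_def extensional_def)
  next
    case True
    obtain \<beta> where \<beta>: "0 \<le> \<beta>" "contraction_on T \<beta>"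
      by (rule evolve_contraction[OF True])
    define E where "E = exp (growth_rate * T) * initial_moment"
    have E: "0 \<le> E" using initial_moment_nonneg by (simp add: E_def)
    have close: "weighted_close V (E / 2 ^ n * exp (\<beta> * t)) (\<mu> t) (\<nu> t)" if "0 \<le> t" "t \<le> T" for n t
      using that
    proof (induction n arbitrary: t)
      case 0
      have "exp (growth_rate * t) * initial_moment \<le> E"
        unfolding E_def using 0 growth_rate_nonneg initial_moment_nonneg
        by (intro mult_right_mono) (auto simp: mult_left_mono)
      also have "\<dots> \<le> E * exp (\<beta> * t)"
        using E \<beta> 0 by (simp add: mult_le_cancel_left1)
      finally have le: "ennreal (exp (growth_rate * t) * initial_moment) \<le> ennreal (E * exp (\<beta> * t))"
        by (rule ennreal_leI)
      have "weighted_close V (E * exp (\<beta> * t)) (evolve m0 \<mu> t) (evolve m0 \<nu> t)"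
        by (intro weighted_close_of_bounds order_trans[OF evolve_growth le] \<mu>(1) \<nu>(1) 0)
      then show ?case using 0 \<mu>(2) \<nu>(2) by simp
    next
      case (Suc n)
      have "weighted_close V (E / 2 ^ n / 2 * exp (\<beta> * t)) (evolve m0 \<mu> t) (evolve m0 \<nu> t)"
        using Suc E by (intro contraction_onD[OF \<beta>(2)] \<mu>(1) \<nu>(1) wp) auto
      then show ?case using Suc.prems \<mu>(2) \<nu>(2) by (simp add: mult.commute)
    qed
    show ?thesis
    proof (rule eq_of_weighted_close)
      show "weighted_close V (E / 2 ^ n * exp (\<beta> * T)) (\<mu> T) (\<nu> T)" for n
        using close True by simp
      show "(\<lambda>n. E / 2 ^ n * exp (\<beta> * T)) \<longlonglongrightarrow> 0"
        by (rule halving_tendsto_zero)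
    qed (use E wp True in \<open>auto simp: weighted_probs_def V_ge_1\<close>)
  qed
qed

end

end

section \<open>The moment bound\<close>

text \<open>The right-hand side \<open>c\<close> of the bound solves the integral inequality with equality. If
  \<open>u\<close> exceeds it by at most \<open>D\<close>, then the inequality, in which \<open>u\<close> enters with the factor
  \<open>\<eta>\<close> and is averaged over time, shows that the excess is at most \<open>\<eta> * D\<close>.\<close>

lemma drift_inequality_bound:
  fixes u :: "real \<Rightarrow> ennreal" and \<rho> \<eta> M u0 T :: real
  assumes \<rho>: "0 < \<rho>" and \<eta>: "0 \<le> \<eta>" "\<eta> < 1" and M: "0 \<le> M" and u0: "0 \<le> u0" and D: "0 \<le> D"
    and bounded: "\<And>t. 0 \<le> t \<Longrightarrow> t \<le> T \<Longrightarrow> u t \<le> ennreal D"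
    and ineq: "\<And>t. 0 \<le> t \<Longrightarrow> t \<le> T \<Longrightarrow> u t \<le> ennreal (exp (- \<rho> * t) * u0) +
      ennreal \<rho> * (\<integral>\<^sup>+s\<in>{0..t}. ennreal (exp (\<rho> * (s - t))) * (ennreal \<eta> * u s + ennreal M) \<partial>lborel)"
    and "0 \<le> T"
  shows "u T \<le> ennreal (exp (- \<rho> * (1 - \<eta>) * T) * u0 + (1 - exp (- \<rho> * (1 - \<eta>) * T)) * (M / (1 - \<eta>)))"
proof -
  define c where "c t = exp (- \<rho> * (1 - \<eta>) * t) * u0 + (1 - exp (- \<rho> * (1 - \<eta>) * t)) * (M / (1 - \<eta>))" for t
  have c_nonneg: "0 \<le> c t" if "0 \<le> t" for t
    using that assms unfolding c_def by (intro add_nonneg_nonneg mult_nonneg_nonneg) auto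
  have c_deriv: "DERIV c s :> - \<rho> * (1 - \<eta>) * c s + \<rho> * M" for s
    unfolding c_def using \<eta> by (auto intro!: derivative_eq_intros simp: divide_simps) (simp add: algebra_simps)
  have excess: "u t \<le> ennreal (c t + D * \<eta> ^ n)" if "0 \<le> t" "t \<le> T" for n t
    using that
  proof (induction n arbitrary: t)
    case 0
    have "ennreal D \<le> ennreal (c t + D * \<eta> ^ 0)"
      using c_nonneg[OF 0(1)] by (intro ennreal_leI) simp
    then show ?case using bounded[OF 0] by (rule order_trans[rotated])
  next
    case (Suc n)
    define F where "F s = exp (\<rho> * (s - t)) * (c s + D * \<eta> ^ Suc n)" for s
    define f where "f s = \<rho> * (exp (\<rho> * (s - t)) * (\<eta> * (c s + D * \<eta> ^ n) + M))" for s
    have cont: "continuous_on UNIV c" unfolding c_def by (intro continuous_intros)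
    then have [measurable]: "c \<in> borel_measurable borel" by (rule borel_measurable_continuous_onI)
    have f_nonneg: "0 \<le> f s" if "0 \<le> s" for s
      using c_nonneg[OF that] \<rho> \<eta> M D by (simp add: f_def)
    have "ennreal \<rho> * (\<integral>\<^sup>+s\<in>{0..t}. ennreal (exp (\<rho> * (s - t))) * (ennreal \<eta> * u s + ennreal M) \<partial>lborel)
        \<le> ennreal \<rho> * (\<integral>\<^sup>+s. ennreal (exp (\<rho> * (s - t)) * (\<eta> * (c s + D * \<eta> ^ n) + M)) * indicator {0..t} s \<partial>lborel)"
    proof (intro mult_left_mono nn_integral_mono)
      fix s :: real
      show "ennreal (exp (\<rho> * (s - t))) * (ennreal \<eta> * u s + ennreal M) * indicator {0..t} s
        \<le> ennreal (exp (\<rho> * (s - t)) * (\<eta> * (c s + D * \<eta> ^ n) + M)) * indicator {0..t} s"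
      proof (cases "s \<in> {0..t}")
        case True
        have nonneg: "0 \<le> c s + D * \<eta> ^ n" using c_nonneg[of s] True D \<eta> by simp
        have "ennreal (exp (\<rho> * (s - t))) * (ennreal \<eta> * u s + ennreal M)
          \<le> ennreal (exp (\<rho> * (s - t))) * (ennreal \<eta> * ennreal (c s + D * \<eta> ^ n) + ennreal M)"
          using True Suc.prems by (intro mult_left_mono add_right_mono Suc.IH) auto
        also have "\<dots> = ennreal (exp (\<rho> * (s - t)) * (\<eta> * (c s + D * \<eta> ^ n) + M))"
          using nonneg \<eta> M by (simp add: ennreal_mult)
        finally show ?thesis using True by simp
      qed simp
    qed simp
    also have "\<dots> = (\<integral>\<^sup>+s. ennreal \<rho> * (ennreal (exp (\<rho> * (s - t)) * (\<eta> * (c s + D * \<eta> ^ n) + M)) * indicator {0..t} s) \<partial>lborel)"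
      by (rule nn_integral_cmult[symmetric]) measurable
    also have "\<dots> = (\<integral>\<^sup>+s. ennreal (f s) * indicator {0..t} s \<partial>lborel)"
      using \<rho> by (intro nn_integral_cong) (auto simp: f_def indicator_def ennreal_mult')
    also have "\<dots> = ennreal (F t - F 0)"
    proof (rule nn_integral_FTC_Icc)
      show "f \<in> borel_measurable borel" unfolding f_def by measurable
      fix s assume "s \<in> {0..t}"
      have "DERIV F s :> f s"
        unfolding F_def f_def using c_deriv[of s]
        by (auto intro!: derivative_eq_intros) (simp add: algebra_simps)
      then show "DERIV F s :> f s" "0 \<le> f s" using f_nonneg \<open>s \<in> {0..t}\<close> by auto
    qed (rule Suc.prems)
    finally have "u t \<le> ennreal (exp (- \<rho> * t) * u0) + ennreal (F t - F 0)"
      using order_trans[OF ineq[OF Suc.prems] add_left_mono] by blast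
    also have "\<dots> = ennreal (exp (- \<rho> * t) * u0 + (F t - F 0))"
    proof (rule ennreal_plus[symmetric])
      have "\<And>s. 0 \<le> s \<Longrightarrow> s \<le> t \<Longrightarrow> DERIV F s :> f s"
        unfolding F_def f_def using c_deriv
        by (auto intro!: derivative_eq_intros) (simp add: algebra_simps)
      then show "0 \<le> F t - F 0"
        using DERIV_nonneg_imp_nondecreasing[OF Suc.prems(1), of F] f_nonneg by fastforce
    qed (use u0 in simp)
    also have "\<dots> \<le> ennreal (c t + D * \<eta> ^ Suc n)"
      using D \<eta> by (intro ennreal_leI) (simp add: F_def c_def algebra_simps)
    finally show ?case .
  qed
  have "(\<lambda>n. ennreal (c T + D * \<eta> ^ n)) \<longlonglongrightarrow> ennreal (c T + D * 0)"
    using \<eta> by (intro tendsto_ennrealI tendsto_intros LIMSEQ_power_zero) auto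
  then have "u T \<le> ennreal (c T + D * 0)"
    by (rule LIMSEQ_le_const) (use excess[OF \<open>0 \<le> T\<close> order_refl] in blast)
  then show ?thesis by (simp add: c_def)
qed

lemma (in weighted_jump_construction) solution_moment_bound:
  fixes \<rho> \<eta> M :: real
  assumes m0: "m0 \<in> weighted_probs V" and sol: "is_solution l lam G H m0 m"
    and params: "0 < \<rho>" "0 \<le> \<eta>" "\<eta> < 1" "0 \<le> M"
    and drift: "\<And>x t. 0 \<le> t \<Longrightarrow> (\<integral>\<^sup>+y. ennreal (V y) \<partial>kernel m 0 t x)
      \<le> ennreal (exp (- \<rho> * t) * V x) + ennreal \<rho> * (\<integral>\<^sup>+s\<in>{0..t}. ennreal (exp (\<rho> * (s - t))) *
         (ennreal \<eta> * (\<integral>\<^sup>+y. ennreal (V y) \<partial>m s) + ennreal M) \<partial>lborel)"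
    and t: "0 \<le> t"
  shows "(\<integral>\<^sup>+x. ennreal (V x) \<partial>m t) \<le> ennreal (exp (- \<rho> * (1 - \<eta>) * t)) * (\<integral>\<^sup>+x. ennreal (V x) \<partial>m0) +
    ennreal ((1 - exp (- \<rho> * (1 - \<eta>) * t)) * (M / (1 - \<eta>)))"
proof -
  have flow: "m \<in> measure_flows" and fixed: "\<And>t. 0 \<le> t \<Longrightarrow> evolve m0 m t = m t"
    using sol by (auto simp: is_solution_def)
  interpret m0: prob_space m0 by (rule in_prob_algebraD[OF m0_prob[OF m0]])
  have [measurable]: "V \<in> borel_measurable m0"
    using in_prob_algebraD(2)[OF m0_prob[OF m0]] by (simp cong: measurable_cong_sets)
  let ?u = "\<lambda>t. \<integral>\<^sup>+x. ennreal (V x) \<partial>m t" and ?W = "initial_moment m0"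
  have u0: "0 \<le> ?W" by (rule initial_moment_nonneg[OF m0])
  have "?u t \<le> ennreal (exp (- \<rho> * (1 - \<eta>) * t) * ?W + (1 - exp (- \<rho> * (1 - \<eta>) * t)) * (M / (1 - \<eta>)))"
  proof (rule drift_inequality_bound[OF params u0 _ _ _ t])
    show "0 \<le> exp (growth_rate * t) * ?W" using u0 by simp
    fix s assume s: "0 \<le> s" "s \<le> t"
    have "?u s \<le> ennreal (exp (growth_rate * s) * ?W)"
      using evolve_growth[OF m0 flow _ _ s(1), of "\<lambda>x. ennreal (V x)"] fixed[OF s(1)] by simp
    also have "\<dots> \<le> ennreal (exp (growth_rate * t) * ?W)"
      using s growth_rate_nonneg u0 by (intro ennreal_leI mult_right_mono) (auto simp: mult_left_mono)
    finally show "?u s \<le> ennreal (exp (growth_rate * t) * ?W)" .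
    let ?I = "\<integral>\<^sup>+r\<in>{0..s}. ennreal (exp (\<rho> * (r - s))) * (ennreal \<eta> * ?u r + ennreal M) \<partial>lborel"
    have "?u s = (\<integral>\<^sup>+x. \<integral>\<^sup>+y. ennreal (V y) \<partial>kernel m 0 s x \<partial>m0)"
      using nn_integral_evolve[OF flow m0_prob[OF m0], of "\<lambda>x. ennreal (V x)" s] fixed[OF s(1)] by simp
    also have "\<dots> \<le> (\<integral>\<^sup>+x. ennreal (exp (- \<rho> * s) * V x) + ennreal \<rho> * ?I \<partial>m0)"
      by (intro nn_integral_mono drift s)
    also have "\<dots> = ennreal (exp (- \<rho> * s) * ?W) + ennreal \<rho> * ?I"
      using nn_integral_moment[OF m0, of "exp (- \<rho> * s)"]
      by (subst nn_integral_add) (auto simp: m0.emeasure_space_1)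
    finally show "?u s \<le> ennreal (exp (- \<rho> * s) * ?W) + ennreal \<rho> * ?I" .
  qed
  also have "\<dots> = ennreal (exp (- \<rho> * (1 - \<eta>) * t)) * ennreal ?W
      + ennreal ((1 - exp (- \<rho> * (1 - \<eta>) * t)) * (M / (1 - \<eta>)))"
    using params u0 t by (subst ennreal_plus) (auto simp: ennreal_mult intro!: divide_nonneg_pos mult_nonneg_nonneg)
  finally show ?thesis by (simp add: m0_moment[OF m0])
qed

section \<open>Well-posedness of the nonlinear equation\<close>

theorem theorem2:
  fixes P :: "real \<Rightarrow> 'a::polish_space \<Rightarrow> 'a measure"
    and \<Omega> :: "'a \<Rightarrow> 'w measure"
    and Z :: "'a \<Rightarrow> 'w \<Rightarrow> real \<Rightarrow> 'a"
    and H :: "'a \<Rightarrow> real \<Rightarrow> real \<Rightarrow> 'a"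
    and lam :: "'a measure \<Rightarrow> 'a \<Rightarrow> real"
    and Q :: "'a measure \<Rightarrow> 'a \<Rightarrow> 'a measure"
    and G :: "'a measure \<Rightarrow> 'a \<Rightarrow> real \<Rightarrow> 'a"
    and lam_star :: real
    and V :: "'a \<Rightarrow> real"
    and \<theta> \<rho> t0 \<rho>_star \<alpha> \<eta> M \<gamma>_star :: real
  assumes feller: "feller_semigroup P"
    and process: "\<And>x. associated_process P x (\<Omega> x) (Z x)"
    and H_repr: "is_representation borel skorokhod_borel H
                   (\<lambda>x. distr (\<Omega> x) skorokhod_borel (Z x))"
    and lam_measurable: "(\<lambda>(\<nu>, x). lam \<nu> x) \<in> borel_measurable (prob_algebra borel \<Otimes>\<^sub>M borel)"
    and lam_nonneg: "\<And>\<nu> x. \<nu> \<in> space (prob_algebra borel) \<Longrightarrow> 0 \<le> lam \<nu> x"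
    and Q_kernel: "\<And>\<nu>. \<nu> \<in> space (prob_algebra borel) \<Longrightarrow> Q \<nu> \<in> borel \<rightarrow>\<^sub>M prob_algebra borel"
    and G_repr: "\<And>\<nu>. \<nu> \<in> space (prob_algebra borel) \<Longrightarrow> is_representation borel borel (G \<nu>) (Q \<nu>)"
    and G_measurable: "(\<lambda>(\<nu>, x, u). G \<nu> x u) \<in>
          prob_algebra borel \<Otimes>\<^sub>M (borel \<Otimes>\<^sub>M restrict_space borel {0..1}) \<rightarrow>\<^sub>M borel"
    and lam_star_pos: "lam_star > 0"
    and lam_bound: "\<And>\<nu> x. \<nu> \<in> space (prob_algebra borel) \<Longrightarrow> lam \<nu> x \<le> lam_star"
    and V_measurable: "V \<in> borel_measurable borel"
    and V_ge_1: "\<And>x. V x \<ge> 1"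
    and params: "\<theta> \<ge> 0" "\<rho> > 0" "t0 > 0" "\<alpha> \<in> {0..1}" "\<eta> \<in> {0..<1}" "M \<ge> 1" "\<gamma>_star \<ge> 1"
    and drift: "\<And>\<mu> x t. \<mu> \<in> measure_flows \<Longrightarrow> t \<ge> 0 \<Longrightarrow>
          (\<integral>\<^sup>+y. ennreal (V y) \<partial>jump_kernel lam_star lam G H \<mu> 0 t x)
            \<le> ennreal (exp (- \<rho> * t) * V x) +
              ennreal \<rho> * (\<integral>\<^sup>+s\<in>{0..t}. ennreal (exp (\<rho> * (s - t))) *
                 (ennreal \<eta> * (\<integral>\<^sup>+y. ennreal (V y) \<partial>\<mu> s) + ennreal M) \<partial>lborel) \<and>
          (\<integral>\<^sup>+y. ennreal (V y) \<partial>P t x) \<le> ennreal (exp (\<rho>_star * t) * V x) \<and>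
          (AE u in unit_uniform. V (G (\<mu> t) x u) \<le> \<gamma>_star * V x)"
    and lipschitz: "\<And>\<nu>1 \<nu>2. \<nu>1 \<in> weighted_probs V \<Longrightarrow> \<nu>2 \<in> weighted_probs V \<Longrightarrow>
          (SUP f\<in>unit_test_functions. sup_norm (\<lambda>x.
              lam \<nu>1 x * ((\<integral>y. f y \<partial>Q \<nu>1 x) - f x) - lam \<nu>2 x * ((\<integral>y. f y \<partial>Q \<nu>2 x) - f x)))
            \<le> ennreal \<theta> * weighted_norm_diff V \<nu>1 \<nu>2"
    and doeblin: "\<And>x y. V x + V y \<le> 8 * (1 + M / (1 - \<eta>)) \<Longrightarrow>
          tv_norm_diff (return borel x \<bind> P t0) (return borel y \<bind> P t0)
            \<le> ennreal (2 * (1 - \<alpha>))"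
  shows "\<forall>m0\<in>weighted_probs V.
           (\<exists>!m. is_solution lam_star lam G H m0 m) \<and>
           (\<forall>m. is_solution lam_star lam G H m0 m \<longrightarrow>
              (\<forall>t\<ge>0. (\<integral>\<^sup>+x. ennreal (V x) \<partial>m t)
                 \<le> ennreal (exp (- \<rho> * (1 - \<eta>) * t)) * (\<integral>\<^sup>+x. ennreal (V x) \<partial>m0) +
                   ennreal ((1 - exp (- \<rho> * (1 - \<eta>) * t)) * (M / (1 - \<eta>)))))"
proof -
  have H_path: "H x \<in> unit_uniform \<rightarrow>\<^sub>M skorokhod_borel" for x
  proof -
    have "(\<lambda>u. (x, u)) \<in> unit_uniform \<rightarrow>\<^sub>M borel \<Otimes>\<^sub>M restrict_space borel {0..1}"
      using measurable_from_unit_uniform(2)[of "\<lambda>u. u" unit_uniform] by measurable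
    from measurable_compose[OF this conjunct1[OF H_repr[unfolded is_representation_def]]]
    show ?thesis by simp
  qed
  have H_law: "distr unit_uniform borel (\<lambda>u. H x u t) = P t x" if t: "0 \<le> t" for x t
  proof -
    have Z: "Z x \<in> \<Omega> x \<rightarrow>\<^sub>M skorokhod_borel" "distr (\<Omega> x) borel (\<lambda>\<omega>. Z x \<omega> t) = P t x"
      using process[of x] t by (auto simp: associated_process_def)
    have "distr unit_uniform borel (\<lambda>u. H x u t) = distr (distr unit_uniform skorokhod_borel (H x)) borel (\<lambda>w. w t)"
      by (subst distr_distr[OF measurable_evaluation_at[OF t] H_path]) (simp add: comp_def)
    also have "distr unit_uniform skorokhod_borel (H x) = distr (\<Omega> x) skorokhod_borel (Z x)"
      using H_repr by (simp add: is_representation_def)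
    also have "distr (distr (\<Omega> x) skorokhod_borel (Z x)) borel (\<lambda>w. w t) = P t x"
      using Z(2) by (subst distr_distr[OF measurable_evaluation_at[OF t] Z(1)]) (simp add: comp_def)
    finally show ?thesis .
  qed
  have H_at: "(\<lambda>u. H x u t) \<in> unit_uniform \<rightarrow>\<^sub>M borel" if "0 \<le> t" for x t
    by (rule measurable_compose[OF H_path measurable_evaluation_at[OF that]])
  (* The rate is made nonnegative so that bounds at time t are bounds at all earlier times. *)
  interpret weighted_jump_construction lam_star lam G H V "max \<rho>_star 0" \<gamma>_star \<theta>
  proof
    show "0 < lam_star" by (rule lam_star_pos)
    show "(\<lambda>(x, u). H x u) \<in> borel \<Otimes>\<^sub>M restrict_space borel {0..1} \<rightarrow>\<^sub>M skorokhod_borel"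
      using H_repr by (simp add: is_representation_def)
    show "(\<lambda>(\<nu>, x). lam \<nu> x) \<in> borel_measurable (prob_algebra borel \<Otimes>\<^sub>M borel)"
      by (rule lam_measurable)
    show "(\<lambda>(\<nu>, x, u). G \<nu> x u) \<in> prob_algebra borel \<Otimes>\<^sub>M (borel \<Otimes>\<^sub>M restrict_space borel {0..1}) \<rightarrow>\<^sub>M borel"
      by (rule G_measurable)
    show "V \<in> borel_measurable borel" "\<And>x. 1 \<le> V x" by (rule V_measurable V_ge_1)+
    show "0 \<le> max \<rho>_star 0" "1 \<le> \<gamma>_star" "0 \<le> \<theta>" using params by auto
    show "AE u in unit_uniform. H x u 0 = x" for x
    proof -
      have "P 0 x = return borel x"
        using feller unfolding feller_semigroup_def by blast
      then have "AE y in distr unit_uniform borel (\<lambda>u. H x u 0). y = x"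
        unfolding H_law[OF order_refl] by (simp only:) (subst AE_return, auto)
      then show ?thesis
        by (subst (asm) AE_distr_iff) (auto intro: H_at)
    qed
    show "(\<integral>\<^sup>+u. ennreal (V (H x u t)) \<partial>unit_uniform) \<le> ennreal (exp (max \<rho>_star 0 * t) * V x)"
      if t: "0 \<le> t" for x t
    proof -
      have "(\<integral>\<^sup>+u. ennreal (V (H x u t)) \<partial>unit_uniform) = (\<integral>\<^sup>+y. ennreal (V y) \<partial>P t x)"
        unfolding H_law[OF t, symmetric] using V_measurable
        by (subst nn_integral_distr[OF H_at[OF t]]) auto
      also have "\<dots> \<le> ennreal (exp (\<rho>_star * t) * V x)"
        using drift[OF constant_flow[of "return borel x"] t, of x]
        by (simp add: space_prob_algebra prob_space_return)
      also have "\<dots> \<le> ennreal (exp (max \<rho>_star 0 * t) * V x)"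
        using t V_ge_1[of x] by (intro ennreal_leI mult_right_mono) (auto intro: mult_right_mono)
      finally show ?thesis .
    qed
    show "0 \<le> lam \<nu> x" "lam \<nu> x \<le> lam_star" if "\<nu> \<in> space (prob_algebra borel)" for \<nu> x
      using lam_nonneg lam_bound that by auto
    show "AE u in unit_uniform. V (G \<nu> x u) \<le> \<gamma>_star * V x" if "\<nu> \<in> space (prob_algebra borel)" for \<nu> x
      using drift[OF constant_flow[OF that] order_refl, of x] by simp
    show "lam \<nu>1 x * ((\<integral>w. f (G \<nu>1 x w) \<partial>unit_uniform) - f x)
        - lam \<nu>2 x * ((\<integral>w. f (G \<nu>2 x w) \<partial>unit_uniform) - f x) \<le> 2 * \<theta> * e"
      if \<nu>1: "\<nu>1 \<in> weighted_probs V" and \<nu>2: "\<nu>2 \<in> weighted_probs V" and e: "0 \<le> e"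
        and close: "weighted_close V e \<nu>1 \<nu>2" and f: "f \<in> borel_measurable borel" "\<And>x. \<bar>f x\<bar> \<le> 1"
      for \<nu>1 \<nu>2 e f x
    proof -
      have Q: "(\<integral>y. f y \<partial>Q \<nu> x) = (\<integral>w. f (G \<nu> x w) \<partial>unit_uniform)" if "\<nu> \<in> weighted_probs V" for \<nu>
      proof -
        have \<nu>: "\<nu> \<in> space (prob_algebra borel)" using that by (simp add: weighted_probs_def)
        have pair: "(\<lambda>w. (\<nu>, x, w)) \<in> unit_uniform \<rightarrow>\<^sub>M prob_algebra borel \<Otimes>\<^sub>M (borel \<Otimes>\<^sub>M restrict_space borel {0..1})"
          using \<nu> measurable_from_unit_uniform(2)[of "\<lambda>u. u" unit_uniform] by measurable
        have "G \<nu> x \<in> unit_uniform \<rightarrow>\<^sub>M borel"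
          using measurable_compose[OF pair G_measurable] by simp
        moreover have "distr unit_uniform borel (G \<nu> x) = Q \<nu> x"
          using G_repr[OF \<nu>] by (simp add: is_representation_def)
        ultimately show ?thesis
          using f(1) by (metis integral_distr)
      qed
      let ?A = "\<lambda>\<nu> z. lam \<nu> z * ((\<integral>y. f y \<partial>Q \<nu> z) - f z)"
      (* The operators of the Lipschitz hypothesis are those of the interpretation, with the integral
         against Q written as an expectation of the representation G. *)
      have "f \<in> unit_test_functions"
        using f by (auto simp: unit_test_functions_def sup_norm_def intro!: SUP_least)
      then have "sup_norm (\<lambda>z. ?A \<nu>1 z - ?A \<nu>2 z) \<le> ennreal \<theta> * weighted_norm_diff V \<nu>1 \<nu>2"
        using lipschitz[OF \<nu>1 \<nu>2] by (rule order_trans[OF SUP_upper])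
      also have "\<dots> \<le> ennreal \<theta> * ennreal (2 * e)"
        by (intro mult_left_mono weighted_norm_diff_le close e \<nu>1 \<nu>2) simp
      also have "\<dots> = ennreal (2 * \<theta> * e)"
        using params(1) e by (simp add: ennreal_mult[symmetric] mult_ac)
      finally have "ennreal \<bar>?A \<nu>1 x - ?A \<nu>2 x\<bar> \<le> ennreal (2 * \<theta> * e)"
        unfolding sup_norm_def by (rule order_trans[OF SUP_upper[OF UNIV_I]])
      then have "\<bar>?A \<nu>1 x - ?A \<nu>2 x\<bar> \<le> 2 * \<theta> * e"
        using params(1) e by (simp add: ennreal_le_iff)
      then show ?thesis unfolding Q[OF \<nu>1] Q[OF \<nu>2] by linarith
    qed
  qed
  show ?thesis
  proof (intro ballI conjI allI impI)
    fix m0 :: "'a measure" assume m0: "m0 \<in> weighted_probs V"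
    show "\<exists>!m. is_solution lam_star lam G H m0 m"
      using solution_exists[OF m0] solution_unique[OF m0] by blast
    fix m t assume m: "is_solution lam_star lam G H m0 m" and t: "0 \<le> (t :: real)"
    have "m \<in> measure_flows" using m by (simp add: is_solution_def)
    from drift[OF this, THEN conjunct1]
    show "(\<integral>\<^sup>+x. ennreal (V x) \<partial>m t)
       \<le> ennreal (exp (- \<rho> * (1 - \<eta>) * t)) * (\<integral>\<^sup>+x. ennreal (V x) \<partial>m0) +
         ennreal ((1 - exp (- \<rho> * (1 - \<eta>) * t)) * (M / (1 - \<eta>)))"
      using params t by (intro solution_moment_bound[OF m0 m]) auto
  qed
qed

end
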